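(* Let $\sigma:\Sigma\to\Sigma$ be a topologically mixing countable state Markov shift satisfying the big images and pre-images (BIP) property, let $G$ be a finitely generated group, let $\varphi:\Sigma\to\mathbb{R}$ be locally Hölder continuous and summable, and let $\psi:\Sigma\to G$ satisfy $\psi(x)=\psi(x_1)$, such that Assumptions (I), (II) and (III) (stated in the context) hold. If $P_{\mathrm G}(\varphi,T_\psi)=P_{\mathrm G}(\varphi,T_{\bar\psi})$, then $G$ is amenable.
   Context: Countable state Markov shift: $S$ is a countable set, $A$ an $S\times S$ matrix with entries in $\{0,1\}$, $\Sigma=\{x=(x_i)_{i=1}^\infty: x_i\in S,\ A(x_i,x_{i+1})=1\ \forall i\ge1\}$ with the topology generated by cylinders, $(\sigma x)_i=x_{i+1}$. $\mathcal W_n$ is the set of allowed words $w=(w_1,\dots,w_n)$ ($A(w_i,w_{i+1})=1$), $[w]=\{x\in\Sigma:x_i=w_i,\ 1\le i\le n\}$. BIP: there exist $b_1,\dots,b_N\in S$ such that for all $a\in S$ there are $i,j$ with $A(b_i,a)=1$ and $A(a,b_j)=1$. A countable state Markov shift is topologically mixing if for all states $a,b$ there is $N(a,b)$ such that for every $n\ge N(a,b)$ there is an allowed word $w$ of length $n$ with $awb$ allowed. $\varphi$ is locally Hölder continuous if $\sup_{w\in\mathcal W_n}\sup_{x,y\in[w]}|\varphi(x)-\varphi(y)|\le C\theta^n$ for all $n\ge1$, for some $C>0$, $0<\theta<1$. It is summable if $\sup_{x\in\Sigma}\sum_{\sigma y=x}e^{\varphi(y)}<\infty$. Write $\varphi^n=\sum_{j=0}^{n-1}\varphi\circ\sigma^j$,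 $\psi_n(x)=\psi(x)\psi(\sigma x)\cdots\psi(\sigma^{n-1}x)$. $T_\psi(x,g)=(\sigma x,g\psi(x))$ on $\Sigma\times G$ is a countable state Markov shift with states $S\times G$, a transition $(i,g)\to(j,h)$ being allowed iff $A(i,j)=1$ and $h=g\psi(i)$. $\overline G\cong\mathbb{Z}^d$ is the quotient of the abelianization of $G$ by its torsion subgroup, $\pi:G\to\overline G$ the projection, $\bar\psi=\pi\circ\psi$, identified with a function $f:\Sigma\to\mathbb{Z}^d$; $T_{\bar\psi}(x,m)=(\sigma x,m+\bar\psi(x))$ on $\Sigma\times\overline G$. Gurevič pressures (each independent of the choice of $a\in S$; $e$ is the identity of $G$, $f^n=\sum_{j<n}f\circ\sigma^j$): $P_{\mathrm G}(\varphi,\sigma)$, $P_{\mathrm G}(\varphi,T_\psi)$, $P_{\mathrm G}(\varphi,T_{\bar\psi})$ are the values of $\limsup_{n\to\infty}\frac1n\log\sum e^{\varphi^n(x)}$, where the sum is over $x$ with $\sigma^nx=x$, $x_1=a$ and, respectively, no further condition, $\psi_n(x)=e$, $f^n(x)=0$. Let $\delta=\delta(\varphi,f)=\sup\{r\ge0:\varphi+r|f|\text{ is summable}\}$ ($|\cdot|$ the 2-norm on $\mathbb{R}^d$), $B(\delta)=\{w\in\mathbb{R}^d:|w|<\delta\}$, and $\mathfrak p(w)=P_{\mathrm G}(\varphi+\langle w,f\rangle,\sigma)$ (finite on $B(\delta)$). Assumption (I): $T_\psi$ is topologically mixing. Assumption (II): $\delta(\varphi,f)>0$. Assumption (III): $w\mapsto\mathfrak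 p(w)$ has a unique minimum at a point $\xi\in\mathrm{int}(B(\delta))$. *)

theory Defs
  imports
    "HOL-Analysis.Analysis"
    "HOL-Algebra.Generated_Groups"
    "HOL-Algebra.Product_Groups"
begin

section \<open>Countable state Markov shifts\<close>

text \<open>A 0-1 matrix over the state set \<open>S\<close> is encoded as a predicate \<open>A\<close>, where \<open>A i j\<close> means that
  the entry at \<open>(i, j)\<close> is 1; values of \<open>A\<close> off \<open>S\<close> are irrelevant. Points are sequences indexed
  from 0, so the first coordinate of \<open>x\<close> is \<open>x 0\<close>.\<close>

definition markov_shift :: "'s set \<Rightarrow> ('s \<Rightarrow> 's \<Rightarrow> bool) \<Rightarrow> (nat \<Rightarrow> 's) set" where
  "markov_shift S A = {x. \<forall>i. x i \<in> S \<and> A (x i) (x (Suc i))}"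

definition shift :: "(nat \<Rightarrow> 's) \<Rightarrow> (nat \<Rightarrow> 's)" where
  "shift x = (\<lambda>i. x (Suc i))"

definition words :: "'s set \<Rightarrow> ('s \<Rightarrow> 's \<Rightarrow> bool) \<Rightarrow> nat \<Rightarrow> 's list set" where
  "words S A n = {w. length w = n \<and> set w \<subseteq> S \<and> successively A w}"

definition cylinder :: "'s set \<Rightarrow> ('s \<Rightarrow> 's \<Rightarrow> bool) \<Rightarrow> 's list \<Rightarrow> (nat \<Rightarrow> 's) set" where
  "cylinder S A w = {x \<in> markov_shift S A. \<forall>i<length w. x i = w ! i}"

definition BIP :: "'s set \<Rightarrow> ('s \<Rightarrow> 's \<Rightarrow> bool) \<Rightarrow> bool" where
  "BIP S A \<longleftrightarrow> (\<exists>B. finite B \<and> B \<subseteq> S \<and> (\<forall>a\<in>S. \<exists>b\<in>B. \<exists>b'\<in>B. A b a \<and> A a b'))"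

definition topologically_mixing :: "'s set \<Rightarrow> ('s \<Rightarrow> 's \<Rightarrow> bool) \<Rightarrow> bool" where
  "topologically_mixing S A \<longleftrightarrow>
     (\<forall>a\<in>S. \<forall>b\<in>S. \<exists>N. \<forall>n\<ge>N. \<exists>w\<in>words S A n. a # w @ [b] \<in> words S A (n + 2))"

definition locally_Hoelder :: "'s set \<Rightarrow> ('s \<Rightarrow> 's \<Rightarrow> bool) \<Rightarrow> ((nat \<Rightarrow> 's) \<Rightarrow> real) \<Rightarrow> bool" where
  "locally_Hoelder S A \<phi> \<longleftrightarrow>
     (\<exists>C>0. \<exists>\<theta>. 0 < \<theta> \<and> \<theta> < 1 \<and>
        (\<forall>n\<ge>1. \<forall>w\<in>words S A n. \<forall>x\<in>cylinder S A w. \<forall>y\<in>cylinder S A w.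
           \<bar>\<phi> x - \<phi> y\<bar> \<le> C * \<theta> ^ n))"

definition summable_potential :: "'s set \<Rightarrow> ('s \<Rightarrow> 's \<Rightarrow> bool) \<Rightarrow> ((nat \<Rightarrow> 's) \<Rightarrow> real) \<Rightarrow> bool" where
  "summable_potential S A \<phi> \<longleftrightarrow>
     (SUP x\<in>markov_shift S A.
        \<Sum>\<^sub>\<infinity>y\<in>{y \<in> markov_shift S A. shift y = x}. ennreal (exp (\<phi> y))) < \<infinity>"

definition birkhoff_sum :: "((nat \<Rightarrow> 's) \<Rightarrow> real) \<Rightarrow> nat \<Rightarrow> (nat \<Rightarrow> 's) \<Rightarrow> real" where
  "birkhoff_sum \<phi> n x = (\<Sum>j<n. \<phi> ((shift ^^ j) x))"


section \<open>Group extensions\<close>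

text \<open>A function \<open>\<psi>\<close> on the shift space that depends only on the first coordinate is given as a
  function on states; its value at \<open>x\<close> is \<open>\<psi> (x 0)\<close>.\<close>

primrec cocycle :: "('g, 'm) monoid_scheme \<Rightarrow> ('s \<Rightarrow> 'g) \<Rightarrow> nat \<Rightarrow> (nat \<Rightarrow> 's) \<Rightarrow> 'g" where
  "cocycle G \<psi> 0 x = \<one>\<^bsub>G\<^esub>"
| "cocycle G \<psi> (Suc n) x = cocycle G \<psi> n x \<otimes>\<^bsub>G\<^esub> \<psi> ((shift ^^ n) x 0)"

text \<open>The skew product \<open>T\<^sub>\<psi> (x, g) = (\<sigma> x, g \<psi>(x))\<close>, as a Markov shift with states
  \<open>S \<times> carrier G\<close>.\<close>

definition skew_transition ::
    "('g, 'm) monoid_scheme \<Rightarrow> ('s \<Rightarrow> 's \<Rightarrow> bool) \<Rightarrow> ('s \<Rightarrow> 'g) \<Rightarrow> 's \<times> 'g \<Rightarrow> 's \<times> 'g \<Rightarrow> bool" where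
  "skew_transition G A \<psi> = (\<lambda>(i, g) (j, h). A i j \<and> h = g \<otimes>\<^bsub>G\<^esub> \<psi> i)"

definition skew_mixing ::
    "('g, 'm) monoid_scheme \<Rightarrow> 's set \<Rightarrow> ('s \<Rightarrow> 's \<Rightarrow> bool) \<Rightarrow> ('s \<Rightarrow> 'g) \<Rightarrow> bool" where
  "skew_mixing G S A \<psi> \<longleftrightarrow> topologically_mixing (S \<times> carrier G) (skew_transition G A \<psi>)"


section \<open>Gurevic pressure\<close>

definition ln_ennreal :: "ennreal \<Rightarrow> ereal" where
  "ln_ennreal t = (if t = 0 then -\<infinity> else if t = \<infinity> then \<infinity> else ereal (ln (enn2real t)))"

definition exp_growth :: "(nat \<Rightarrow> ennreal) \<Rightarrow> ereal" where
  "exp_growth Z = limsup (\<lambda>n. ereal (1 / real n) * ln_ennreal (Z n))"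

text \<open>The pressures carry the reference state \<open>a\<close> as an explicit argument; that their values do
  not depend on it is a theorem.\<close>

definition pressure ::
    "'s set \<Rightarrow> ('s \<Rightarrow> 's \<Rightarrow> bool) \<Rightarrow> 's \<Rightarrow> ((nat \<Rightarrow> 's) \<Rightarrow> real) \<Rightarrow> ereal" where
  "pressure S A a \<phi> = exp_growth (\<lambda>n.
     \<Sum>\<^sub>\<infinity>x\<in>{x \<in> markov_shift S A. (shift ^^ n) x = x \<and> x 0 = a}.
       ennreal (exp (birkhoff_sum \<phi> n x)))"

text \<open>The pressure of \<open>\<phi>\<close> with respect to the skew product \<open>T\<^sub>\<psi>\<close> over the group \<open>G\<close>.\<close>

definition skew_pressure ::
    "('g, 'm) monoid_scheme \<Rightarrow> 's set \<Rightarrow> ('s \<Rightarrow> 's \<Rightarrow> bool) \<Rightarrow> ('s \<Rightarrow> 'g) \<Rightarrow> 's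
      \<Rightarrow> ((nat \<Rightarrow> 's) \<Rightarrow> real) \<Rightarrow> ereal" where
  "skew_pressure G S A \<psi> a \<phi> = exp_growth (\<lambda>n.
     \<Sum>\<^sub>\<infinity>x\<in>{x \<in> markov_shift S A. (shift ^^ n) x = x \<and> x 0 = a \<and> cocycle G \<psi> n x = \<one>\<^bsub>G\<^esub>}.
       ennreal (exp (birkhoff_sum \<phi> n x)))"


section \<open>Groups\<close>

definition finitely_generated :: "('g, 'm) monoid_scheme \<Rightarrow> bool" where
  "finitely_generated G \<longleftrightarrow> (\<exists>K. finite K \<and> K \<subseteq> carrier G \<and> generate G K = carrier G)"

definition abelianization :: "('g, 'm) monoid_scheme \<Rightarrow> 'g set monoid" where
  "abelianization G = G Mod derived G (carrier G)"

definition torsion :: "('g, 'm) monoid_scheme \<Rightarrow> 'g set" where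
  "torsion G = {g \<in> carrier G. \<exists>n::nat. n > 0 \<and> g [^]\<^bsub>G\<^esub> n = \<one>\<^bsub>G\<^esub>}"

definition free_abelianization :: "('g, 'm) monoid_scheme \<Rightarrow> 'g set set monoid" where
  "free_abelianization G = abelianization G Mod torsion (abelianization G)"

definition free_abelianization_proj :: "('g, 'm) monoid_scheme \<Rightarrow> 'g \<Rightarrow> 'g set set" where
  "free_abelianization_proj G g =
     torsion (abelianization G) #>\<^bsub>abelianization G\<^esub> (derived G (carrier G) #>\<^bsub>G\<^esub> g)"

text \<open>The group of integer vectors of length \<open>d\<close>; the case \<open>d = 0\<close> is allowed. Elements are
  undefined at indices from \<open>d\<close> on.\<close>

abbreviation int_lattice :: "nat \<Rightarrow> (nat \<Rightarrow> int) monoid" where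
  "int_lattice d \<equiv> product_group {..<d} (\<lambda>_. integer_group)"

text \<open>Amenability of a discrete group: there is a left-invariant mean on the bounded real functions
  on the group. Linearity and positivity force \<open>M u\<close> to depend only on the restriction of \<open>u\<close> to the
  carrier.\<close>

definition amenable :: "('g, 'm) monoid_scheme \<Rightarrow> bool" where
  "amenable G \<longleftrightarrow> (\<exists>M :: ('g \<Rightarrow> real) \<Rightarrow> real.
     (\<forall>u v. bounded (u ` carrier G) \<longrightarrow> bounded (v ` carrier G) \<longrightarrow>
        M (\<lambda>h. u h + v h) = M u + M v) \<and>
     (\<forall>u c. bounded (u ` carrier G) \<longrightarrow> M (\<lambda>h. c * u h) = c * M u) \<and>
     (\<forall>u. bounded (u ` carrier G) \<longrightarrow> (\<forall>h\<in>carrier G. 0 \<le> u h) \<longrightarrow> 0 \<le> M u) \<and>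
     M (\<lambda>_. 1) = 1 \<and>
     (\<forall>u. bounded (u ` carrier G) \<longrightarrow>
        (\<forall>g\<in>carrier G. M (\<lambda>h. u (g \<otimes>\<^bsub>G\<^esub> h)) = M u)))"


section \<open>The drift\<close>

text \<open>Here \<open>f\<close> takes values in \<open>int_lattice d\<close>, and real vectors of length \<open>d\<close> are the points of
  \<^term>\<open>Euclidean_space d\<close>, i.e. sequences vanishing from index \<open>d\<close> on.\<close>

definition delta ::
    "'s set \<Rightarrow> ('s \<Rightarrow> 's \<Rightarrow> bool) \<Rightarrow> nat \<Rightarrow> ((nat \<Rightarrow> 's) \<Rightarrow> real) \<Rightarrow> ('s \<Rightarrow> nat \<Rightarrow> int) \<Rightarrow> ereal" where
  "delta S A d \<phi> f =
     (SUP r \<in> {r. 0 \<le> r \<and>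
         summable_potential S A (\<lambda>x. \<phi> x + r * L2_set (\<lambda>i. real_of_int (f (x 0) i)) {..<d})}.
       ereal r)"

definition delta_ball :: "nat \<Rightarrow> ereal \<Rightarrow> (nat \<Rightarrow> real) set" where
  "delta_ball d \<delta> = {w \<in> topspace (Euclidean_space d). ereal (L2_set w {..<d}) < \<delta>}"

definition tilted_pressure ::
    "'s set \<Rightarrow> ('s \<Rightarrow> 's \<Rightarrow> bool) \<Rightarrow> nat \<Rightarrow> 's \<Rightarrow> ((nat \<Rightarrow> 's) \<Rightarrow> real) \<Rightarrow> ('s \<Rightarrow> nat \<Rightarrow> int)
      \<Rightarrow> (nat \<Rightarrow> real) \<Rightarrow> ereal" where
  "tilted_pressure S A d a \<phi> f w =
     pressure S A a (\<lambda>x. \<phi> x + (\<Sum>i<d. w i * real_of_int (f (x 0) i)))"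

end

theory Submission
  imports Defs "HOL-Library.Omega_Words_Fun"
begin

text \<open>Tilt the potential to \<open>\<Phi> = \<phi> + \<langle>\<xi>, f\<rangle>\<close>. This does not change the pressure of the
  \<open>G\<close>-extension, since a loop with trivial \<open>G\<close>-cocycle has \<open>f\<close>-sum zero.

  The lattice extension has at least the pressure of \<open>\<Phi>\<close>: as \<open>\<xi>\<close> minimises the tilted pressure
  over all of \<open>\<real>\<^sup>d\<close>, some finite set of loops of equal length has a generating function that is
  everywhere at least 1; tilted at its minimiser the loops form a centred random walk, which returns
  to 0 with subexponential probability.

  If \<open>G\<close> is not amenable, the \<open>G\<close>-extension has strictly smaller pressure than \<open>\<Phi>\<close> (Kesten,
  Stadlbauer). The transfer operator acts on vectors in \<open>\<ell>\<^sup>2(G)\<close>; by bounded distortion the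
  vectors at nearby points nearly agree, and without almost invariant vectors their translates by
  different group elements cannot be aligned, so uniform convexity yields a definite loss of norm.
  Finite alphabets, with constants independent of the alphabet, keep all sums finite.\<close>

text \<open>No eigenfunction or conformal measure normalises the operator, so the loss of norm is
  measured against the plain total mass \<open>tot T n x\<close> of the words. One contraction step
  only gains a fixed multiple of the norm at a single preimage point; BIP compares that norm with
  the supremum \<open>snrm T n\<close>, and adding the gains of \<open>J\<close> blocks yields a
  factor of order \<open>1 / J\<close> relative to \<open>tot\<close>. The constants do not depend
  on the finite alphabet \<open>T\<close>, so one \<open>J\<close> beats them for all alphabets, and
  an alphabet whose mass at that time is within a factor 2 of the supremum turns this into a gap
  between the two pressures. Both sides use \<xi>. Membership in the ball makes \<Phi> summable,
  which bounds the word sums uniformly in the alphabet; minimality gives the lower bound for the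
  lattice. The finite set of loops used there has its own minimiser, in general not \<xi>. Undoing
  this second tilt costs \<open>exp (- dot t v)\<close> at displacement \<open>v\<close>, which is
  harmless because \<open>v\<close> is only of order \<open>sqrt k\<close>.\<close>

lemma funpow_shift: "(shift ^^ n) x = suffix n x"
  by (induction n) (auto simp: shift_def suffix_def fun_eq_iff)

lemma birkhoff_sum_add: "birkhoff_sum \<phi> (m + n) x = birkhoff_sum \<phi> m x + birkhoff_sum \<phi> n ((shift ^^ m) x)"
proof -
  have "birkhoff_sum \<phi> (m + n) x = birkhoff_sum \<phi> m x + (\<Sum>j=m..<m+n. \<phi> ((shift ^^ j) x))"
    unfolding birkhoff_sum_def
    by (metis atLeast0LessThan le_add1 sum.atLeastLessThan_concat zero_le)
  also have "(\<Sum>j=m..<m+n. \<phi> ((shift ^^ j) x)) = (\<Sum>j<n. \<phi> ((shift ^^ (m + j)) x))"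
    using sum.shift_bounds_nat_ivl[of "\<lambda>j. \<phi> ((shift ^^ j) x)" 0 m n]
    by (simp add: add.commute atLeast0LessThan)
  finally show ?thesis
    by (simp add: birkhoff_sum_def funpow_shift add.commute)
qed

section \<open>Words, loops and periodic points\<close>

lemma conc_in_markov_shift:
  "w \<frown> x \<in> markov_shift S A \<longleftrightarrow>
     x \<in> markov_shift S A \<and> set w \<subseteq> S \<and> successively A w \<and> (w \<noteq> [] \<longrightarrow> A (last w) (x 0))"
proof (induction w)
  case Nil
  then show ?case by (simp add: conc_def)
next
  case (Cons s w)
  have "(s # w) \<frown> x = (\<lambda>i. case i of 0 \<Rightarrow> s | Suc j \<Rightarrow> (w \<frown> x) j)"
    by (auto simp: conc_def fun_eq_iff split: nat.split)
  then have "(s # w) \<frown> x \<in> markov_shift S A \<longleftrightarrow>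
      s \<in> S \<and> A s ((w \<frown> x) 0) \<and> w \<frown> x \<in> markov_shift S A"
    unfolding markov_shift_def by (auto split: nat.split)
  also have "(w \<frown> x) 0 = (if w = [] then x 0 else hd w)"
    by (auto simp: conc_def hd_conv_nth)
  finally show ?case
    using Cons.IH by (auto simp: successively_Cons)
qed

lemma suffix_in_markov_shift: "x \<in> markov_shift S A \<Longrightarrow> suffix n x \<in> markov_shift S A"
  by (auto simp: markov_shift_def suffix_def)

lemma prefix_in_words:
  assumes "x \<in> markov_shift S A"
  shows "prefix n x \<in> words S A n"
proof -
  have "prefix n x \<frown> suffix n x \<in> markov_shift S A"
    using assms by (simp flip: prefix_suffix)
  then show ?thesis
    unfolding conc_in_markov_shift words_def by simp
qed

text \<open>The only transition of the periodic point that is not visible inside \<open>w\<close> is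
  the wrap-around from \<open>last w\<close> to \<open>hd w\<close>.\<close>

lemma iter_in_markov_shift:
  assumes "w \<noteq> []"
  shows "w\<^sup>\<omega> \<in> markov_shift S A \<longleftrightarrow> set w \<subseteq> S \<and> successively A w \<and> A (last w) (hd w)"
proof
  assume *: "w\<^sup>\<omega> \<in> markov_shift S A"
  have "w \<frown> w\<^sup>\<omega> \<in> markov_shift S A"
    using * assms by (simp flip: iter_unroll)
  then show "set w \<subseteq> S \<and> successively A w \<and> A (last w) (hd w)"
    using assms unfolding conc_in_markov_shift by (simp add: iter_def hd_conv_nth)
next
  assume *: "set w \<subseteq> S \<and> successively A w \<and> A (last w) (hd w)"
  have "w\<^sup>\<omega> i \<in> S \<and> A (w\<^sup>\<omega> i) (w\<^sup>\<omega> (Suc i))" for i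
  proof -
    let ?j = "i mod length w"
    have j: "?j < length w" using assms by simp
    then have "w ! ?j \<in> S" using * nth_mem by blast
    moreover have "A (w ! ?j) (w ! (Suc i mod length w))"
    proof (cases "Suc ?j = length w")
      case True
      then have "Suc i mod length w = 0" by (simp add: mod_Suc)
      moreover have "w ! ?j = last w" using True assms
        by (metis diff_Suc_1 last_conv_nth)
      ultimately show ?thesis using * assms by (simp add: hd_conv_nth)
    next
      case False
      then have "Suc i mod length w = Suc ?j" by (simp add: mod_Suc)
      then show ?thesis using * j False successively_conv_nth[of A w] by auto
    qed
    ultimately show ?thesis using assms by (simp add: iter_def)
  qed
  then show "w\<^sup>\<omega> \<in> markov_shift S A" by (simp add: markov_shift_def)
qed

text \<open>Loops are words, not periodic points, so that they can be concatenated. Membership of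
  the periodic point in the shift encodes the closing transition. A loop may be a power of a shorter
  one and may revisit \<open>a\<close>, so the loops of length \<open>n\<close> match all points
  fixed by \<open>shift ^^ n\<close>, not only those of least period \<open>n\<close>.\<close>

definition loops :: "'s set \<Rightarrow> ('s \<Rightarrow> 's \<Rightarrow> bool) \<Rightarrow> 's \<Rightarrow> 's list set" where
  "loops S A a = {w. w \<noteq> [] \<and> hd w = a \<and> w\<^sup>\<omega> \<in> markov_shift S A}"

lemma loops_append:
  assumes "u \<in> loops S A a" "v \<in> loops S A a"
  shows "u @ v \<in> loops S A a"
  using assms unfolding loops_def
  by (auto simp: iter_in_markov_shift successively_append_iff)

abbreviation periodic_points :: "'s set \<Rightarrow> ('s \<Rightarrow> 's \<Rightarrow> bool) \<Rightarrow> 's \<Rightarrow> nat \<Rightarrow> (nat \<Rightarrow> 's) set" where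
  "periodic_points S A a n \<equiv> {x \<in> markov_shift S A. (shift ^^ n) x = x \<and> x 0 = a}"

text \<open>Positivity of \<open>n\<close> matters: \<open>shift ^^ 0\<close> fixes every point,
  while no loop has length 0.\<close>

lemma periodic_points_eq:
  assumes "n > 0"
  shows "bij_betw iter {w \<in> loops S A a. length w = n}
           (periodic_points S A a n)"
proof (rule bij_betwI[where g = "prefix n"])
  have eq: "(prefix n x)\<^sup>\<omega> = x" if "(shift ^^ n) x = x" for x :: "nat \<Rightarrow> 's"
  proof
    fix i
    have per: "x (j + k * n) = x j" for j k
    proof (induction k)
      case (Suc k)
      have "x (j + Suc k * n) = (shift ^^ n) x (j + k * n)"
        by (simp add: funpow_shift suffix_def algebra_simps)
      then show ?case using that Suc by simp
    qed simp
    have "x i = x (i mod n + (i div n) * n)" by simp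
    then have "x i = x (i mod n)" by (simp only: per)
    then show "(prefix n x)\<^sup>\<omega> i = x i" using assms by (simp add: iter_def)
  qed
  show "iter \<in> {w \<in> loops S A a. length w = n} \<rightarrow> periodic_points S A a n"
    by (auto simp: loops_def funpow_shift suffix_def iter_def fun_eq_iff hd_conv_nth)
  show "prefix n \<in> periodic_points S A a n \<rightarrow> {w \<in> loops S A a. length w = n}"
  proof safe
    fix x assume x: "x \<in> markov_shift S A" "(shift ^^ n) x = x" "a = x 0"
    then show "prefix n x \<in> loops S A (x 0)" "length (prefix n x) = n"
      using assms eq[OF x(2)] by (simp_all add: loops_def hd_conv_nth)
  qed
  show "prefix n (w\<^sup>\<omega>) = w" if "w \<in> {w \<in> loops S A a. length w = n}" for w
    using that by (auto simp: loops_def iter_def intro!: nth_equalityI)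
  show "(prefix n x)\<^sup>\<omega> = x" if "x \<in> periodic_points S A a n" for x
    using that eq by auto
qed

abbreviation partition_sum ::
    "'s set \<Rightarrow> ('s \<Rightarrow> 's \<Rightarrow> bool) \<Rightarrow> 's \<Rightarrow> ((nat \<Rightarrow> 's) \<Rightarrow> real) \<Rightarrow> nat \<Rightarrow> ennreal" where
  "partition_sum S A a \<phi> n \<equiv>
     \<Sum>\<^sub>\<infinity>x\<in>periodic_points S A a n. ennreal (exp (birkhoff_sum \<phi> n x))"

abbreviation skew_partition_sum ::
    "('g, 'm) monoid_scheme \<Rightarrow> 's set \<Rightarrow> ('s \<Rightarrow> 's \<Rightarrow> bool) \<Rightarrow> ('s \<Rightarrow> 'g) \<Rightarrow> 's
      \<Rightarrow> ((nat \<Rightarrow> 's) \<Rightarrow> real) \<Rightarrow> nat \<Rightarrow> ennreal" where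
  "skew_partition_sum G S A \<psi> a \<phi> n \<equiv>
     \<Sum>\<^sub>\<infinity>x\<in>{x \<in> markov_shift S A. (shift ^^ n) x = x \<and> x 0 = a \<and> cocycle G \<psi> n x = \<one>\<^bsub>G\<^esub>}.
       ennreal (exp (birkhoff_sum \<phi> n x))"

text \<open>The predicate \<open>P\<close> lets one statement serve both the unrestricted partition
  sum and the sum over points with trivial cocycle.\<close>

lemma periodic_sum_eq:
  fixes F :: "(nat \<Rightarrow> 's) \<Rightarrow> ennreal"
  assumes "n > 0"
  shows "(\<Sum>\<^sub>\<infinity>x\<in>{x \<in> markov_shift S A. (shift ^^ n) x = x \<and> x 0 = a \<and> P x}. F x) =
         (\<Sum>\<^sub>\<infinity>w\<in>{w \<in> loops S A a. length w = n \<and> P (w\<^sup>\<omega>)}. F (w\<^sup>\<omega>))"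
proof -
  let ?L = "{w \<in> loops S A a. length w = n}"
  note bij = periodic_points_eq[OF assms, of S A a]
  have "iter ` {w \<in> ?L. P (w\<^sup>\<omega>)} = {x \<in> iter ` ?L. P x}" by blast
  also have "\<dots> = {x \<in> markov_shift S A. (shift ^^ n) x = x \<and> x 0 = a \<and> P x}"
    unfolding bij_betw_imp_surj_on[OF bij] by blast
  finally have "bij_betw iter {w \<in> ?L. P (w\<^sup>\<omega>)} {x \<in> markov_shift S A. (shift ^^ n) x = x \<and> x 0 = a \<and> P x}"
    by (intro bij_betw_subset[OF bij]) auto
  from infsum_reindex_bij_betw[OF this, of F] show ?thesis by (simp add: conj_assoc)
qed

text \<open>In \<open>ennreal\<close> every sum is the supremum of its finite partial sums, so a
  bound only has to be checked on finite sets of loops, whose letters form a finite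
  alphabet.\<close>

lemma infsum_ennreal_le_iff:
  fixes F :: "'b \<Rightarrow> ennreal"
  shows "infsum F X \<le> c \<longleftrightarrow> (\<forall>Y. finite Y \<longrightarrow> Y \<subseteq> X \<longrightarrow> sum F Y \<le> c)"
  by (subst nonneg_infsum_complete) (auto simp: SUP_le_iff)

lemma less_infsum_ennreal_iff:
  fixes F :: "'b \<Rightarrow> ennreal"
  shows "c < infsum F X \<longleftrightarrow> (\<exists>Y. finite Y \<and> Y \<subseteq> X \<and> c < sum F Y)"
  using infsum_ennreal_le_iff[of F X c] by (auto simp: not_le[symmetric])

section \<open>Exponential growth rates\<close>

lemma ln_ennreal_mono: "s \<le> t \<Longrightarrow> ln_ennreal s \<le> ln_ennreal t"
  by (cases s; cases t) (auto simp: ln_ennreal_def ennreal_eq_0_iff top_unique)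

lemma ln_ennreal_ennreal [simp]: "0 < t \<Longrightarrow> ln_ennreal (ennreal t) = ereal (ln t)"
  by (auto simp: ln_ennreal_def ennreal_eq_0_iff)

lemma exp_growth_le:
  assumes "0 < c" "\<forall>\<^sub>F n in sequentially. Z n \<le> ennreal (c * exp (s * real n))"
  shows "exp_growth Z \<le> ereal s"
proof -
  have "\<forall>\<^sub>F n in sequentially. ereal (1 / real n) * ln_ennreal (Z n) \<le> ereal (ln c / real n + s)"
    using assms(2) eventually_gt_at_top[of 0]
  proof eventually_elim
    case (elim n)
    have "ln_ennreal (Z n) \<le> ereal (ln (c * exp (s * real n)))"
      using ln_ennreal_mono[OF elim(1)] assms(1) by simp
    also have "ln (c * exp (s * real n)) = ln c + s * real n"
      using assms(1) by (simp add: ln_mult)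
    finally have "ereal (1 / real n) * ln_ennreal (Z n) \<le> ereal (1 / real n) * ereal (ln c + s * real n)"
      by (intro ereal_mult_left_mono) auto
    then show ?case using elim(2) by (simp add: field_simps)
  qed
  then have "exp_growth Z \<le> limsup (\<lambda>n. ereal (ln c / real n + s))"
    unfolding exp_growth_def by (rule Limsup_mono)
  also have "\<dots> = ereal s"
  proof (rule lim_imp_Limsup)
    have "(\<lambda>n. ln c / real n + s) \<longlonglongrightarrow> 0 + s"
      by (intro tendsto_intros lim_const_over_n)
    then show "(\<lambda>n. ereal (ln c / real n + s)) \<longlonglongrightarrow> ereal s" by simp
  qed simp
  finally show ?thesis .
qed

text \<open>A limsup is bounded below along any subsequence, so infinitely many good
  \<open>n\<close> for each rate below \<open>s\<close> are enough.\<close>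

lemma exp_growth_ge:
  assumes "\<And>s'. s' < s \<Longrightarrow> \<exists>\<^sub>F n in sequentially. Z n \<ge> ennreal (exp (s' * real n))"
  shows "ereal s \<le> exp_growth Z"
proof (rule dense_le)
  fix y assume "y < ereal s"
  then obtain s' where s': "y < ereal s'" "s' < s" using ereal_dense2[of y "ereal s"] by auto
  have "\<exists>\<^sub>F n in sequentially. y < ereal (1 / real n) * ln_ennreal (Z n)"
    using frequently_eventually_conj[OF assms[OF s'(2)] eventually_gt_at_top[of 0]]
  proof (rule frequently_elim1)
    fix n assume n: "0 < n \<and> Z n \<ge> ennreal (exp (s' * real n))"
    have "ereal (s' * real n) \<le> ln_ennreal (Z n)"
      using ln_ennreal_mono[OF n[THEN conjunct2]] by simp
    then have "ereal (1 / real n) * ereal (s' * real n) \<le> ereal (1 / real n) * ln_ennreal (Z n)"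
      by (intro ereal_mult_left_mono) auto
    then show "y < ereal (1 / real n) * ln_ennreal (Z n)" using n s'(1) by simp
  qed
  moreover have "\<forall>\<^sub>F n in sequentially. ereal (1 / real n) * ln_ennreal (Z n) < y" if "exp_growth Z < y"
    using that unfolding exp_growth_def by (rule Limsup_lessD)
  ultimately show "y \<le> exp_growth Z"
    by (metis (no_types, lifting) eventually_mono frequently_def not_le less_asym)
qed

text \<open>A prefactor does not affect an exponential rate, so an arbitrary constant
  \<open>c\<close> may be demanded; this later pays for distortion.\<close>

lemma less_exp_growthD:
  assumes "ereal s < exp_growth Z"
  shows "\<exists>\<^sub>F n in sequentially. ennreal (c * exp (s * real n)) < Z n"
proof (rule ccontr)
  assume "\<not> ?thesis"
  then have *: "\<forall>\<^sub>F n in sequentially. Z n \<le> ennreal (c * exp (s * real n))"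
    by (simp add: not_frequently not_less)
  have "\<forall>\<^sub>F n in sequentially. Z n \<le> ennreal (max c 1 * exp (s * real n))"
    using * by eventually_elim (meson ennreal_leI exp_ge_zero max.cobounded1 mult_right_mono order_trans)
  then have "exp_growth Z \<le> ereal s" by (intro exp_growth_le[of "max c 1"]) auto
  then show False using assms by simp
qed

section \<open>Bounded distortion\<close>

text \<open>The constants are parameters because the potential will change while they stay fixed:
  \<phi> and its tilt satisfy the same Hoelder estimate.\<close>

locale hoelder_shift =
  fixes S :: "'s set" and A :: "'s \<Rightarrow> 's \<Rightarrow> bool" and \<phi> :: "(nat \<Rightarrow> 's) \<Rightarrow> real" and C \<theta> :: real
  assumes C_pos: "C > 0" and \<theta>_pos: "0 < \<theta>" and \<theta>_less: "\<theta> < 1"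
    and hoelder: "\<And>n w x y. n \<ge> 1 \<Longrightarrow> w \<in> words S A n \<Longrightarrow> x \<in> cylinder S A w \<Longrightarrow>
        y \<in> cylinder S A w \<Longrightarrow> \<bar>\<phi> x - \<phi> y\<bar> \<le> C * \<theta> ^ n"
begin

abbreviation "X \<equiv> markov_shift S A"

text \<open>The sum of the geometric series with terms \<open>C * \<theta> ^ j\<close>.\<close>

definition D :: real where "D = C / (1 - \<theta>)"

lemma D_pos: "D > 0"
  using C_pos \<theta>_less by (simp add: D_def)

text \<open>After \<open>j\<close> shifts the points still agree in \<open>n - j + k\<close>
  coordinates, so the errors form a geometric series dominated by its last terms. Agreement beyond
  time \<open>n\<close> makes the total small, and even \<open>k = 0\<close> gives a bound
  independent of \<open>n\<close>.\<close>

lemma distortion: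
  assumes "x \<in> X" "y \<in> X" "\<And>i. i < n + k \<Longrightarrow> x i = y i"
  shows "\<bar>birkhoff_sum \<phi> n x - birkhoff_sum \<phi> n y\<bar> \<le> D * \<theta> ^ k"
proof -
  have *: "\<bar>\<phi> (suffix j x) - \<phi> (suffix j y)\<bar> \<le> C * \<theta> ^ (n - j + k)" if "j < n" for j
  proof (rule hoelder)
    show "prefix (n - j + k) (suffix j x) \<in> words S A (n - j + k)"
      using assms suffix_in_markov_shift prefix_in_words by blast
    show "suffix j x \<in> cylinder S A (prefix (n - j + k) (suffix j x))"
      using assms(1) by (auto simp: cylinder_def suffix_in_markov_shift suffix_nth)
    show "suffix j y \<in> cylinder S A (prefix (n - j + k) (suffix j x))"
      using assms that by (auto simp: cylinder_def suffix_in_markov_shift suffix_nth intro!: assms(3)[symmetric])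
  qed (use that in simp)
  have "\<bar>birkhoff_sum \<phi> n x - birkhoff_sum \<phi> n y\<bar> \<le> (\<Sum>j<n. \<bar>\<phi> (suffix j x) - \<phi> (suffix j y)\<bar>)"
    unfolding birkhoff_sum_def funpow_shift by (simp add: sum_abs flip: sum_subtractf)
  also have "\<dots> \<le> (\<Sum>j<n. C * \<theta> ^ (n - j + k))"
    by (intro sum_mono *) simp
  also have "\<dots> = C * \<theta> ^ k * (\<Sum>j<n. \<theta> ^ (n - j))"
    unfolding sum_distrib_left power_add by (intro sum.cong) (simp_all add: mult_ac)
  also have "(\<Sum>j<n. \<theta> ^ (n - j)) \<le> (\<Sum>j<n. \<theta> ^ (n - Suc j))"
    using \<theta>_pos \<theta>_less by (intro sum_mono power_decreasing) auto
  also have "(\<Sum>j<n. \<theta> ^ (n - Suc j)) = (\<Sum>j<n. \<theta> ^ j)"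
    by (rule sum.nat_diff_reindex)
  also have "(\<Sum>j<n. \<theta> ^ j) \<le> 1 / (1 - \<theta>)"
    using \<theta>_pos \<theta>_less by (simp add: sum_gp_strict divide_right_mono)
  finally show ?thesis using C_pos \<theta>_pos by (simp add: D_def mult_ac mult_left_mono)
qed

text \<open>The factor with which the inverse branch adding the prefix \<open>w\<close> enters a
  power of the transfer operator.\<close>

definition weight :: "'s list \<Rightarrow> (nat \<Rightarrow> 's) \<Rightarrow> real" where
  "weight w x = exp (birkhoff_sum \<phi> (length w) (w \<frown> x))"

lemma weight_pos [simp]: "weight w x > 0"
  by (simp add: weight_def)

lemma weight_nonneg [simp]: "weight w x \<ge> 0"
  by (simp add: weight_def)

lemma weight_Nil [simp]: "weight [] x = 1"
  by (simp add: weight_def birkhoff_sum_def)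

lemma weight_append: "weight (u @ v) x = weight u (v \<frown> x) * weight v x"
  by (simp add: weight_def birkhoff_sum_add funpow_shift exp_add flip: conc_conc)

lemma weight_iter: "w \<noteq> [] \<Longrightarrow> weight w (w\<^sup>\<omega>) = exp (birkhoff_sum \<phi> (length w) (w\<^sup>\<omega>))"
  by (simp add: weight_def flip: iter_unroll)

lemma weight_le:
  assumes "w \<frown> x \<in> X" "w \<frown> y \<in> X" "\<And>i. i < k \<Longrightarrow> x i = y i"
  shows "weight w x \<le> exp (D * \<theta> ^ k) * weight w y"
proof -
  have "(w \<frown> x) i = (w \<frown> y) i" if "i < length w + k" for i
    using assms(3)[of "i - length w"] that by (auto simp: conc_def)
  from distortion[where n = "length w" and k = k, OF assms(1,2) this] show ?thesis
    unfolding weight_def by (simp add: abs_le_iff flip: exp_add)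
qed

lemma weight_le_D:
  assumes "w \<frown> x \<in> X" "w \<frown> y \<in> X"
  shows "weight w x \<le> exp D * weight w y"
  using weight_le[OF assms, of 0] by simp

text \<open>Each loop is weighed at its own periodic point; moving both to the periodic orbit of the
  concatenation costs one factor \<open>exp D\<close> per loop.\<close>

lemma weight_loops_append:
  assumes "u \<in> loops S A a" "v \<in> loops S A a"
  shows "weight u (u\<^sup>\<omega>) * weight v (v\<^sup>\<omega>) \<le> exp (2 * D) * weight (u @ v) ((u @ v)\<^sup>\<omega>)"
proof -
  have uv: "u @ v \<in> loops S A a" using assms by (rule loops_append)
  let ?z = "(u @ v)\<^sup>\<omega>"
  have X: "u \<frown> u\<^sup>\<omega> \<in> X" "v \<frown> v\<^sup>\<omega> \<in> X" "(u @ v) \<frown> ?z \<in> X"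
    using assms uv unfolding loops_def by (simp_all flip: iter_unroll)
  then have "u \<frown> (v \<frown> ?z) \<in> X" by simp
  moreover from this have "v \<frown> ?z \<in> X" unfolding conc_in_markov_shift[of u] by blast
  ultimately have "weight u (u\<^sup>\<omega>) \<le> exp D * weight u (v \<frown> ?z)" "weight v (v\<^sup>\<omega>) \<le> exp D * weight v ?z"
    using weight_le_D X by blast+
  from mult_mono[OF this] show ?thesis
    by (simp add: weight_append mult_ac exp_double power2_eq_square)
qed

text \<open>By distortion one value per word controls its weight at all admissible points; a word
  that no point can follow imposes no condition.\<close>

lemma weight_lower_bound:
  assumes "finite K"
  shows "\<exists>c>0. \<forall>w\<in>K. \<forall>x. w \<frown> x \<in> X \<longrightarrow> c \<le> weight w x"
  using assms
proof (induction K)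
  case empty
  then show ?case by (intro exI[of _ 1]) auto
next
  case (insert v K)
  then obtain c where c: "c > 0" "\<forall>w\<in>K. \<forall>x. w \<frown> x \<in> X \<longrightarrow> c \<le> weight w x" by blast
  show ?case
  proof (cases "\<exists>y. v \<frown> y \<in> X")
    case True
    then obtain y where y: "v \<frown> y \<in> X" by blast
    have "exp (-D) * weight v y \<le> weight v x" if "v \<frown> x \<in> X" for x
      using weight_le_D[OF y that] by (simp add: exp_minus field_simps)
    then show ?thesis
      using c by (intro exI[of _ "min c (exp (-D) * weight v y)"]) (auto simp: min_le_iff_disj)
  next
    case False
    then show ?thesis using c by (intro exI[of _ c]) auto
  qed
qed

end

section \<open>Finitely supported functions on a group\<close>

definition fin_supp :: "('g, 'm) monoid_scheme \<Rightarrow> ('g \<Rightarrow> real) \<Rightarrow> bool" where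
  "fin_supp G v \<longleftrightarrow> finite {g \<in> carrier G. v g \<noteq> 0}"

text \<open>The norm of square-summable functions on \<open>G\<close>, written as a finite sum over
  the support. For an infinite support it is 0 by default, hence the accompanying
  \<open>fin_supp\<close>; values off the carrier never count.\<close>

definition l2 :: "('g, 'm) monoid_scheme \<Rightarrow> ('g \<Rightarrow> real) \<Rightarrow> real" where
  "l2 G v = L2_set v {g \<in> carrier G. v g \<noteq> 0}"

lemma l2_eq:
  assumes "finite T" "T \<subseteq> carrier G" "{g \<in> carrier G. v g \<noteq> 0} \<subseteq> T"
  shows "l2 G v = L2_set v T"
proof -
  have "(\<Sum>g | g \<in> carrier G \<and> v g \<noteq> 0. (v g)\<^sup>2) = (\<Sum>g\<in>T. (v g)\<^sup>2)"
    using assms by (intro sum.mono_neutral_left) auto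
  then show ?thesis by (simp add: l2_def L2_set_def)
qed

lemma l2_nonneg [simp]: "l2 G v \<ge> 0"
  by (simp add: l2_def)

lemma fin_supp_add [simp]:
  assumes "fin_supp G u" "fin_supp G v"
  shows "fin_supp G (\<lambda>g. u g + v g)"
proof -
  have "finite ({g \<in> carrier G. u g \<noteq> 0} \<union> {g \<in> carrier G. v g \<noteq> 0})"
    using assms by (simp add: fin_supp_def)
  then show ?thesis unfolding fin_supp_def by (rule finite_subset[rotated]) auto
qed

lemma fin_supp_scale [simp]: "fin_supp G v \<Longrightarrow> fin_supp G (\<lambda>g. c * v g)"
  unfolding fin_supp_def by (rule finite_subset[rotated]) auto

lemma fin_supp_diff [simp]: "fin_supp G u \<Longrightarrow> fin_supp G v \<Longrightarrow> fin_supp G (\<lambda>g. u g - v g)"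
  using fin_supp_add[of G u "\<lambda>g. (-1) * v g"] fin_supp_scale[of G v "-1"] by simp

lemma fin_supp_0 [simp]: "fin_supp G (\<lambda>g. 0)"
  by (simp add: fin_supp_def)

lemma fin_supp_sum [simp]: "(\<And>i. i \<in> I \<Longrightarrow> fin_supp G (v i)) \<Longrightarrow> fin_supp G (\<lambda>g. \<Sum>i\<in>I. v i g)"
  by (induction I rule: infinite_finite_induct) auto

lemma l2_0 [simp]: "l2 G (\<lambda>g. 0) = 0"
  by (simp add: l2_def)

lemma l2_scale: "l2 G (\<lambda>g. c * v g) = \<bar>c\<bar> * l2 G v"
proof (cases "c = 0")
  case False
  have "L2_set (\<lambda>g. c * v g) T = \<bar>c\<bar> * L2_set v T" for T
    by (simp add: L2_set_def power_mult_distrib real_sqrt_mult flip: sum_distrib_left)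
  then show ?thesis using False by (simp add: l2_def)
qed simp

lemma l2_cong: "(\<And>g. g \<in> carrier G \<Longrightarrow> u g = v g) \<Longrightarrow> l2 G u = l2 G v"
  unfolding l2_def L2_set_def by (intro arg_cong[where f = sqrt] sum.cong) auto

lemma common_support:
  assumes "fin_supp G u" "fin_supp G v"
  obtains T where "finite T" "T \<subseteq> carrier G"
    "{g \<in> carrier G. u g \<noteq> 0} \<subseteq> T" "{g \<in> carrier G. v g \<noteq> 0} \<subseteq> T"
  by (rule that[of "{g \<in> carrier G. u g \<noteq> 0} \<union> {g \<in> carrier G. v g \<noteq> 0}"])
    (use assms in \<open>auto simp: fin_supp_def\<close>)

lemma l2_triangle:
  assumes "fin_supp G u" "fin_supp G v"
  shows "l2 G (\<lambda>g. u g + v g) \<le> l2 G u + l2 G v"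
proof -
  obtain T where T: "finite T" "T \<subseteq> carrier G"
    "{g \<in> carrier G. u g \<noteq> 0} \<subseteq> T" "{g \<in> carrier G. v g \<noteq> 0} \<subseteq> T"
    by (rule common_support[OF assms])
  have "l2 G (\<lambda>g. u g + v g) = L2_set (\<lambda>g. u g + v g) T" "l2 G u = L2_set u T" "l2 G v = L2_set v T"
    by (rule l2_eq; use T in force)+
  then show ?thesis by (simp add: L2_set_triangle_ineq)
qed

lemma l2_power2:
  assumes "finite T" "T \<subseteq> carrier G" "{g \<in> carrier G. v g \<noteq> 0} \<subseteq> T"
  shows "(l2 G v)\<^sup>2 = (\<Sum>g\<in>T. (v g)\<^sup>2)"
  using l2_eq[OF assms] by (simp add: L2_set_def sum_nonneg)

lemma l2_parallelogram:
  assumes "fin_supp G u" "fin_supp G v"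
  shows "(l2 G (\<lambda>g. u g + v g))\<^sup>2 + (l2 G (\<lambda>g. u g - v g))\<^sup>2 = 2 * (l2 G u)\<^sup>2 + 2 * (l2 G v)\<^sup>2"
proof -
  obtain T where T: "finite T" "T \<subseteq> carrier G"
    "{g \<in> carrier G. u g \<noteq> 0} \<subseteq> T" "{g \<in> carrier G. v g \<noteq> 0} \<subseteq> T"
    by (rule common_support[OF assms])
  have "(l2 G (\<lambda>g. u g + v g))\<^sup>2 = (\<Sum>g\<in>T. (u g + v g)\<^sup>2)" "(l2 G (\<lambda>g. u g - v g))\<^sup>2 = (\<Sum>g\<in>T. (u g - v g)\<^sup>2)"
    "(l2 G u)\<^sup>2 = (\<Sum>g\<in>T. (u g)\<^sup>2)" "(l2 G v)\<^sup>2 = (\<Sum>g\<in>T. (v g)\<^sup>2)"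
    by (rule l2_power2; use T in force)+
  moreover have "(\<Sum>g\<in>T. (u g + v g)\<^sup>2) + (\<Sum>g\<in>T. (u g - v g)\<^sup>2) = (\<Sum>g\<in>T. 2 * (u g)\<^sup>2 + 2 * (v g)\<^sup>2)"
    unfolding sum.distrib[symmetric] by (intro sum.cong) (auto simp: power2_eq_square algebra_simps)
  ultimately show ?thesis by (simp add: sum.distrib sum_distrib_left)
qed

lemma l2_sum:
  assumes "\<And>i. i \<in> I \<Longrightarrow> fin_supp G (v i)"
  shows "l2 G (\<lambda>g. \<Sum>i\<in>I. v i g) \<le> (\<Sum>i\<in>I. l2 G (v i))"
  using assms
proof (induction I rule: infinite_finite_induct)
  case (insert i I)
  then show ?case
    using l2_triangle[of G "v i" "\<lambda>g. \<Sum>i\<in>I. v i g"] by fastforce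
qed auto

lemma l2_mono:
  assumes "fin_supp G v" "\<And>g. g \<in> carrier G \<Longrightarrow> \<bar>u g\<bar> \<le> \<bar>v g\<bar>"
  shows "l2 G u \<le> l2 G v"
proof -
  let ?T = "{g \<in> carrier G. v g \<noteq> 0}"
  have "l2 G u = L2_set u ?T"
    using assms by (intro l2_eq) (fastforce simp: fin_supp_def)+
  also have "\<dots> \<le> L2_set v ?T"
    unfolding L2_set_def using assms(2) by (intro real_sqrt_le_mono sum_mono) (simp add: abs_le_square_iff)
  finally show ?thesis by (simp add: l2_def)
qed

lemma abs_le_l2:
  assumes "fin_supp G v" "g \<in> carrier G"
  shows "\<bar>v g\<bar> \<le> l2 G v"
proof (cases "v g = 0")
  case False
  have "(v g)\<^sup>2 \<le> (\<Sum>g | g \<in> carrier G \<and> v g \<noteq> 0. (v g)\<^sup>2)"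
    using assms False by (intro member_le_sum) (auto simp: fin_supp_def)
  then show ?thesis
    unfolding l2_def L2_set_def by (simp add: real_le_rsqrt)
qed simp

text \<open>Strict convexity of the norm, made quantitative by the parallelogram law.\<close>

lemma l2_add_deficit:
  assumes "fin_supp G u" "fin_supp G v"
    and "0 \<le> \<epsilon>" "\<bar>l2 G u - l2 G v\<bar> \<le> \<eta> * l2 G u" "2 * \<eta> \<le> \<epsilon>" "\<eta> \<le> 1"
    and diff: "\<epsilon> * l2 G u \<le> l2 G (\<lambda>g. u g - v g)"
  shows "l2 G (\<lambda>g. u g + v g) \<le> l2 G u + l2 G v - \<epsilon>\<^sup>2 / 8 * l2 G u"
proof -
  define r r' where "r = l2 G u" and "r' = l2 G v"
  have r: "r \<ge> 0" "r' \<ge> 0" "\<bar>r - r'\<bar> \<le> \<eta> * r" "\<eta> * r \<le> \<epsilon> / 2 * r" "\<eta> * r \<le> 1 * r"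
    using assms mult_right_mono[of \<eta> "\<epsilon> / 2" r] mult_right_mono[of \<eta> 1 r] by (simp_all add: r_def r'_def)
  have "l2 G (\<lambda>g. u g - v g) \<le> r + r'"
    using l2_triangle[of G u "\<lambda>g. (-1) * v g"] l2_scale[of G "-1" v] fin_supp_scale[of G v "-1"] assms(1,2)
    by (simp add: r_def r'_def)
  then have le: "\<epsilon> * r \<le> 3 * r" using diff r by (simp add: r_def)
  have "(l2 G (\<lambda>g. u g + v g))\<^sup>2 = (r + r')\<^sup>2 + (r - r')\<^sup>2 - (l2 G (\<lambda>g. u g - v g))\<^sup>2"
    using l2_parallelogram[OF assms(1,2)] by (simp add: r_def r'_def power2_eq_square algebra_simps)
  moreover have "(r - r')\<^sup>2 \<le> (\<epsilon> / 2 * r)\<^sup>2"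
    using r by (intro abs_le_square_iff[THEN iffD1]) linarith
  moreover have "(\<epsilon> * r)\<^sup>2 \<le> (l2 G (\<lambda>g. u g - v g))\<^sup>2"
    using diff assms(3) r by (intro power_mono) (auto simp: r_def)
  moreover have "(\<epsilon> / 2 * r)\<^sup>2 - (\<epsilon> * r)\<^sup>2 = - (3 / 4 * \<epsilon>\<^sup>2 * r\<^sup>2)"
    by (simp add: power2_eq_square field_simps)
  ultimately have 1: "(l2 G (\<lambda>g. u g + v g))\<^sup>2 \<le> (r + r')\<^sup>2 - 3 / 4 * \<epsilon>\<^sup>2 * r\<^sup>2"
    by linarith
  \<comment> \<open>The constant 1/8 comes from \<open>r + r' \<le> 3 * r\<close>: it makes
    \<open>2 * s * (r + r')\<close> at most the deficit
    \<open>3 / 4 * \<epsilon>\<^sup>2 * r\<^sup>2\<close> of the squares.\<close>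
  define s where "s = \<epsilon>\<^sup>2 / 8 * r"
  have "s * (r + r') \<le> s * (3 * r)"
    using r by (intro mult_left_mono) (auto simp: s_def)
  then have "2 * s * (r + r') \<le> 3 / 4 * \<epsilon>\<^sup>2 * r\<^sup>2"
    by (simp add: s_def power2_eq_square algebra_simps)
  then have "(l2 G (\<lambda>g. u g + v g))\<^sup>2 \<le> (r + r')\<^sup>2 - 2 * s * (r + r') + s\<^sup>2"
    using 1 zero_le_power2[of s] by linarith
  also have "\<dots> = (r + r' - s)\<^sup>2" by (simp add: power2_eq_square algebra_simps)
  finally have "l2 G (\<lambda>g. u g + v g) \<le> \<bar>r + r' - s\<bar>"
    using abs_le_square_iff[of "l2 G (\<lambda>g. u g + v g)" "r + r' - s"] by simp
  \<comment> \<open>Needed to drop the absolute value left by comparing squares.\<close>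
  moreover have "s \<le> r + r'"
  proof (cases "r = 0")
    case False
    have "\<epsilon> * r \<le> r + r'" using diff \<open>l2 G (\<lambda>g. u g - v g) \<le> r + r'\<close> by (simp add: r_def)
    then have "\<epsilon> * (\<epsilon> * r) \<le> 3 * (r + r')"
      using False le r assms(3) by (intro mult_mono) auto
    then show ?thesis using r by (simp add: s_def power2_eq_square)
  qed (use r in \<open>simp add: s_def\<close>)
  ultimately show ?thesis by (simp add: r_def r'_def s_def)
qed

context group
begin

lemma translate_support:
  assumes "h \<in> carrier G"
  shows "bij_betw (\<lambda>g. h \<otimes> g) {g \<in> carrier G. v (h \<otimes> g) \<noteq> 0} {g \<in> carrier G. v g \<noteq> (0::real)}"
  by (rule bij_betwI[where g = "\<lambda>g. inv h \<otimes> g"]) (use assms in \<open>auto simp flip: m_assoc\<close>)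

lemma fin_supp_translate: "h \<in> carrier G \<Longrightarrow> fin_supp G v \<Longrightarrow> fin_supp G (\<lambda>g. v (h \<otimes> g))"
  unfolding fin_supp_def using bij_betw_finite[OF translate_support] by blast

lemma l2_translate: "h \<in> carrier G \<Longrightarrow> l2 G (\<lambda>g. v (h \<otimes> g)) = l2 G v"
  unfolding l2_def L2_set_def
  using sum.reindex_bij_betw[OF translate_support[of h v], of "\<lambda>g. (v g)\<^sup>2"] by simp

subsection \<open>Amenability from almost invariant vectors\<close>

text \<open>Integration of \<open>u\<close> against the probability density proportional to the
  square of \<open>v\<close>; almost invariance of the vector becomes almost invariance of this
  mean.\<close>

definition vector_mean :: "('a \<Rightarrow> real) \<Rightarrow> ('a \<Rightarrow> real) \<Rightarrow> real" where
  "vector_mean v u = (\<Sum>h | h \<in> carrier G \<and> v h \<noteq> 0. u h * (v h)\<^sup>2) / (l2 G v)\<^sup>2"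

lemma vector_mean_eq:
  assumes "finite T" "T \<subseteq> carrier G" "{g \<in> carrier G. v g \<noteq> 0} \<subseteq> T"
  shows "vector_mean v u = (\<Sum>h\<in>T. u h * (v h)\<^sup>2) / (l2 G v)\<^sup>2"
  unfolding vector_mean_def using assms
  by (intro arg_cong2[where f = "(/)"] sum.mono_neutral_left refl) auto

text \<open>Substitution moves the translation from \<open>u\<close> to \<open>v\<close>. The
  difference of squares factors into \<open>v' - v\<close> and \<open>v' + v\<close>, and
  Cauchy-Schwarz bounds its sum by \<open>\<epsilon> * l2 G v\<close> times
  \<open>2 * l2 G v\<close>.\<close>

lemma vector_mean_translate:
  assumes v: "fin_supp G v" and g: "g \<in> carrier G" and l2v: "l2 G v > 0"
    and u: "\<And>h. h \<in> carrier G \<Longrightarrow> \<bar>u h\<bar> \<le> b"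
    and \<epsilon>: "l2 G (\<lambda>h. v (inv g \<otimes> h) - v h) \<le> \<epsilon> * l2 G v"
  shows "\<bar>vector_mean v (\<lambda>h. u (g \<otimes> h)) - vector_mean v u\<bar> \<le> 2 * b * \<epsilon>"
proof -
  define v' where "v' h = v (inv g \<otimes> h)" for h
  have ig: "inv g \<in> carrier G" using g by simp
  have v': "fin_supp G v'" unfolding v'_def using fin_supp_translate[OF ig v] .
  have "b \<ge> 0" using u[of \<one>] by fastforce
  have l2v': "l2 G v' = l2 G v" unfolding v'_def using l2_translate[OF ig] .
  obtain T where T: "finite T" "T \<subseteq> carrier G"
    "{h \<in> carrier G. v h \<noteq> 0} \<subseteq> T" "{h \<in> carrier G. v' h \<noteq> 0} \<subseteq> T"
    by (rule common_support[OF v v'])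
  have "(\<Sum>h | h \<in> carrier G \<and> v h \<noteq> 0. u (g \<otimes> h) * (v h)\<^sup>2) = (\<Sum>h | h \<in> carrier G \<and> v' h \<noteq> 0. u h * (v' h)\<^sup>2)"
  proof -
    have "(\<Sum>h | h \<in> carrier G \<and> v' h \<noteq> 0. u h * (v' h)\<^sup>2) =
        (\<Sum>h | h \<in> carrier G \<and> v (inv g \<otimes> h) \<noteq> 0. u (g \<otimes> (inv g \<otimes> h)) * (v (inv g \<otimes> h))\<^sup>2)"
      using g by (intro sum.cong) (auto simp: v'_def simp flip: m_assoc)
    also have "\<dots> = (\<Sum>h | h \<in> carrier G \<and> v h \<noteq> 0. u (g \<otimes> h) * (v h)\<^sup>2)"
      using sum.reindex_bij_betw[OF translate_support[OF ig, of v], of "\<lambda>h. u (g \<otimes> h) * (v h)\<^sup>2"] .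
    finally show ?thesis by simp
  qed
  also have "\<dots> = (\<Sum>h\<in>T. u h * (v' h)\<^sup>2)"
    using T by (intro sum.mono_neutral_left) auto
  finally have 1: "vector_mean v (\<lambda>h. u (g \<otimes> h)) = (\<Sum>h\<in>T. u h * (v' h)\<^sup>2) / (l2 G v)\<^sup>2"
    by (simp add: vector_mean_def)
  have "\<bar>(\<Sum>h\<in>T. u h * (v' h)\<^sup>2) - (\<Sum>h\<in>T. u h * (v h)\<^sup>2)\<bar> \<le> (\<Sum>h\<in>T. \<bar>u h * ((v' h)\<^sup>2 - (v h)\<^sup>2)\<bar>)"
    by (simp add: sum_abs algebra_simps flip: sum_subtractf)
  also have "\<dots> \<le> (\<Sum>h\<in>T. b * (\<bar>v' h - v h\<bar> * \<bar>v' h + v h\<bar>))"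
  proof (intro sum_mono)
    fix h assume "h \<in> T"
    have "\<bar>u h * ((v' h)\<^sup>2 - (v h)\<^sup>2)\<bar> = \<bar>u h\<bar> * (\<bar>v' h - v h\<bar> * \<bar>v' h + v h\<bar>)"
      by (simp add: abs_mult[symmetric] power2_eq_square algebra_simps)
    also have "\<dots> \<le> b * (\<bar>v' h - v h\<bar> * \<bar>v' h + v h\<bar>)"
      using u \<open>h \<in> T\<close> T by (intro mult_right_mono) auto
    finally show "\<bar>u h * ((v' h)\<^sup>2 - (v h)\<^sup>2)\<bar> \<le> \<dots>" .
  qed
  also have "\<dots> = b * (\<Sum>h\<in>T. \<bar>v' h - v h\<bar> * \<bar>v' h + v h\<bar>)" by (simp add: sum_distrib_left)
  also have "\<dots> \<le> b * (L2_set (\<lambda>h. v' h - v h) T * L2_set (\<lambda>h. v' h + v h) T)"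
    by (intro mult_left_mono L2_set_mult_ineq \<open>b \<ge> 0\<close>)
  also have "L2_set (\<lambda>h. v' h - v h) T = l2 G (\<lambda>h. v' h - v h)"
    by (rule l2_eq[symmetric]; use T in force)
  also have "L2_set (\<lambda>h. v' h + v h) T = l2 G (\<lambda>h. v' h + v h)"
    by (rule l2_eq[symmetric]; use T in force)
  also have "b * (l2 G (\<lambda>h. v' h - v h) * l2 G (\<lambda>h. v' h + v h)) \<le> b * ((\<epsilon> * l2 G v) * (l2 G v + l2 G v))"
  proof (intro mult_left_mono mult_mono)
    show "l2 G (\<lambda>h. v' h - v h) \<le> \<epsilon> * l2 G v" using \<epsilon> by (simp add: v'_def)
    show "l2 G (\<lambda>h. v' h + v h) \<le> l2 G v + l2 G v" using l2_triangle[OF v' v] l2v' by simp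
    show "0 \<le> \<epsilon> * l2 G v" using \<epsilon> l2_nonneg order_trans by blast
  qed (use \<open>b \<ge> 0\<close> in auto)
  finally have "\<bar>(\<Sum>h\<in>T. u h * (v' h)\<^sup>2) - (\<Sum>h\<in>T. u h * (v h)\<^sup>2)\<bar> \<le> 2 * b * \<epsilon> * (l2 G v)\<^sup>2"
    by (simp add: power2_eq_square mult_ac)
  then show ?thesis
    unfolding 1 vector_mean_eq[OF T(1-3)] using l2v
    by (simp add: divide_le_eq abs_divide flip: diff_divide_distrib)
qed

text \<open>Otherwise almost invariant vectors exist for every finite \<open>E\<close> and every
  tolerance, and their means are almost invariant. All these means live in a product of compact
  intervals, one for each function, so by Tychonoff's theorem and the finite intersection property a
  single mean is invariant under every element.\<close>

lemma not_amenableD: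
  assumes "\<not> amenable G"
  shows "\<exists>E \<epsilon>. finite E \<and> E \<subseteq> carrier G \<and> 0 < \<epsilon> \<and>
    (\<forall>v. fin_supp G v \<longrightarrow> l2 G v > 0 \<longrightarrow> (\<exists>g\<in>E. \<epsilon> * l2 G v < l2 G (\<lambda>h. v (g \<otimes> h) - v h)))"
proof (rule ccontr)
  assume "\<not> ?thesis"
  then have almost: "\<exists>v. fin_supp G v \<and> l2 G v > 0 \<and> (\<forall>g\<in>E. l2 G (\<lambda>h. v (g \<otimes> h) - v h) \<le> \<epsilon> * l2 G v)"
    if "finite E" "E \<subseteq> carrier G" "0 < \<epsilon>" for E \<epsilon>
    using that by (simp add: not_less) (meson not_le)
  define bdd where "bdd u \<longleftrightarrow> bounded (u ` carrier G)" for u :: "'a \<Rightarrow> real"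
  \<comment> \<open>The value 0 on unbounded functions pins those coordinates of a mean, so that
    \<open>K\<close> is a product of compact intervals over all functions.\<close>
  define b where "b u = (if bdd u then (SUP h\<in>carrier G. \<bar>u h\<bar>) else 0)" for u :: "'a \<Rightarrow> real"
  have b: "\<bar>u h\<bar> \<le> b u" if "bdd u" "h \<in> carrier G" for u h
    unfolding b_def using that
    by (auto intro!: cSUP_upper2[where x = h] simp: bdd_def bounded_iff bdd_above_def)
  define K where "K = (\<Pi>\<^sub>E u\<in>UNIV. {- b u .. b u})"
  \<comment> \<open>Each condition involves finitely many coordinates of \<open>M\<close>, hence is
    closed in the product topology; invariance is relaxed to an error
    \<open>2 * b u * \<epsilon>\<close> for the translations from \<open>E\<close>.\<close>
  define Q where "Q = (\<lambda>(E, \<epsilon>). {M. 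
      (\<forall>u v. bdd u \<longrightarrow> bdd v \<longrightarrow> M (\<lambda>h. u h + v h) = M u + M v) \<and>
      (\<forall>u c. bdd u \<longrightarrow> M (\<lambda>h. c * u h) = c * M u) \<and>
      (\<forall>u. bdd u \<longrightarrow> (\<forall>h\<in>carrier G. 0 \<le> u h) \<longrightarrow> 0 \<le> M u) \<and>
      M (\<lambda>_. 1) = 1 \<and>
      (\<forall>u. bdd u \<longrightarrow> (\<forall>g\<in>E. \<bar>M (\<lambda>h. u (g \<otimes> h)) - M u\<bar> \<le> 2 * b u * \<epsilon>))})"
  have "compact K"
    using compactin_PiE[of "\<lambda>_. euclidean" UNIV "\<lambda>u. {- b u .. b u}"]
    by (simp add: K_def euclidean_product_topology)
  have Q_closed: "closed (Q (E, \<epsilon>))" for E \<epsilon>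
    unfolding Q_def prod.case Ball_def
    by (intro closed_Collect_conj closed_Collect_all closed_Collect_imp open_Collect_const
        closed_Collect_eq closed_Collect_le continuous_intros continuous_on_product_coordinates)
  have bdd_add: "bdd (\<lambda>h. u h + v h)" if "bdd u" "bdd v" for u v
    using that unfolding bdd_def by (rule bounded_plus_comp)
  have bdd_scale: "bdd (\<lambda>h. c * u h)" if "bdd u" for u c
    using bounded_scaling[of "u ` carrier G" c] that by (simp add: bdd_def image_image)
  have bdd_one: "bdd (\<lambda>_. 1)" 
    unfolding bdd_def by (rule bounded_subset[of "{1}"]) auto
  have bdd_translate: "bdd (\<lambda>h. u (g \<otimes> h))" if "bdd u" "g \<in> carrier G" for u g
    using that unfolding bdd_def by (elim bounded_subset) auto
  have b_nonneg: "b u \<ge> 0" for u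
  proof (cases "bdd u")
    case True
    then show ?thesis using b[OF True one_closed] by linarith
  qed (simp add: b_def)
  define P where "P = {(E, \<epsilon>). finite E \<and> E \<subseteq> carrier G \<and> (0::real) < \<epsilon>}"
  have "K \<inter> (\<Inter>i\<in>P. Q i) \<noteq> {}"
  proof (rule compact_imp_fip_image[OF \<open>compact K\<close>])
    show "closed (Q i)" if "i \<in> P" for i using Q_closed by (cases i) simp
    fix I' assume I': "finite I'" "I' \<subseteq> P"
    define E where "E = \<Union>(fst ` I')"
    define \<epsilon> where "\<epsilon> = Min (insert 1 (snd ` I'))"
    have "finite E" "E \<subseteq> carrier G" "0 < \<epsilon>"
      using I' unfolding E_def \<epsilon>_def P_def by fastforce+
    \<comment> \<open>Inverses are taken because translating \<open>u\<close> by \<open>g\<close>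
      amounts to translating the vector by \<open>inv g\<close>.\<close>
    then have "\<exists>v. fin_supp G v \<and> l2 G v > 0 \<and>
        (\<forall>g\<in>m_inv G ` E. l2 G (\<lambda>h. v (g \<otimes> h) - v h) \<le> \<epsilon> * l2 G v)"
      by (intro almost) auto
    then obtain v where v: "fin_supp G v" "l2 G v > 0"
      "\<And>g. g \<in> E \<Longrightarrow> l2 G (\<lambda>h. v (inv g \<otimes> h) - v h) \<le> \<epsilon> * l2 G v"
      by blast
    define M where "M u = (if bdd u then vector_mean v u else 0)" for u
    let ?T = "{h \<in> carrier G. v h \<noteq> 0}"
    have sq: "(\<Sum>h\<in>?T. (v h)\<^sup>2) = (l2 G v)\<^sup>2"
      using l2_power2[of ?T G v] v(1) by (simp add: fin_supp_def)
    have "\<bar>M u\<bar> \<le> b u" for u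
    proof (cases "bdd u")
      case True
      have "\<bar>\<Sum>h\<in>?T. u h * (v h)\<^sup>2\<bar> \<le> (\<Sum>h\<in>?T. b u * (v h)\<^sup>2)"
        using b[OF True] by (intro order_trans[OF sum_abs] sum_mono) (auto simp: abs_mult intro: mult_right_mono)
      then show ?thesis
        using v(2) True by (simp add: M_def vector_mean_def abs_divide divide_le_eq sq flip: sum_distrib_left)
    qed (simp add: M_def b_nonneg)
    then have "M \<in> K" unfolding K_def by (auto simp: abs_le_iff minus_le_iff)
    moreover have "M \<in> Q i" if i: "i \<in> I'" for i
    proof -
      obtain E' \<epsilon>' where [simp]: "i = (E', \<epsilon>')" by (cases i)
      have E': "E' \<subseteq> E" "\<epsilon> \<le> \<epsilon>'" "E' \<subseteq> carrier G"
        using i I' unfolding E_def \<epsilon>_def P_def by (force intro: Min_le)+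
      have "\<bar>M (\<lambda>h. u (g \<otimes> h)) - M u\<bar> \<le> 2 * b u * \<epsilon>'" if "bdd u" "g \<in> E'" for u g
      proof -
        have "\<bar>M (\<lambda>h. u (g \<otimes> h)) - M u\<bar> \<le> 2 * b u * \<epsilon>"
          using that E' v b[OF that(1)] bdd_translate[OF that(1), of g] unfolding M_def
          by (auto intro!: vector_mean_translate)
        also have "\<dots> \<le> 2 * b u * \<epsilon>'" using E' b_nonneg[of u] by (intro mult_left_mono) auto
        finally show ?thesis .
      qed
      moreover have "M (\<lambda>_. 1) = 1"
        using v(2) bdd_one by (simp add: M_def vector_mean_def sq)
      moreover have "0 \<le> M u" if "bdd u" "\<forall>h\<in>carrier G. 0 \<le> u h" for u
        using that by (auto simp: M_def vector_mean_def intro!: divide_nonneg_nonneg sum_nonneg)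
      moreover have "M (\<lambda>h. c * u h) = c * M u" if "bdd u" for u c
        using that by (simp add: M_def bdd_scale vector_mean_def sum_distrib_left mult.assoc)
      moreover have "M (\<lambda>h. u h + w h) = M u + M w" if "bdd u" "bdd w" for u w
        using that by (simp add: M_def bdd_add vector_mean_def sum.distrib distrib_right add_divide_distrib)
      ultimately show ?thesis by (simp add: Q_def)
    qed
    ultimately show "K \<inter> (\<Inter>i\<in>I'. Q i) \<noteq> {}" by blast
  qed
  then obtain M where M: "\<And>E \<epsilon>. finite E \<Longrightarrow> E \<subseteq> carrier G \<Longrightarrow> 0 < \<epsilon> \<Longrightarrow> M \<in> Q (E, \<epsilon>)"
    by (auto simp: P_def)
  have "M (\<lambda>h. u (g \<otimes> h)) = M u" if "bdd u" "g \<in> carrier G" for u g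
  proof -
    have "\<bar>M (\<lambda>h. u (g \<otimes> h)) - M u\<bar> \<le> \<epsilon>" if "\<epsilon> > 0" for \<epsilon>
    proof -
      \<comment> \<open>The summand 1 guards against \<open>b u = 0\<close>.\<close>
      have "M \<in> Q ({g}, \<epsilon> / (2 * b u + 1))"
        using that b_nonneg[of u] \<open>g \<in> carrier G\<close> by (intro M) (auto intro!: divide_pos_pos add_nonneg_pos)
      then have "\<bar>M (\<lambda>h. u (g \<otimes> h)) - M u\<bar> \<le> 2 * b u * (\<epsilon> / (2 * b u + 1))"
        using \<open>bdd u\<close> by (simp add: Q_def)
      also have "\<dots> \<le> \<epsilon>" using that b_nonneg[of u] by (simp add: field_simps)
      finally show ?thesis .
    qed
    then show ?thesis using field_le_epsilon[of "\<bar>M (\<lambda>h. u (g \<otimes> h)) - M u\<bar>" 0] by simp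
  qed
  moreover have "M \<in> Q ({}, 1)" by (intro M) auto
  ultimately have "amenable G"
    unfolding amenable_def by (intro exI[of _ M]) (simp add: Q_def flip: bdd_def)
  then show False using assms by contradiction
qed

end

section \<open>The twisted transfer operator\<close>

definition word_prod :: "('g, 'm) monoid_scheme \<Rightarrow> ('s \<Rightarrow> 'g) \<Rightarrow> 's list \<Rightarrow> 'g" where
  "word_prod G \<psi> w = foldr (\<lambda>s g. \<psi> s \<otimes>\<^bsub>G\<^esub> g) w \<one>\<^bsub>G\<^esub>"

lemma word_prod_simps [simp]:
  "word_prod G \<psi> [] = \<one>\<^bsub>G\<^esub>" "word_prod G \<psi> (s # w) = \<psi> s \<otimes>\<^bsub>G\<^esub> word_prod G \<psi> w"
  by (simp_all add: word_prod_def)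

text \<open>The word \<open>v\<close> is the interior of a path from \<open>s\<close> to
  \<open>b\<close>. Its group element counts \<open>s\<close> but not \<open>b\<close>, because the
  skew product multiplies by \<psi> of the state being left.\<close>

abbreviation joins :: "('g, 'm) monoid_scheme \<Rightarrow> 's set \<Rightarrow> ('s \<Rightarrow> 's \<Rightarrow> bool) \<Rightarrow> ('s \<Rightarrow> 'g)
    \<Rightarrow> nat \<Rightarrow> 's \<Rightarrow> 's \<Rightarrow> 'g \<Rightarrow> 's list \<Rightarrow> bool" where
  "joins G S A \<psi> n s b h v \<equiv> length v = n \<and> set v \<subseteq> S \<and> successively A (s # v @ [b]) \<and>
     word_prod G \<psi> (s # v) = h"

text \<open>Here both end states belong to \<open>w\<close>, unlike in \<open>joins\<close>.\<close>

abbreviation connects :: "'s set \<Rightarrow> ('s \<Rightarrow> 's \<Rightarrow> bool) \<Rightarrow> nat \<Rightarrow> 's \<Rightarrow> 's \<Rightarrow> 's list \<Rightarrow> bool" where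
  "connects S A n s t w \<equiv> length w = n \<and> set w \<subseteq> S \<and> successively A w \<and> hd w = s \<and> last w = t"

context group
begin

lemma word_prod_closed: "\<psi> \<in> S \<rightarrow> carrier G \<Longrightarrow> set w \<subseteq> S \<Longrightarrow> word_prod G \<psi> w \<in> carrier G"
  by (induction w) auto

lemma word_prod_append:
  "\<psi> \<in> S \<rightarrow> carrier G \<Longrightarrow> set (u @ w) \<subseteq> S \<Longrightarrow>
     word_prod G \<psi> (u @ w) = word_prod G \<psi> u \<otimes> word_prod G \<psi> w"
  by (induction u) (auto simp: m_assoc word_prod_closed Pi_iff)

lemma cocycle_eq_word_prod:
  assumes "\<psi> \<in> S \<rightarrow> carrier G" "x \<in> markov_shift S A"
  shows "cocycle G \<psi> n x = word_prod G \<psi> (prefix n x)"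
proof (induction n)
  case (Suc n)
  have "set (prefix n x @ [x n]) \<subseteq> S" using assms(2) by (auto simp: markov_shift_def)
  from word_prod_append[OF assms(1) this] show ?case
    using Suc assms by (auto simp: funpow_shift suffix_def markov_shift_def Pi_iff)
qed simp

lemma skew_path:
  assumes "\<psi> \<in> S \<rightarrow> carrier G" "s \<in> S" "g \<in> carrier G" "fst ` set w \<subseteq> S"
    and "successively (skew_transition G A \<psi>) ((s, g) # w @ [(b, h)])"
  shows "successively A (s # map fst w @ [b]) \<and> h = g \<otimes> word_prod G \<psi> (s # map fst w)"
  using assms(2-)
proof (induction w arbitrary: s g)
  case Nil
  then show ?case using assms(1) by (auto simp: skew_transition_def Pi_iff)
next
  case (Cons t w)
  obtain s' g' where t: "t = (s', g')" by (cases t)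
  have *: "A s s'" "g' = g \<otimes> \<psi> s" "s' \<in> S" using Cons.prems t by (auto simp: skew_transition_def)
  moreover have "g' \<in> carrier G" using * Cons.prems assms(1) by auto
  moreover have "fst ` set w \<subseteq> S" "successively (skew_transition G A \<psi>) ((s', g') # w @ [(b, h)])"
    using Cons.prems t by auto
  ultimately have "successively A (s' # map fst w @ [b]) \<and> h = g' \<otimes> word_prod G \<psi> (s' # map fst w)"
    by (intro Cons.IH) auto
  moreover have "word_prod G \<psi> (s' # map fst w) \<in> carrier G" "\<psi> s \<in> carrier G"
    using assms(1) \<open>s' \<in> S\<close> \<open>s \<in> S\<close> \<open>fst ` set w \<subseteq> S\<close>
    by (auto simp: image_subset_iff intro!: word_prod_closed[of \<psi> S] simp del: word_prod_simps)
  ultimately show ?case using * t Cons.prems by (simp add: m_assoc)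
qed

text \<open>A path starting at group coordinate \<open>\<one>\<close> ends at the product of its
  word, so mixing of the skew product realises every group element between any two states at every
  large length.\<close>

lemma skew_mixingD:
  assumes "\<psi> \<in> S \<rightarrow> carrier G" "skew_mixing G S A \<psi>" "s \<in> S" "b \<in> S" "h \<in> carrier G"
  shows "\<exists>N. \<forall>n\<ge>N. \<exists>v. joins G S A \<psi> n s b h v"
proof -
  have "(s, \<one>) \<in> S \<times> carrier G" "(b, h) \<in> S \<times> carrier G" using assms by auto
  then obtain N where N: "\<And>n. n \<ge> N \<Longrightarrow> \<exists>w\<in>words (S \<times> carrier G) (skew_transition G A \<psi>) n.
      (s, \<one>) # w @ [(b, h)] \<in> words (S \<times> carrier G) (skew_transition G A \<psi>) (n + 2)"
    using assms(2) unfolding skew_mixing_def topologically_mixing_def by blast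
  have "\<exists>v. joins G S A \<psi> n s b h v"
    if n: "n \<ge> N" for n
  proof -
    obtain w where w: "length w = n" "set w \<subseteq> S \<times> carrier G"
      "successively (skew_transition G A \<psi>) ((s, \<one>) # w @ [(b, h)])"
      using N[OF n] by (auto simp: words_def)
    then have fst: "fst ` set w \<subseteq> S" by auto
    have "word_prod G \<psi> (s # map fst w) \<in> carrier G"
      using assms(1,3) fst by (intro word_prod_closed[of \<psi> S]) auto
    then show ?thesis
      using skew_path[OF assms(1,3) one_closed fst w(3)] w fst by (intro exI[of _ "map fst w"]) auto
  qed
  then show ?thesis by blast
qed

end

text \<open>The finite sets \<open>T\<close> are the alphabets. \<open>M\<close> bounds the one-step
  sums uniformly in them, so that later constants need not depend on \<open>T\<close>. The potential
  will be the tilted one.\<close>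

locale group_extension = hoelder_shift S A \<phi> C \<theta> + group G
  for S :: "'s set" and A \<phi> C \<theta> and G :: "('g, 'm) monoid_scheme" (structure) +
  fixes \<psi> :: "'s \<Rightarrow> 'g" and B :: "'s set" and M :: real
  assumes \<psi>: "\<psi> \<in> S \<rightarrow> carrier G"
    and mixing: "skew_mixing G S A \<psi>"
    and finite_B: "finite B" and B_subset: "B \<subseteq> S"
    and bip: "\<And>s. s \<in> S \<Longrightarrow> \<exists>b\<in>B. \<exists>b'\<in>B. A b s \<and> A s b'"
    and M_pos: "M > 0"
    and summable_le: "\<And>x T. x \<in> X \<Longrightarrow> finite T \<Longrightarrow> T \<subseteq> S \<Longrightarrow> (\<Sum>s | s \<in> T \<and> [s] \<frown> x \<in> X. weight [s] x) \<le> M"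
begin

abbreviation "gp \<equiv> word_prod G \<psi>"

lemmas gp_closed = word_prod_closed[OF \<psi>]
lemmas gp_append = word_prod_append[OF \<psi>]

text \<open>The letters of \<open>w\<close> are confined to \<open>T\<close>, but \<open>x\<close>
  may be any point of the shift, so suprema over base points range over the same set for all
  alphabets.\<close>

definition W :: "'s set \<Rightarrow> nat \<Rightarrow> (nat \<Rightarrow> 's) \<Rightarrow> 's list set" where
  "W T n x = {w. length w = n \<and> set w \<subseteq> T \<and> w \<frown> x \<in> X}"

lemma WD: "w \<in> W T n x \<Longrightarrow> length w = n \<and> set w \<subseteq> T \<and> set w \<subseteq> S \<and> w \<frown> x \<in> X"
  unfolding W_def using conc_in_markov_shift by blast

lemma finite_W [simp]: "finite T \<Longrightarrow> finite (W T n x)"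
  unfolding W_def by (rule finite_subset[OF _ finite_lists_length_eq[of T n]]) auto

lemma W_0 [simp]: "x \<in> X \<Longrightarrow> W T 0 x = {[]}"
  by (auto simp: W_def conc_def)

lemma gp_W: "w \<in> W T n x \<Longrightarrow> gp w \<in> carrier G"
  using WD gp_closed by blast

lemma sum_W_add:
  assumes "finite T"
  shows "(\<Sum>w\<in>W T (n + m) x. F w) = (\<Sum>w\<in>W T m x. \<Sum>u\<in>W T n (w \<frown> x). F (u @ w))"
proof -
  have "bij_betw (\<lambda>(w, u). u @ w) (SIGMA w:W T m x. W T n (w \<frown> x)) (W T (n + m) x)"
  proof (rule bij_betwI[where g = "\<lambda>w. (drop n w, take n w)"])
    show "(\<lambda>w. (drop n w, take n w)) \<in> W T (n + m) x \<rightarrow> (SIGMA w:W T m x. W T n (w \<frown> x))"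
    proof
      fix w assume w: "w \<in> W T (n + m) x"
      then have "take n w \<frown> drop n w \<frown> x \<in> X" by (simp add: W_def)
      moreover from this have "drop n w \<frown> x \<in> X" unfolding conc_in_markov_shift[of "take n w"] by blast
      ultimately show "(drop n w, take n w) \<in> (SIGMA w:W T m x. W T n (w \<frown> x))"
        using w by (auto simp: W_def dest: in_set_takeD in_set_dropD)
    qed
  qed (auto simp: W_def)
  from sum.reindex_bij_betw[OF this, of F] show ?thesis
    using assms by (subst sum.Sigma) (auto simp: case_prod_beta)
qed

text \<open>The \<open>n\<close>-th power of the transfer operator over the alphabet
  \<open>T\<close>, applied to the constant function 1.\<close>

definition tot :: "'s set \<Rightarrow> nat \<Rightarrow> (nat \<Rightarrow> 's) \<Rightarrow> real" where
  "tot T n x = (\<Sum>w\<in>W T n x. weight w x)"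

text \<open>The operator twisted by the group, applied to the point mass at the identity: the weight
  of \<open>w\<close> sits at the inverse of \<open>gp w\<close>. With this convention passing to
  the base point \<open>w \<frown> x\<close> becomes a left translation by \<open>gp w\<close>, and
  the value at \<open>\<one>\<close> is the mass of the words with trivial product.\<close>

definition vec :: "'s set \<Rightarrow> nat \<Rightarrow> (nat \<Rightarrow> 's) \<Rightarrow> 'g \<Rightarrow> real" where
  "vec T n x g = (\<Sum>w\<in>W T n x. if gp w \<otimes> g = \<one> then weight w x else 0)"

definition nrm :: "'s set \<Rightarrow> nat \<Rightarrow> (nat \<Rightarrow> 's) \<Rightarrow> real" where
  "nrm T n x = l2 G (vec T n x)"

lemma tot_nonneg [simp]: "tot T n x \<ge> 0"
  by (simp add: tot_def sum_nonneg)

lemma vec_nonneg [simp]: "vec T n x g \<ge> 0"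
  by (auto simp: vec_def intro: sum_nonneg)

lemma nrm_nonneg [simp]: "nrm T n x \<ge> 0"
  by (simp add: nrm_def)

lemma tot_0 [simp]: "x \<in> X \<Longrightarrow> tot T 0 x = 1"
  by (simp add: tot_def)

lemma tot_add: "finite T \<Longrightarrow> tot T (n + m) x = (\<Sum>w\<in>W T m x. weight w x * tot T n (w \<frown> x))"
  unfolding tot_def by (simp add: sum_W_add weight_append sum_distrib_left mult.commute)

lemma vec_add:
  assumes "finite T" "g \<in> carrier G"
  shows "vec T (n + m) x g = (\<Sum>w\<in>W T m x. weight w x * vec T n (w \<frown> x) (gp w \<otimes> g))"
proof -
  have "(if gp (u @ w) \<otimes> g = \<one> then weight (u @ w) x else 0) =
      weight w x * (if gp u \<otimes> (gp w \<otimes> g) = \<one> then weight u (w \<frown> x) else 0)"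
    if "w \<in> W T m x" "u \<in> W T n (w \<frown> x)" for w u
  proof -
    have "gp (u @ w) \<otimes> g = gp u \<otimes> (gp w \<otimes> g)"
      using that WD[OF that(1)] WD[OF that(2)] gp_W assms(2) by (subst gp_append) (auto simp: m_assoc)
    then show ?thesis by (simp add: weight_append)
  qed
  then show ?thesis
    unfolding vec_def sum_W_add[OF assms(1)] sum_distrib_left by (intro sum.cong refl) auto
qed

lemma fin_supp_vec [simp]:
  assumes "finite T"
  shows "fin_supp G (vec T n x)"
  unfolding fin_supp_def
proof (rule finite_subset)
  show "finite ((\<lambda>w. inv (gp w)) ` W T n x)" using assms by simp
  show "{g \<in> carrier G. vec T n x g \<noteq> 0} \<subseteq> (\<lambda>w. inv (gp w)) ` W T n x"
  proof
    fix g assume g: "g \<in> {g \<in> carrier G. vec T n x g \<noteq> 0}"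
    then have "(\<Sum>w\<in>W T n x. if gp w \<otimes> g = \<one> then weight w x else 0) \<noteq> 0"
      by (simp add: vec_def)
    then obtain w where "w \<in> W T n x" "(if gp w \<otimes> g = \<one> then weight w x else 0) \<noteq> 0"
      by (rule sum.not_neutral_contains_not_neutral)
    then have "w \<in> W T n x" "gp w \<otimes> g = \<one>" by (auto split: if_splits)
    then show "g \<in> (\<lambda>w. inv (gp w)) ` W T n x"
      using g gp_W[of w] by (intro image_eqI[of _ _ w]) (auto, metis inv_equality inv_inv)
  qed
qed

lemma fin_supp_vec_translate [simp]:
  "finite T \<Longrightarrow> w \<in> W T' m y \<Longrightarrow> fin_supp G (\<lambda>g. vec T n x (gp w \<otimes> g))"
  by (simp add: fin_supp_translate gp_W)

text \<open>Translations are isometries, so this is the triangle inequality; without amenability,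
  \<open>contraction\<close> improves on exactly this estimate.\<close>

lemma nrm_add:
  assumes "finite T"
  shows "nrm T (n + m) x \<le> (\<Sum>w\<in>W T m x. weight w x * nrm T n (w \<frown> x))"
proof -
  have "nrm T (n + m) x = l2 G (\<lambda>g. \<Sum>w\<in>W T m x. weight w x * vec T n (w \<frown> x) (gp w \<otimes> g))"
    unfolding nrm_def by (rule l2_cong) (rule vec_add[OF assms])
  also have "\<dots> \<le> (\<Sum>w\<in>W T m x. l2 G (\<lambda>g. weight w x * vec T n (w \<frown> x) (gp w \<otimes> g)))"
    using assms by (intro l2_sum) auto
  also have "\<dots> = (\<Sum>w\<in>W T m x. weight w x * nrm T n (w \<frown> x))"
    by (intro sum.cong) (auto simp: l2_scale nrm_def l2_translate gp_W)
  finally show ?thesis .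
qed

lemma tot_le_power:
  assumes "finite T" "T \<subseteq> S" "x \<in> X"
  shows "tot T n x \<le> M ^ n"
  using assms(3)
proof (induction n arbitrary: x)
  case (Suc n)
  have "tot T (n + 1) x = (\<Sum>w\<in>W T 1 x. weight w x * tot T n (w \<frown> x))"
    by (rule tot_add[OF assms(1)])
  also have "\<dots> \<le> (\<Sum>w\<in>W T 1 x. weight w x * M ^ n)"
    using WD by (intro sum_mono mult_left_mono Suc.IH) auto
  also have "W T 1 x = (\<lambda>s. [s]) ` {s \<in> T. [s] \<frown> x \<in> X}"
    by (auto simp: W_def length_Suc_conv)
  also have "(\<Sum>w\<in>\<dots>. weight w x * M ^ n) = (\<Sum>s | s \<in> T \<and> [s] \<frown> x \<in> X. weight [s] x) * M ^ n"
    by (subst sum.reindex) (auto simp: inj_on_def sum_distrib_right)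
  also have "\<dots> \<le> M * M ^ n"
    using Suc.prems assms M_pos by (intro mult_right_mono summable_le) auto
  finally show ?case by simp
qed auto

lemma nrm_add_le:
  assumes "finite T" "\<And>y. y \<in> X \<Longrightarrow> nrm T n y \<le> c"
  shows "nrm T (n + m) x \<le> tot T m x * c"
proof -
  have "nrm T (n + m) x \<le> (\<Sum>w\<in>W T m x. weight w x * nrm T n (w \<frown> x))" by (rule nrm_add[OF assms(1)])
  also have "\<dots> \<le> (\<Sum>w\<in>W T m x. weight w x * c)"
    using assms(2) WD by (intro sum_mono mult_left_mono) auto
  finally show ?thesis by (simp add: tot_def sum_distrib_right)
qed

lemma nrm_0_le: 
  assumes "x \<in> X"
  shows "nrm T 0 x \<le> 1"
proof -
  have vec: "vec T 0 x g = (if g = \<one> then 1 else 0)" if "g \<in> carrier G" for g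
    using that assms by (simp add: vec_def)
  have "l2 G (vec T 0 x) = L2_set (vec T 0 x) {\<one>}"
    by (intro l2_eq) (auto simp: vec split: if_splits)
  also have "\<dots> = 1" by (simp add: L2_set_def vec)
  finally show ?thesis by (simp add: nrm_def)
qed

lemma nrm_le_power:
  assumes "finite T" "T \<subseteq> S" "x \<in> X"
  shows "nrm T n x \<le> M ^ n"
  using nrm_add_le[OF assms(1), of 0 1 n x] nrm_0_le tot_le_power[OF assms, of n] by auto

definition snrm :: "'s set \<Rightarrow> nat \<Rightarrow> real" where
  "snrm T n = (SUP x\<in>X. nrm T n x)"

lemma nrm_le_snrm: "finite T \<Longrightarrow> T \<subseteq> S \<Longrightarrow> x \<in> X \<Longrightarrow> nrm T n x \<le> snrm T n"
  unfolding snrm_def by (intro cSUP_upper bdd_aboveI2[of _ _ "M ^ n"] nrm_le_power)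

lemma snrm_leI: "X \<noteq> {} \<Longrightarrow> (\<And>x. x \<in> X \<Longrightarrow> nrm T n x \<le> c) \<Longrightarrow> snrm T n \<le> c"
  unfolding snrm_def by (rule cSUP_least)


subsection \<open>Comparison between base points\<close>

text \<open>The mixing times of finitely many pairs are all bounded by their sum, which gives one
  common length.\<close>

lemma mix_finite:
  assumes "finite I" "\<And>i. i \<in> I \<Longrightarrow> s i \<in> S \<and> b i \<in> S \<and> h i \<in> carrier G"
  shows "\<exists>N. \<forall>n\<ge>N. \<exists>v. \<forall>i\<in>I. joins G S A \<psi> n (s i) (b i) (h i) (v i)"
proof -
  have "\<forall>i\<in>I. \<exists>N. \<forall>n\<ge>N. \<exists>v. joins G S A \<psi> n (s i) (b i) (h i) v"
    using assms(2) by (intro ballI skew_mixingD \<psi> mixing) auto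
  from bchoice[OF this] obtain N where N: "\<forall>i\<in>I. \<forall>n\<ge>N i. \<exists>v. joins G S A \<psi> n (s i) (b i) (h i) v"
    ..
  have le: "N i \<le> sum N I" if "i \<in> I" for i
    using that assms(1) by (intro member_le_sum) auto
  show ?thesis
  proof (intro exI[of _ "sum N I"] allI impI)
    fix n assume n: "sum N I \<le> n"
    have "\<forall>i\<in>I. \<exists>v. joins G S A \<psi> n (s i) (b i) (h i) v"
    proof
      fix i assume i: "i \<in> I"
      show "\<exists>v. joins G S A \<psi> n (s i) (b i) (h i) v"
        using N[rule_format, OF i order_trans[OF le[OF i] n]] .
    qed
    then show "\<exists>v. \<forall>i\<in>I. joins G S A \<psi> n (s i) (b i) (h i) (v i)"
      by (rule bchoice)
  qed
qed

text \<open>For gluing: with one common length and a uniform lower bound for the weights, arbitrary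
  words can be joined at bounded cost. Distortion makes the bound uniform over the points that
  follow.\<close>

lemma connectors:
  assumes "finite S0" "S0 \<subseteq> S"
  obtains N \<kappa> c where "N > 0" "c > 0"
    "\<And>s t. s \<in> S0 \<Longrightarrow> t \<in> S0 \<Longrightarrow> connects S A N s t (\<kappa> s t)"
    "\<And>s t x. s \<in> S0 \<Longrightarrow> t \<in> S0 \<Longrightarrow> \<kappa> s t \<frown> x \<in> X \<Longrightarrow> c \<le> weight (\<kappa> s t) x"
proof -
  have "\<exists>N. \<forall>n\<ge>N. \<exists>v. \<forall>i\<in>S0 \<times> S0. joins G S A \<psi> n (fst i) (snd i) \<one> (v i)"
    using assms by (intro mix_finite) auto
  then obtain N where "\<forall>n\<ge>N. \<exists>v. \<forall>i\<in>S0 \<times> S0. joins G S A \<psi> n (fst i) (snd i) \<one> (v i)" ..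
  then have "\<exists>v. \<forall>i\<in>S0 \<times> S0. joins G S A \<psi> N (fst i) (snd i) \<one> (v i)"
    by simp
  then obtain v where v: "\<And>i. i \<in> S0 \<times> S0 \<Longrightarrow> length (v i) = N \<and> set (v i) \<subseteq> S \<and>
    successively A (fst i # v i @ [snd i])"
    by fast
  define \<kappa> where "\<kappa> s t = s # v (s, t) @ [t]" for s t
  have "finite ((\<lambda>(s, t). \<kappa> s t) ` (S0 \<times> S0))" using assms by simp
  from weight_lower_bound[OF this] obtain c where
    "c > 0" "\<And>s t x. s \<in> S0 \<Longrightarrow> t \<in> S0 \<Longrightarrow> \<kappa> s t \<frown> x \<in> X \<Longrightarrow> c \<le> weight (\<kappa> s t) x"
    by auto
  moreover have "connects S A (N + 2) s t (\<kappa> s t)" if "s \<in> S0" "t \<in> S0" for s t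
    using v[of "(s, t)"] that assms unfolding \<kappa>_def by auto
  \<comment> \<open>The two extra letters are the end states.\<close>
  ultimately show ?thesis using that[of "N + 2" c \<kappa>] by simp
qed

lemma exists_point: "a \<in> S \<Longrightarrow> \<exists>y\<in>X. y 0 = a"
proof -
  assume a: "a \<in> S"
  then obtain v where v: "set v \<subseteq> S" "successively A (a # v @ [a])"
    using skew_mixingD[OF \<psi> mixing, of a a \<one>] by blast
  then have "successively A (a # v) \<and> A (last (a # v)) a"
    using successively_append_iff[of A "a # v" "[a]"] by simp
  then have "(a # v)\<^sup>\<omega> \<in> X" using a v(1) by (subst iter_in_markov_shift) auto
  then show ?thesis by (intro bexI[of _ "(a # v)\<^sup>\<omega>"]) (auto simp: iter_def)
qed

lemma tot_pos:
  assumes "finite T" "B \<subseteq> T" "T \<subseteq> S" "x \<in> X"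
  shows "tot T n x > 0"
  using assms(4)
proof (induction n arbitrary: x)
  case (Suc n)
  have "x 0 \<in> S" using Suc.prems by (auto simp: markov_shift_def)
  then obtain b where b: "b \<in> B" "A b (x 0)" using bip by blast
  then have w: "[b] \<in> W T 1 x" using Suc.prems assms(2,3) by (auto simp: W_def conc_in_markov_shift)
  then have "0 < weight [b] x * tot T n ([b] \<frown> x)" using WD[OF w] by (intro mult_pos_pos Suc.IH) auto
  also have "\<dots> \<le> (\<Sum>w\<in>W T 1 x. weight w x * tot T n (w \<frown> x))"
    using w assms(1) by (intro member_le_sum) auto
  also have "\<dots> = tot T (n + 1) x" using tot_add[OF assms(1), of n 1 x] by simp
  finally show ?case by simp
qed auto

text \<open>After a word \<open>w\<close> before \<open>x\<close>, a connector from some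
  \<open>b'\<close> with \<open>A (last w) b'\<close> to some \<open>b\<close> with
  \<open>A b (y 0)\<close> leads to \<open>y\<close>. By BIP both states can be taken in the finite
  set \<open>B\<close>, so finitely many connectors serve all words and points, and \<open>L\<close>
  collects their letters. The price is distortion, the least connector weight and a factor
  \<open>card B\<close>; on norms a connector acts by an isometric translation.\<close>

lemma comparison:
  obtains N K L where "N > 0" "K \<ge> 0" "finite L" "B \<subseteq> L" "L \<subseteq> S"
    "\<And>T n x y. finite T \<Longrightarrow> L \<subseteq> T \<Longrightarrow> T \<subseteq> S \<Longrightarrow> n \<ge> 1 \<Longrightarrow> x \<in> X \<Longrightarrow> y \<in> X \<Longrightarrow>
       tot T n x \<le> K * tot T (n + N) y \<and> nrm T n x \<le> K * nrm T (n + N) y"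
proof -
  obtain N \<kappa> c where N: "N > 0" and c: "c > 0"
    and \<kappa>: "\<And>s t. s \<in> B \<Longrightarrow> t \<in> B \<Longrightarrow> connects S A N s t (\<kappa> s t)"
    and \<kappa>_weight: "\<And>s t x. s \<in> B \<Longrightarrow> t \<in> B \<Longrightarrow> \<kappa> s t \<frown> x \<in> X \<Longrightarrow> c \<le> weight (\<kappa> s t) x"
    using connectors[OF finite_B B_subset] by metis
  define L where "L = B \<union> (\<Union>s\<in>B. \<Union>t\<in>B. set (\<kappa> s t))"
  have L: "finite L" "B \<subseteq> L" "L \<subseteq> S" using finite_B B_subset \<kappa> by (auto simp: L_def)
  define k where "k = exp D / c"
  have k: "k > 0" using c by (simp add: k_def)
  have main: "tot T n x \<le> (real (card B) * k) * tot T (n + N) y \<and> nrm T n x \<le> (real (card B) * k) * nrm T (n + N) y"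
    if T: "finite T" "L \<subseteq> T" "T \<subseteq> S" and n: "n \<ge> 1" and x: "x \<in> X" and y: "y \<in> X" for T n x y
  proof -
    have "y 0 \<in> S" using y by (auto simp: markov_shift_def)
    then obtain b where b: "b \<in> B" "A b (y 0)" using bip by blast
    define V where "V b' = {w \<in> W T n x. A (last w) b'}" for b'
    have \<kappa>X: "\<kappa> b' b \<frown> y \<in> X" if "b' \<in> B" for b'
      using \<kappa>[OF that b(1)] b(2) y N by (auto simp: conc_in_markov_shift)
    have ext: "w @ \<kappa> b' b \<in> W T (n + N) y \<and> weight w x \<le> k * weight (w @ \<kappa> b' b) y"
      if "b' \<in> B" "w \<in> V b'" for w b'
    proof -
      have w: "w \<noteq> []" "length w = n" "set w \<subseteq> T" "w \<frown> x \<in> X" "A (last w) b'"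
        using that n by (auto simp: V_def W_def)
      have "(\<kappa> b' b \<frown> y) 0 = b'"
        using \<kappa>[OF that(1) b(1)] N by (auto simp: conc_def hd_conv_nth)
      then have wX: "w \<frown> (\<kappa> b' b \<frown> y) \<in> X"
        using w \<kappa>X[OF that(1)] unfolding conc_in_markov_shift[of w] by simp
      have "set (\<kappa> b' b) \<subseteq> T" using that(1) b(1) T(2) by (auto simp: L_def)
      then have 1: "w @ \<kappa> b' b \<in> W T (n + N) y" using w wX \<kappa>[OF that(1) b(1)] by (auto simp: W_def)
      have "weight w x \<le> exp D * weight w (\<kappa> b' b \<frown> y)" by (rule weight_le_D[OF w(4) wX])
      also have "\<dots> = k * (weight w (\<kappa> b' b \<frown> y) * c)" using c by (simp add: k_def)
      also have "\<dots> \<le> k * (weight w (\<kappa> b' b \<frown> y) * weight (\<kappa> b' b) y)"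
        using k \<kappa>_weight[OF that(1) b(1) \<kappa>X[OF that(1)]] by (intro mult_left_mono) auto
      finally show ?thesis using 1 by (simp add: weight_append)
    qed
    have inj: "inj_on (\<lambda>w. w @ \<kappa> b' b) (V b')" for b' by (auto simp: inj_on_def)
    have fin: "finite (V b')" for b' using T by (auto simp: V_def)
    \<comment> \<open>A word may be followed by several states of \<open>B\<close> and is then
      counted more than once; non-negativity makes this harmless.\<close>
    have sum_le: "(\<Sum>w\<in>W T n x. F w) \<le> (\<Sum>b'\<in>B. \<Sum>w\<in>V b'. F w)" if "\<And>w. F w \<ge> 0" for F :: "'s list \<Rightarrow> real"
    proof -
      have "F w \<le> (\<Sum>b'\<in>B. if A (last w) b' then F w else 0)" if w: "w \<in> W T n x" for w
      proof -
        have "last w \<in> S" using WD[OF w] n by (metis last_in_set length_0_conv not_one_le_zero subsetD)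
        then obtain b' where "b' \<in> B" "A (last w) b'" using bip by blast
        then show ?thesis
          using member_le_sum[of b' B "\<lambda>b'. if A (last w) b' then F w else 0"] finite_B \<open>\<And>w. F w \<ge> 0\<close> by auto
      qed
      then have "(\<Sum>w\<in>W T n x. F w) \<le> (\<Sum>w\<in>W T n x. \<Sum>b'\<in>B. if A (last w) b' then F w else 0)"
        by (rule sum_mono)
      also have "\<dots> = (\<Sum>b'\<in>B. \<Sum>w\<in>V b'. F w)"
        using T by (subst sum.swap) (simp add: V_def sum.inter_filter)
      finally show ?thesis .
    qed
    have ext_sum: "(\<Sum>w\<in>V b'. if Q w then weight w x else 0) \<le> k * (\<Sum>v\<in>W T (n + N) y. if Q' v then weight v y else 0)"
      if b': "b' \<in> B" and Q: "\<And>w. w \<in> V b' \<Longrightarrow> Q' (w @ \<kappa> b' b) = Q w" for b' Q Q'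
    proof -
      have "(\<Sum>w\<in>V b'. if Q w then weight w x else 0) \<le>
          (\<Sum>w\<in>V b'. k * (if Q' (w @ \<kappa> b' b) then weight (w @ \<kappa> b' b) y else 0))"
        using ext[OF b'] Q by (intro sum_mono) auto
      also have "\<dots> = k * (\<Sum>v\<in>(\<lambda>w. w @ \<kappa> b' b) ` V b'. if Q' v then weight v y else 0)"
        by (simp add: sum.reindex[OF inj] sum_distrib_left)
      also have "\<dots> \<le> k * (\<Sum>v\<in>W T (n + N) y. if Q' v then weight v y else 0)"
        using ext[OF b'] T k by (intro mult_left_mono sum_mono2) auto
      finally show ?thesis .
    qed
    have "tot T n x \<le> (\<Sum>b'\<in>B. \<Sum>w\<in>V b'. weight w x)" unfolding tot_def by (rule sum_le) simp
    also have "\<dots> \<le> (\<Sum>b'\<in>B. k * tot T (n + N) y)"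
      using ext_sum[of _ "\<lambda>_. True" "\<lambda>_. True"] by (intro sum_mono) (simp add: tot_def)
    finally have 1: "tot T n x \<le> (real (card B) * k) * tot T (n + N) y" by simp
    \<comment> \<open>Translation by \<open>?h b'\<close> cancels the group element of the
      connector.\<close>
    let ?h = "\<lambda>b'. inv (gp (\<kappa> b' b))"
    have h: "?h b' \<in> carrier G" if "b' \<in> B" for b'
      using \<kappa>[OF that b(1)] by (intro inv_closed gp_closed) auto
    have vec_le: "vec T n x g \<le> (\<Sum>b'\<in>B. k * vec T (n + N) y (?h b' \<otimes> g))" if g: "g \<in> carrier G" for g
    proof -
      have "vec T n x g \<le> (\<Sum>b'\<in>B. \<Sum>w\<in>V b'. if gp w \<otimes> g = \<one> then weight w x else 0)"
        unfolding vec_def by (rule sum_le) simp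
      also have "\<dots> \<le> (\<Sum>b'\<in>B. k * vec T (n + N) y (?h b' \<otimes> g))"
      proof (rule sum_mono)
        fix b' assume b': "b' \<in> B"
        have "gp (w @ \<kappa> b' b) \<otimes> (?h b' \<otimes> g) = gp w \<otimes> g" if "w \<in> V b'" for w
        proof -
          have wS: "set w \<subseteq> S" using that WD unfolding V_def by blast
          have cl: "gp w \<in> carrier G" "gp (\<kappa> b' b) \<in> carrier G"
            using wS \<kappa>[OF b' b(1)] gp_closed by auto
          have "gp (w @ \<kappa> b' b) = gp w \<otimes> gp (\<kappa> b' b)"
            using wS \<kappa>[OF b' b(1)] by (intro gp_append) auto
          moreover have "gp w \<otimes> gp (\<kappa> b' b) \<otimes> (?h b' \<otimes> g) = gp w \<otimes> (gp (\<kappa> b' b) \<otimes> ?h b') \<otimes> g"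
            using cl g by (simp only: m_assoc m_closed inv_closed)
          ultimately show ?thesis using cl g by (simp only: r_inv r_one)
        qed
        then show "(\<Sum>w\<in>V b'. if gp w \<otimes> g = \<one> then weight w x else 0) \<le> k * vec T (n + N) y (?h b' \<otimes> g)"
          unfolding vec_def by (intro ext_sum b') simp
      qed
      finally show ?thesis .
    qed
    have fs: "fin_supp G (\<lambda>g. k * vec T (n + N) y (?h b' \<otimes> g))" if "b' \<in> B" for b'
      using T h[OF that] by (intro fin_supp_scale fin_supp_translate) auto
    have "nrm T n x \<le> l2 G (\<lambda>g. \<Sum>b'\<in>B. k * vec T (n + N) y (?h b' \<otimes> g))"
      unfolding nrm_def
    proof (rule l2_mono)
      show "fin_supp G (\<lambda>g. \<Sum>b'\<in>B. k * vec T (n + N) y (?h b' \<otimes> g))" by (intro fin_supp_sum fs)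
      fix g assume "g \<in> carrier G"
      then show "\<bar>vec T n x g\<bar> \<le> \<bar>\<Sum>b'\<in>B. k * vec T (n + N) y (?h b' \<otimes> g)\<bar>"
        using vec_le[of g] vec_nonneg[of T n x g] by linarith
    qed
    also have "\<dots> \<le> (\<Sum>b'\<in>B. l2 G (\<lambda>g. k * vec T (n + N) y (?h b' \<otimes> g)))"
      by (intro l2_sum fs)
    also have "\<dots> = (\<Sum>b'\<in>B. k * nrm T (n + N) y)"
    proof (intro sum.cong refl)
      fix b' assume "b' \<in> B"
      from l2_translate[OF h[OF this], of "vec T (n + N) y"] show
        "l2 G (\<lambda>g. k * vec T (n + N) y (?h b' \<otimes> g)) = k * nrm T (n + N) y"
        using k by (simp add: l2_scale nrm_def)
    qed
    finally show ?thesis using 1 by simp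
  qed
  have "0 \<le> real (card B) * k" using k by simp
  with N show ?thesis using L main by (rule that)
qed

end

lemma l2_minus_commute: "l2 G (\<lambda>g. u g - v g) = l2 G (\<lambda>g. v g - u g)"
  using l2_scale[of G "-1" "\<lambda>g. v g - u g"] by simp

lemma l2_triangle3:
  assumes "fin_supp G u" "fin_supp G v" "fin_supp G w"
  shows "l2 G (\<lambda>g. u g - w g) \<le> l2 G (\<lambda>g. u g - v g) + l2 G (\<lambda>g. v g - w g)"
  using l2_triangle[of G "\<lambda>g. u g - v g" "\<lambda>g. v g - w g"] assms by simp

lemma abs_l2_diff:
  assumes "fin_supp G u" "fin_supp G v"
  shows "\<bar>l2 G u - l2 G v\<bar> \<le> l2 G (\<lambda>g. u g - v g)"
  using l2_triangle3[OF assms fin_supp_0] l2_triangle3[OF assms(2,1) fin_supp_0]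
    l2_minus_commute[of G u v] by simp

context group_extension
begin

subsection \<open>Contraction for non-amenable groups\<close>

text \<open>Points sharing their first coordinate admit the same words, hence
  \<open>k \<ge> 1\<close>. The weights then differ by a factor that is close to 1 for large
  \<open>k\<close>, and so do the vectors, coordinate by coordinate.\<close>

lemma vec_Hoelder:
  assumes "x \<in> X" "y \<in> X" "k \<ge> 1" "\<And>i. i < k \<Longrightarrow> x i = y i"
  shows "vec T n x g \<le> exp (D * \<theta> ^ k) * vec T n y g"
proof -
  have "x 0 = y 0" using assms by auto
  then have W: "W T n x = W T n y" using assms by (auto simp: W_def conc_in_markov_shift)
  have "weight w x \<le> exp (D * \<theta> ^ k) * weight w y" if "w \<in> W T n y" for w
    using weight_le[where w = w and k = k and x = x and y = y, OF _ _ assms(4)] that WD[of w T n x] WD[OF that] W by blast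
  then show ?thesis
    unfolding vec_def W sum_distrib_left by (intro sum_mono) auto
qed

text \<open>A common coefficient \<open>c\<close> is split off from both terms: that part carries
  the deficit \<open>e\<close>, and the remainder obeys the triangle inequality.\<close>

lemma l2_pair_deficit:
  assumes "fin_supp G u" "fin_supp G v" "0 < c" "c \<le> \<alpha>" "c \<le> \<beta>"
    and "l2 G (\<lambda>g. u g + v g) \<le> l2 G u + l2 G v - e"
  shows "l2 G (\<lambda>g. \<alpha> * u g + \<beta> * v g) \<le> \<alpha> * l2 G u + \<beta> * l2 G v - c * e"
proof -
  have "l2 G (\<lambda>g. \<alpha> * u g + \<beta> * v g) =
      l2 G (\<lambda>g. c * (u g + v g) + ((\<alpha> - c) * u g + (\<beta> - c) * v g))"
    by (rule l2_cong) (simp add: algebra_simps)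
  also have "\<dots> \<le> l2 G (\<lambda>g. c * (u g + v g)) + l2 G (\<lambda>g. (\<alpha> - c) * u g + (\<beta> - c) * v g)"
    using assms by (intro l2_triangle) auto
  also have "\<dots> \<le> l2 G (\<lambda>g. c * (u g + v g)) + (l2 G (\<lambda>g. (\<alpha> - c) * u g) + l2 G (\<lambda>g. (\<beta> - c) * v g))"
    using assms by (intro add_left_mono l2_triangle) auto
  also have "\<dots> = c * l2 G (\<lambda>g. u g + v g) + ((\<alpha> - c) * l2 G u + (\<beta> - c) * l2 G v)"
    using assms by (simp add: l2_scale)
  also have "c * l2 G (\<lambda>g. u g + v g) \<le> c * (l2 G u + l2 G v - e)"
    using assms by (intro mult_left_mono) auto
  finally show ?thesis by (simp add: algebra_simps)
qed

text \<open>The words \<open>w g b\<close> share a long prefix, so the vectors at the points \<open>w g b \<frown> x\<close> nearly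
  agree, but they carry different group elements \<open>g\<close>; without almost invariant vectors their
  translates cannot be aligned.\<close>

lemma contraction:
  assumes "\<not> amenable G" "S \<noteq> {}"
  obtains m c L where "m > N0" "c > 0" "finite L" "L \<subseteq> S"
    "\<And>T n x. finite T \<Longrightarrow> L \<subseteq> T \<Longrightarrow> T \<subseteq> S \<Longrightarrow> x \<in> X \<Longrightarrow> \<exists>w\<in>W T m x.
       nrm T (n + m) x \<le> (\<Sum>w\<in>W T m x. weight w x * nrm T n (w \<frown> x)) - c * nrm T n (w \<frown> x)"
proof -
  obtain E \<epsilon> where E: "finite E" "E \<subseteq> carrier G" "0 < \<epsilon>"
    "\<And>v. fin_supp G v \<Longrightarrow> l2 G v > 0 \<Longrightarrow> \<exists>g\<in>E. \<epsilon> * l2 G v < l2 G (\<lambda>h. v (g \<otimes> h) - v h)"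
    using not_amenableD[OF assms(1)] by blast
  \<comment> \<open>Chosen for \<open>l2_add_deficit\<close> applied with
    \<open>\<epsilon> / 2\<close>: it needs \<open>2 * \<eta> \<le> \<epsilon> / 2\<close>, and a
    relative distance \<epsilon> between translates must survive an error \<eta> as at least
    \<open>\<epsilon> / 2\<close>.\<close>
  define \<eta> where "\<eta> = min (\<epsilon> / 4) 1"
  have \<eta>: "\<eta> > 0" "\<eta> \<le> \<epsilon> / 4" "\<eta> \<le> 1" using E by (auto simp: \<eta>_def)
  have "(\<lambda>k. exp (D * \<theta> ^ k)) \<longlonglongrightarrow> exp (D * 0)"
    using \<theta>_pos \<theta>_less by (intro tendsto_intros LIMSEQ_power_zero) auto
  then have "\<forall>\<^sub>F k in sequentially. exp (D * \<theta> ^ k) < 1 + \<eta>"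
    using \<eta> by (intro order_tendstoD) auto
  then have "\<forall>\<^sub>F k in sequentially. exp (D * \<theta> ^ k) < 1 + \<eta> \<and> k \<ge> 1"
    using eventually_ge_at_top[of 1] by eventually_elim auto
  then obtain k where k: "exp (D * \<theta> ^ k) < 1 + \<eta>" "k \<ge> 1"
    by (auto dest!: eventually_happens)
  obtain x0 where x0: "x0 \<in> X" using exists_point assms(2) by blast
  define u where "u = prefix k x0"
  define s where "s = x0 k"
  have s: "s \<in> S" using x0 by (auto simp: s_def markov_shift_def)
  have "prefix (Suc k) x0 = u @ [s]" by (simp add: u_def s_def)
  then have us: "length u = k" "set u \<subseteq> S" "successively A (u @ [s])"
    using prefix_in_words[OF x0, of "Suc k"] by (auto simp: words_def)
  \<comment> \<open>The identity is added to \<open>E\<close> to supply a reference word.\<close>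
  define I where "I = insert \<one> E \<times> B"
  have I: "finite I" using E finite_B by (simp add: I_def)
  \<comment> \<open>Solves \<open>gp u \<otimes> (h (g, b) \<otimes> \<psi> b) = g\<close>, so that
    prefix, middle part and last letter together multiply to \<open>g\<close>.\<close>
  define h where "h i = inv (gp u) \<otimes> (fst i \<otimes> inv (\<psi> (snd i)))" for i
  have "\<exists>N. \<forall>n\<ge>N. \<exists>v. \<forall>i\<in>I. joins G S A \<psi> n s (snd i) (h i) (v i)"
    using I E us B_subset \<psi> s by (intro mix_finite) (auto simp: I_def h_def intro!: m_closed inv_closed gp_closed)
  then obtain N where N: "\<forall>n\<ge>N. \<exists>v. \<forall>i\<in>I. joins G S A \<psi> n s (snd i) (h i) (v i)" ..
  \<comment> \<open>Makes \<open>m\<close> exceed the prescribed \<open>N0\<close>, which will be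
    the length added in \<open>comparison\<close>.\<close>
  define n0 where "n0 = max N N0"
  have "\<exists>v. \<forall>i\<in>I. joins G S A \<psi> n0 s (snd i) (h i) (v i)"
    using N[rule_format, of n0] by (simp add: n0_def)
  then obtain v where "\<forall>i\<in>I. joins G S A \<psi> n0 s (snd i) (h i) (v i)" ..
  note v = bspec[OF this]
  define w where "w g b = u @ (s # v (g, b)) @ [b]" for g b
  define m where "m = k + n0 + 2"
  have w: "length (w g b) = m" "set (w g b) \<subseteq> S" "successively A (w g b)" "last (w g b) = b"
      "gp (w g b) = g" if "g \<in> insert \<one> E" "b \<in> B" for g b
  proof -
    have i: "(g, b) \<in> I" using that by (simp add: I_def)
    have b: "b \<in> S" "\<psi> b \<in> carrier G" "g \<in> carrier G" "gp u \<in> carrier G"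
      using that B_subset \<psi> E gp_closed us by auto
    then have gpb: "gp [b] = \<psi> b" by simp
    show "length (w g b) = m" using v[OF i] us by (simp add: w_def m_def)
    show S: "set (w g b) \<subseteq> S" using v[OF i] us s b by (auto simp: w_def)
    show "successively A (w g b)"
      using v[OF i] us by (auto simp: w_def successively_append_iff)
    show "last (w g b) = b" by (simp add: w_def)
    have "gp (w g b) = gp u \<otimes> (gp (s # v (g, b)) \<otimes> gp [b])"
      using S unfolding w_def by (subst gp_append, simp, subst gp_append) auto
    also have "\<dots> = gp u \<otimes> (h (g, b) \<otimes> \<psi> b)" using v[OF i] gpb by simp
    also have "\<dots> = g" using b by (simp add: h_def m_assoc) (simp flip: m_assoc)
    finally show "gp (w g b) = g" .
  qed
  have "finite ((\<lambda>(g, b). w g b) ` I)" using I by simp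
  from weight_lower_bound[OF this] obtain c where c0: "c > 0"
    "\<forall>v\<in>(\<lambda>(g, b). w g b) ` I. \<forall>x. v \<frown> x \<in> X \<longrightarrow> c \<le> weight v x" by blast
  have c: "c \<le> weight (w g b) x" if "g \<in> insert \<one> E" "b \<in> B" "w g b \<frown> x \<in> X" for g b x
  proof -
    have "(g, b) \<in> I" using that by (simp add: I_def)
    then have "w g b \<in> (\<lambda>(g, b). w g b) ` I" by (intro image_eqI[of _ _ "(g, b)"]) auto
    then show ?thesis using c0(2) that(3) by blast
  qed
  define L where "L = (\<Union>g\<in>insert \<one> E. \<Union>b\<in>B. set (w g b))"
  have "finite L" using E finite_B by (auto simp: L_def)
  moreover have "L \<subseteq> S" unfolding L_def using w(2) by blast
  ultimately have L: "finite L" "L \<subseteq> S" .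
  define c' where "c' = c * ((\<epsilon> / 2)\<^sup>2 / 8)"
  show thesis
  proof (rule that[of m c' L])
    show "m > N0" by (simp add: m_def n0_def)
    show "c' > 0" using c0 E by (simp add: c'_def)
    fix T n x assume T: "finite T" "L \<subseteq> T" "T \<subseteq> S" and x: "x \<in> X"
    have "x 0 \<in> S" using x by (auto simp: markov_shift_def)
    then obtain b where b: "b \<in> B" "A b (x 0)" using bip by blast
    have wW: "w g b \<in> W T m x" if "g \<in> insert \<one> E" for g
    proof -
      have "set (w g b) \<subseteq> T" using that b(1) T(2) unfolding L_def by blast
      then show ?thesis using w[OF that b(1)] x b(2) by (auto simp: W_def conc_in_markov_shift)
    qed
    define w1 where "w1 = w \<one> b"
    have w1: "w1 \<in> W T m x" "gp w1 = \<one>" using wW w b by (auto simp: w1_def)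
    define v0 where "v0 = vec T n (w1 \<frown> x)"
    have v0: "fin_supp G v0" "l2 G v0 = nrm T n (w1 \<frown> x)" using T by (auto simp: v0_def nrm_def)
    show "\<exists>w\<in>W T m x. nrm T (n + m) x \<le> (\<Sum>w\<in>W T m x. weight w x * nrm T n (w \<frown> x)) - c' * nrm T n (w \<frown> x)"
    proof (cases "l2 G v0 = 0")
      case True
      then show ?thesis using w1 v0 nrm_add[OF T(1), of n m x] by (intro bexI[of _ w1]) auto
    next
      case False
      then have "l2 G v0 > 0" by (simp add: order_less_le)
      from E(4)[OF v0(1) this] obtain g where g: "g \<in> E" "\<epsilon> * l2 G v0 < l2 G (\<lambda>h. v0 (g \<otimes> h) - v0 h)" by blast
      have gG: "g \<in> carrier G" using g E by auto
      have "l2 G (\<lambda>h. v0 (\<one> \<otimes> h) - v0 h) = l2 G (\<lambda>h. 0)" by (rule l2_cong) simp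
      moreover have "0 \<le> \<epsilon> * l2 G v0" using E by simp
      \<comment> \<open>The two words are therefore distinct, so both of their terms occur in the
        sum over \<open>W T m x\<close>.\<close>
      ultimately have "g \<noteq> \<one>" using g by auto
      define wg where "wg = w g b"
      have wg: "wg \<in> W T m x" "gp wg = g" using wW w b g by (auto simp: wg_def)
      have neq: "w1 \<noteq> wg" using \<open>g \<noteq> \<one>\<close> w1 wg by auto
      define v1 where "v1 = vec T n (wg \<frown> x)"
      define v' where "v' h = v1 (g \<otimes> h)" for h
      have v1: "fin_supp G v1" using T by (simp add: v1_def)
      have v': "fin_supp G v'" unfolding v'_def by (rule fin_supp_translate[OF gG v1])
      have v0g: "fin_supp G (\<lambda>h. v0 (g \<otimes> h))" by (rule fin_supp_translate[OF gG v0(1)])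
      have l2v': "l2 G v' = l2 G v1" unfolding v'_def by (rule l2_translate[OF gG])
      have agree: "(w1 \<frown> x) i = (wg \<frown> x) i" if "i < k" for i
        using that us by (simp add: w1_def wg_def w_def conc_def nth_append)
      have X: "w1 \<frown> x \<in> X" "wg \<frown> x \<in> X" using w1 wg by (auto simp: W_def)
      have close: "\<bar>v1 h - v0 h\<bar> \<le> \<eta> * v0 h" for h
      proof -
        have nn: "0 \<le> v0 h" "0 \<le> v1 h" by (auto simp: v0_def v1_def)
        have "v0 h \<le> exp (D * \<theta> ^ k) * v1 h"
          unfolding v0_def v1_def by (rule vec_Hoelder[OF X k(2) agree])
        also have "\<dots> \<le> (1 + \<eta>) * v1 h" using k nn by (intro mult_right_mono) auto
        finally have 1: "v0 h \<le> (1 + \<eta>) * v1 h" .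
        have "v1 h \<le> exp (D * \<theta> ^ k) * v0 h"
          unfolding v0_def v1_def by (rule vec_Hoelder[OF X(2,1) k(2) agree[symmetric]])
        also have "\<dots> \<le> (1 + \<eta>) * v0 h" using k nn by (intro mult_right_mono) auto
        finally have 2: "v1 h \<le> v0 h + \<eta> * v0 h" by (simp add: algebra_simps)
        have "v0 h - v1 h \<le> \<eta> * v0 h"
        proof (cases "v1 h \<le> v0 h")
          case True
          then have "\<eta> * v1 h \<le> \<eta> * v0 h" using \<eta> by (intro mult_left_mono) auto
          then show ?thesis using 1 by (simp add: algebra_simps)
        next
          case False
          then show ?thesis using nn \<eta> mult_nonneg_nonneg[of \<eta> "v0 h"] by linarith
        qed
        then show ?thesis using 2 by (simp add: abs_le_iff)
      qed
      have d: "l2 G (\<lambda>h. v1 h - v0 h) \<le> \<eta> * l2 G v0"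
      proof -
        have "l2 G (\<lambda>h. v1 h - v0 h) \<le> l2 G (\<lambda>h. \<eta> * v0 h)"
          using close v0 by (intro l2_mono) (auto intro: order_trans[OF _ abs_ge_self])
        then show ?thesis using \<eta> by (simp add: l2_scale)
      qed
      have "\<bar>l2 G v0 - l2 G v'\<bar> \<le> \<eta> * l2 G v0"
        using abs_l2_diff[OF v1 v0(1)] d l2v' by simp
      \<comment> \<open>If \<open>v0\<close> were close to the translate of \<open>v1\<close>, it
        would be close to its own translate by \<open>g\<close>, as \<open>v0\<close> and
        \<open>v1\<close> nearly agree.\<close>
      moreover have "(\<epsilon> / 2) * l2 G v0 \<le> l2 G (\<lambda>h. v0 h - v' h)"
      proof -
        have "\<epsilon> * l2 G v0 \<le> l2 G (\<lambda>h. v0 (g \<otimes> h) - v' h) + l2 G (\<lambda>h. v' h - v0 h)"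
          using g(2) l2_triangle3[OF v0g v' v0(1)] by simp
        also have "l2 G (\<lambda>h. v0 (g \<otimes> h) - v' h) = l2 G (\<lambda>h. v1 h - v0 h)"
          using l2_translate[OF gG, of "\<lambda>h. v0 h - v1 h"] l2_minus_commute[of G v0 v1] by (simp add: v'_def)
        also have "l2 G (\<lambda>h. v' h - v0 h) = l2 G (\<lambda>h. v0 h - v' h)" by (rule l2_minus_commute)
        finally have "\<epsilon> * l2 G v0 \<le> \<eta> * l2 G v0 + l2 G (\<lambda>h. v0 h - v' h)" using d by simp
        moreover have "\<eta> * l2 G v0 \<le> \<epsilon> / 4 * l2 G v0" using \<eta> by (intro mult_right_mono) auto
        moreover have "0 \<le> \<epsilon> / 4 * l2 G v0" using E by simp
        ultimately show ?thesis by (simp add: field_simps)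
      qed
      ultimately have "l2 G (\<lambda>h. v0 h + v' h) \<le> l2 G v0 + l2 G v' - (\<epsilon> / 2)\<^sup>2 / 8 * l2 G v0"
        using \<eta> E by (intro l2_add_deficit[where \<eta> = \<eta>] v0 v') auto
      then have pair: "l2 G (\<lambda>h. weight w1 x * v0 h + weight wg x * v' h) \<le>
          weight w1 x * l2 G v0 + weight wg x * l2 G v' - c * ((\<epsilon> / 2)\<^sup>2 / 8 * l2 G v0)"
        using c0(1) c b g X by (intro l2_pair_deficit v0 v') (auto simp: w1_def wg_def)
      define R where "R = W T m x - {w1, wg}"
      have WR: "W T m x = insert w1 (insert wg R)" "w1 \<notin> insert wg R" "wg \<notin> R" "finite R"
        using w1 wg neq T by (auto simp: R_def)
      have RW: "w \<in> R \<Longrightarrow> w \<in> W T m x" for w by (auto simp: R_def)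
      let ?F = "\<lambda>w h. weight w x * vec T n (w \<frown> x) (gp w \<otimes> h)"
      have fsR: "fin_supp G (?F w)" if "w \<in> R" for w
        by (rule fin_supp_scale, rule fin_supp_vec_translate[OF T(1) RW[OF that]])
      have "nrm T (n + m) x = l2 G (\<lambda>h. (\<Sum>w\<in>R. ?F w h) + (weight w1 x * v0 h + weight wg x * v' h))"
        unfolding nrm_def
      proof (rule l2_cong)
        fix h assume h: "h \<in> carrier G"
        have "vec T (n + m) x h = (\<Sum>w\<in>W T m x. ?F w h)" by (rule vec_add[OF T(1) h])
        also have "\<dots> = ?F w1 h + (?F wg h + (\<Sum>w\<in>R. ?F w h))"
          unfolding WR(1) using WR by simp
        finally show "vec T (n + m) x h = (\<Sum>w\<in>R. ?F w h) + (weight w1 x * v0 h + weight wg x * v' h)"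
          using w1 wg h by (simp add: v0_def v'_def v1_def)
      qed
      also have "\<dots> \<le> l2 G (\<lambda>h. \<Sum>w\<in>R. ?F w h) + l2 G (\<lambda>h. weight w1 x * v0 h + weight wg x * v' h)"
        by (intro l2_triangle fin_supp_sum fin_supp_scale fin_supp_add fsR v0 v')
      also have "l2 G (\<lambda>h. \<Sum>w\<in>R. ?F w h) \<le> (\<Sum>w\<in>R. l2 G (?F w))"
        by (intro l2_sum fsR)
      also have "\<dots> = (\<Sum>w\<in>R. weight w x * nrm T n (w \<frown> x))"
      proof (intro sum.cong refl)
        fix w assume "w \<in> R"
        from l2_translate[OF gp_W[OF RW[OF this]], of "vec T n (w \<frown> x)"]
        show "l2 G (?F w) = weight w x * nrm T n (w \<frown> x)" by (simp add: l2_scale nrm_def)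
      qed
      also note pair
      finally have "nrm T (n + m) x \<le> (\<Sum>w\<in>R. weight w x * nrm T n (w \<frown> x)) +
          (weight w1 x * l2 G v0 + weight wg x * l2 G v' - c * ((\<epsilon> / 2)\<^sup>2 / 8 * l2 G v0))"
        by simp
      also have "\<dots> = (\<Sum>w\<in>W T m x. weight w x * nrm T n (w \<frown> x)) - c' * nrm T n (w1 \<frown> x)"
        unfolding WR(1) using WR v0(2) l2v' by (simp add: nrm_def v1_def c'_def)
      finally show ?thesis using w1 by blast
    qed
  qed (use L in auto)
qed

end

section \<open>Uniform decay relative to the total mass\<close>

context group_extension
begin

text \<open>By \<open>comparison\<close> the norm at any single point is at least a fixed fraction
  of the supremum, so each block of \<open>m\<close> letters loses a fixed multiple of
  \<open>snrm\<close>. Iterating over \<open>J\<close> blocks produces \<open>J\<close> losses, the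
  one at time \<open>i\<close> being propagated by the mass of the remaining blocks. Each propagated
  loss is at least a constant multiple of \<open>snrm T (n + J * m)\<close>, and together they
  cannot exceed \<open>tot T (J * m) y * snrm T n\<close>.\<close>

lemma uniform_decay:
  assumes "\<not> amenable G" "S \<noteq> {}"
  obtains N m K K' L where "m > N" "K > 0" "K' > 0" "finite L" "B \<subseteq> L" "L \<subseteq> S"
    "\<And>T k x y. finite T \<Longrightarrow> L \<subseteq> T \<Longrightarrow> T \<subseteq> S \<Longrightarrow> k = 0 \<or> k > N \<Longrightarrow> x \<in> X \<Longrightarrow> y \<in> X \<Longrightarrow> tot T k x \<le> K * tot T k y"
    "\<And>T n J y. finite T \<Longrightarrow> L \<subseteq> T \<Longrightarrow> T \<subseteq> S \<Longrightarrow> n > N \<Longrightarrow> y \<in> X \<Longrightarrow>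
       real J * snrm T (n + J * m) \<le> K' * tot T (J * m) y * snrm T n"
proof -
  have Xne: "X \<noteq> {}" using exists_point assms(2) by blast
  obtain N K0 L0 where N: "N > 0" and K0: "K0 \<ge> 0" and L0: "finite L0" "B \<subseteq> L0" "L0 \<subseteq> S"
    and cmp: "\<And>T n x y. finite T \<Longrightarrow> L0 \<subseteq> T \<Longrightarrow> T \<subseteq> S \<Longrightarrow> n \<ge> 1 \<Longrightarrow> x \<in> X \<Longrightarrow> y \<in> X \<Longrightarrow>
       tot T n x \<le> K0 * tot T (n + N) y \<and> nrm T n x \<le> K0 * nrm T (n + N) y"
    by (rule comparison) blast
  obtain m c L1 where m: "m > N" and c: "c > 0" and L1: "finite L1" "L1 \<subseteq> S"
    and contr: "\<And>T n x. finite T \<Longrightarrow> L1 \<subseteq> T \<Longrightarrow> T \<subseteq> S \<Longrightarrow> x \<in> X \<Longrightarrow> \<exists>w\<in>W T m x.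
       nrm T (n + m) x \<le> (\<Sum>w\<in>W T m x. weight w x * nrm T n (w \<frown> x)) - c * nrm T n (w \<frown> x)"
    by (rule contraction[OF assms]) blast
  \<comment> \<open>The 1 covers length 0; \<open>M ^ N * K0\<close> arises when the extra length
    \<open>N\<close> in \<open>comparison\<close> is compensated by splitting off \<open>N\<close>
    letters.\<close>
  define K1 where "K1 = max 1 (M ^ N * K0)"
  have K1: "K1 \<ge> 1" "M ^ N * K0 \<le> K1" by (auto simp: K1_def)
  define L where "L = L0 \<union> L1"
  have tot_cmp: "tot T k x \<le> K1 * tot T k y"
    if T: "finite T" "L \<subseteq> T" "T \<subseteq> S" and k: "k = 0 \<or> k > N" and xy: "x \<in> X" "y \<in> X" for T k x y
  proof (cases "k = 0")
    case True
    then show ?thesis using xy K1 by simp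
  next
    case False
    then obtain j where j: "k = j + N" "j \<ge> 1" using k by (metis add.commute less_imp_add_positive One_nat_def Suc_leI)
    have "tot T (j + N) x = (\<Sum>w\<in>W T N x. weight w x * tot T j (w \<frown> x))" by (rule tot_add[OF T(1)])
    also have "\<dots> \<le> (\<Sum>w\<in>W T N x. weight w x * (K0 * tot T k y))"
      using cmp[of T j _ y] T xy j WD by (intro sum_mono mult_left_mono) (auto simp: L_def)
    also have "\<dots> = tot T N x * (K0 * tot T k y)" by (simp add: tot_def sum_distrib_right)
    also have "\<dots> \<le> M ^ N * (K0 * tot T k y)"
      using tot_le_power[OF T(1,3) xy(1)] K0 by (intro mult_right_mono) auto
    also have "\<dots> = (M ^ N * K0) * tot T k y" by simp
    also have "\<dots> \<le> K1 * tot T k y" using K1 by (intro mult_right_mono) auto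
    finally show ?thesis using j by simp
  qed
  have snrm_cmp: "snrm T n \<le> K1 * nrm T n y"
    if T: "finite T" "L \<subseteq> T" "T \<subseteq> S" and n: "n > N" and y: "y \<in> X" for T n y
  proof -
    obtain j where j: "n = j + N" "j \<ge> 1" using n by (metis add.commute less_imp_add_positive One_nat_def Suc_leI)
    show ?thesis
    proof (rule snrm_leI[OF Xne])
      fix x assume x: "x \<in> X"
      have "nrm T (j + N) x \<le> tot T N x * (K0 * nrm T n y)"
        using cmp[of T j _ y] T y j by (intro nrm_add_le) (auto simp: L_def)
      also have "\<dots> \<le> M ^ N * (K0 * nrm T n y)"
        using tot_le_power[OF T(1,3) x] K0 by (intro mult_right_mono) auto
      also have "\<dots> = (M ^ N * K0) * nrm T n y" by simp
      also have "\<dots> \<le> K1 * nrm T n y" using K1 by (intro mult_right_mono) auto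
      finally show "nrm T n x \<le> K1 * nrm T n y" using j by simp
    qed
  qed
  define e where "e = c / K1"
  have e: "e > 0" using c K1 by (simp add: e_def)
  have step: "nrm T (n + m) x \<le> (\<Sum>w\<in>W T m x. weight w x * nrm T n (w \<frown> x)) - e * snrm T n"
    if T: "finite T" "L \<subseteq> T" "T \<subseteq> S" and n: "n > N" and x: "x \<in> X" for T n x
  proof -
    obtain w where w: "w \<in> W T m x"
      "nrm T (n + m) x \<le> (\<Sum>w\<in>W T m x. weight w x * nrm T n (w \<frown> x)) - c * nrm T n (w \<frown> x)"
      using contr[of T x n] T x by (auto simp: L_def)
    have "snrm T n \<le> K1 * nrm T n (w \<frown> x)" using T n WD[OF w(1)] by (intro snrm_cmp) auto
    then have "e * snrm T n \<le> e * (K1 * nrm T n (w \<frown> x))" using e by (intro mult_left_mono) auto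
    also have "\<dots> = c * nrm T n (w \<frown> x)" using K1 by (simp add: e_def)
    finally show ?thesis using w(2) by linarith
  qed
  \<comment> \<open>Loss \<open>i\<close> occurs at length \<open>n + i * m\<close> and is then
    multiplied by the mass of the \<open>j - 1 - i\<close> blocks that remain.\<close>
  have iter: "nrm T (n + j * m) x + e * (\<Sum>i<j. tot T ((j - 1 - i) * m) x * snrm T (n + i * m)) \<le>
      tot T (j * m) x * snrm T n"
    if T: "finite T" "L \<subseteq> T" "T \<subseteq> S" and n: "n > N" and x: "x \<in> X" for T n x j
    using x
  proof (induction j arbitrary: x)
    case 0
    then show ?case using nrm_le_snrm[OF T(1,3)] by simp
  next
    case (Suc j)
    have "nrm T (n + Suc j * m) x = nrm T (n + j * m + m) x" by (simp add: algebra_simps)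
    also have "\<dots> \<le> (\<Sum>w\<in>W T m x. weight w x * nrm T (n + j * m) (w \<frown> x)) - e * snrm T (n + j * m)"
      using T n Suc.prems by (intro step) auto
    also have "(\<Sum>w\<in>W T m x. weight w x * nrm T (n + j * m) (w \<frown> x)) \<le>
        (\<Sum>w\<in>W T m x. weight w x * (tot T (j * m) (w \<frown> x) * snrm T n -
           e * (\<Sum>i<j. tot T ((j - 1 - i) * m) (w \<frown> x) * snrm T (n + i * m))))"
    proof (intro sum_mono mult_left_mono)
      fix w assume "w \<in> W T m x"
      then show "nrm T (n + j * m) (w \<frown> x) \<le> tot T (j * m) (w \<frown> x) * snrm T n -
           e * (\<Sum>i<j. tot T ((j - 1 - i) * m) (w \<frown> x) * snrm T (n + i * m))"
        using Suc.IH[of "w \<frown> x"] WD by fastforce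
    qed auto
    also have "\<dots> = (\<Sum>w\<in>W T m x. weight w x * tot T (j * m) (w \<frown> x)) * snrm T n -
        e * (\<Sum>i<j. (\<Sum>w\<in>W T m x. weight w x * tot T ((j - 1 - i) * m) (w \<frown> x)) * snrm T (n + i * m))"
      unfolding sum_distrib_left sum_distrib_right right_diff_distrib sum_subtractf
      by (subst (2) sum.swap) (simp add: mult_ac)
    also have "\<dots> = tot T (Suc j * m) x * snrm T n - e * (\<Sum>i<j. tot T ((Suc j - 1 - i) * m) x * snrm T (n + i * m))"
    proof -
      have "tot T ((Suc j - 1 - i) * m) x = (\<Sum>w\<in>W T m x. weight w x * tot T ((j - 1 - i) * m) (w \<frown> x))"
        if "i < j" for i
      proof -
        have "(Suc j - 1 - i) * m = (j - 1 - i) * m + m"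
          using that by (metis Suc_diff_Suc diff_Suc_1 diff_diff_left mult_Suc add.commute plus_1_eq_Suc)
        then show ?thesis using tot_add[OF T(1)] by simp
      qed
      moreover have "tot T (Suc j * m) x = (\<Sum>w\<in>W T m x. weight w x * tot T (j * m) (w \<frown> x))"
        using tot_add[OF T(1), of "j * m" m x] by (simp add: add.commute)
      ultimately show ?thesis by simp
    qed
    finally show ?case using Suc.prems by (simp add: algebra_simps)
  qed
  define K3 where "K3 = K1 * (M ^ m * K1) / e"
  have K3: "K3 > 0" using K1 M_pos e by (simp add: K3_def)
  have main: "real J * snrm T (n + J * m) \<le> K3 * tot T (J * m) y * snrm T n"
    if T: "finite T" "L \<subseteq> T" "T \<subseteq> S" and n: "n > N" and y: "y \<in> X" for T n J y
  proof -
    \<comment> \<open>\<open>m > N\<close> ensures that every positive number of blocks is long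
      enough for \<open>tot_cmp\<close>.\<close>
    have zero_or: "j * m = 0 \<or> j * m > N" for j
      using m by (cases j) auto
    have "snrm T (n + J * m) \<le> (K1 * (M ^ m * K1)) * (tot T ((J - 1 - i) * m) y * snrm T (n + i * m))"
      if i: "i < J" for i
    proof (rule snrm_leI[OF Xne])
      fix z assume z: "z \<in> X"
      have sn: "0 \<le> snrm T (n + i * m)"
        using nrm_le_snrm[OF T(1,3) y] nrm_nonneg order_trans by blast
      have J: "n + J * m = (n + i * m) + (J - i) * m" "(J - i) * m = (J - 1 - i) * m + m"
      proof -
        obtain j where j: "J = Suc (i + j)" using less_imp_Suc_add[OF i] by blast
        then have "J - i = Suc j" "J - 1 - i = j" by simp_all
        then show "n + J * m = (n + i * m) + (J - i) * m" "(J - i) * m = (J - 1 - i) * m + m"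
          by (simp_all add: j algebra_simps)
      qed
      have "tot T ((J - i) * m) y = (\<Sum>w\<in>W T m y. weight w y * tot T ((J - 1 - i) * m) (w \<frown> y))"
        unfolding J(2) by (rule tot_add[OF T(1)])
      also have "\<dots> \<le> (\<Sum>w\<in>W T m y. weight w y * (K1 * tot T ((J - 1 - i) * m) y))"
        using WD T y zero_or[of "J - 1 - i"] by (intro sum_mono mult_left_mono tot_cmp) auto
      also have "\<dots> = tot T m y * (K1 * tot T ((J - 1 - i) * m) y)" by (simp add: tot_def sum_distrib_right)
      also have "\<dots> \<le> M ^ m * (K1 * tot T ((J - 1 - i) * m) y)"
        using tot_le_power[OF T(1,3) y] K1 by (intro mult_right_mono) auto
      finally have "K1 * tot T ((J - i) * m) y \<le> K1 * (M ^ m * (K1 * tot T ((J - 1 - i) * m) y))"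
        using K1 by (intro mult_left_mono) auto
      have "nrm T (n + J * m) z \<le> tot T ((J - i) * m) z * snrm T (n + i * m)"
        unfolding J(1) using nrm_le_snrm[OF T(1,3)] by (intro nrm_add_le[OF T(1)]) auto
      also have "\<dots> \<le> (K1 * tot T ((J - i) * m) y) * snrm T (n + i * m)"
        using T y z zero_or[of "J - i"] sn by (intro mult_right_mono tot_cmp) auto
      also have "(K1 * tot T ((J - i) * m) y) * snrm T (n + i * m) \<le>
          K1 * (M ^ m * (K1 * tot T ((J - 1 - i) * m) y)) * snrm T (n + i * m)"
        by (rule mult_right_mono) fact+
      also have "\<dots> = (K1 * (M ^ m * K1)) * (tot T ((J - 1 - i) * m) y * snrm T (n + i * m))"
        by (simp add: mult_ac)
      finally show "nrm T (n + J * m) z \<le> \<dots>" .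
    qed
    then have "(\<Sum>i<J. snrm T (n + J * m)) \<le>
        (\<Sum>i<J. (K1 * (M ^ m * K1)) * (tot T ((J - 1 - i) * m) y * snrm T (n + i * m)))"
      by (intro sum_mono) auto
    also have "\<dots> = K3 * (e * (\<Sum>i<J. tot T ((J - 1 - i) * m) y * snrm T (n + i * m)))"
      unfolding K3_def sum_distrib_left using e by (intro sum.cong refl) (simp add: field_simps)
    also have "\<dots> \<le> K3 * (tot T (J * m) y * snrm T n)"
    proof (intro mult_left_mono)
      show "e * (\<Sum>i<J. tot T ((J - 1 - i) * m) y * snrm T (n + i * m)) \<le> tot T (J * m) y * snrm T n"
        using iter[OF T n y, of J] nrm_nonneg[of T "n + J * m" y] by linarith
    qed (use K3 in auto)
    finally show ?thesis by simp
  qed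
  have L: "finite L" "B \<subseteq> L" "L \<subseteq> S" using L0 L1 by (auto simp: L_def)
  have "K1 > 0" using K1 by simp
  from m this K3 L tot_cmp main show thesis by (rule that)
qed

end

section \<open>The pressure gap for non-amenable groups\<close>

lemma exp_ln_div_power:
  assumes "0 < \<rho>" "0 < q"
  shows "\<rho> ^ k = exp (ln \<rho> / real q * real (k * q))"
proof -
  have "ln \<rho> / real q * real (k * q) = real k * ln \<rho>" using assms by simp
  then show ?thesis using assms by (simp only: exp_of_nat_mult exp_ln)
qed

text \<open>A geometric bound along each residue class modulo \<open>q\<close> suffices: the offset
  \<open>l + r\<close> is bounded and goes into the constant.\<close>

lemma exp_growth_le_geometric:
  assumes "0 < \<rho>" "0 < q" "0 < c"
    and le: "\<And>r k. r < q \<Longrightarrow> Z (l + r + k * q) \<le> ennreal (c * \<rho> ^ k)"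
  shows "exp_growth Z \<le> ereal (ln \<rho> / real q)"
proof (rule exp_growth_le)
  define s where "s = ln \<rho> / real q"
  let ?c = "c * exp (\<bar>s\<bar> * real (l + q))"
  show "0 < ?c" using assms by simp
  show "\<forall>\<^sub>F n in sequentially. Z n \<le> ennreal (?c * exp (ln \<rho> / real q * real n))"
    using eventually_ge_at_top[of l]
  proof eventually_elim
    case (elim n)
    define r k where "r = (n - l) mod q" and "k = (n - l) div q"
    have n: "n = l + r + k * q" using elim by (simp add: r_def k_def)
    have r: "r < q" using assms by (simp add: r_def)
    have "s * real (k * q) = s * real n - s * real (l + r)" by (simp add: n algebra_simps)
    moreover have "- s * real (l + r) \<le> \<bar>s\<bar> * real (l + q)"
      using r by (intro mult_mono) auto
    ultimately have "s * real (k * q) \<le> s * real n + \<bar>s\<bar> * real (l + q)" by simp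
    then have "\<rho> ^ k \<le> exp (s * real n + \<bar>s\<bar> * real (l + q))"
      unfolding exp_ln_div_power[OF assms(1,2)] s_def[symmetric] by simp
    then have "c * \<rho> ^ k \<le> ?c * exp (s * real n)" using assms by (simp add: exp_add mult_ac)
    then have "ennreal (c * \<rho> ^ k) \<le> ennreal (?c * exp (s * real n))" by (rule ennreal_leI)
    with le[OF r, of k] show ?case unfolding n[symmetric] s_def by (rule order_trans)
  qed
qed

lemma exp_growth_ge_geometric:
  assumes "0 < \<rho>" "0 < q" "0 < c"
    and ge: "\<And>k. k \<ge> 1 \<Longrightarrow> Z (l + k * q) \<ge> ennreal (c * \<rho> ^ k)"
  shows "ereal (ln \<rho> / real q) \<le> exp_growth Z"
proof (rule exp_growth_ge)
  define s where "s = ln \<rho> / real q"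
  fix s' assume s': "s' < ln \<rho> / real q"
  show "\<exists>\<^sub>F n in sequentially. Z n \<ge> ennreal (exp (s' * real n))"
    unfolding frequently_sequentially
  proof
    fix N
    have pos: "0 < (s - s') * real q" using s' assms by (simp add: s_def)
    obtain k0 :: nat where k0: "s' * real l - ln c < real k0 * ((s - s') * real q)"
      using ex_less_of_nat_mult[OF pos] by blast
    define k where "k = max k0 (max N 1)"
    have "real k0 * ((s - s') * real q) \<le> real k * ((s - s') * real q)"
      using pos by (intro mult_right_mono) (auto simp: k_def)
    with k0 have k: "ln c + (s - s') * real q * real k - s' * real l \<ge> 0" "k \<ge> N" "k \<ge> 1"
      by (auto simp: k_def algebra_simps)
    have "s' * real (l + k * q) \<le> ln c + s * real (k * q)" using k(1) by (simp add: algebra_simps)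
    then have "exp (s' * real (l + k * q)) \<le> exp (ln c + s * real (k * q))" by simp
    also have "\<dots> = c * \<rho> ^ k"
      unfolding exp_ln_div_power[OF assms(1,2)] s_def[symmetric] using assms by (simp add: exp_add)
    finally have "ennreal (exp (s' * real (l + k * q))) \<le> Z (l + k * q)"
      using ge[OF k(3)] ennreal_leI order_trans by blast
    moreover have "N \<le> l + k * q" using k assms by (simp add: trans_le_add2 order_trans[of N k])
    ultimately show "\<exists>n\<ge>N. Z n \<ge> ennreal (exp (s' * real n))" by blast
  qed
qed

context group_extension
begin

text \<open>A loop at \<open>a\<close> can be followed by \<open>y\<close>, so its weight may be
  moved from its periodic point to \<open>y\<close> at cost \<open>exp D\<close>. Trivial cocycle
  places it at the coordinate \<open>\<one>\<close> of \<open>vec\<close>, and a coordinate is at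
  most the norm. Finitely many loops use finitely many letters, which are added to
  \<open>T0\<close>.\<close>

lemma skew_partition_le:
  assumes "n > 0" "y \<in> X" "y 0 = a"
    and le: "\<And>T. finite T \<Longrightarrow> T0 \<subseteq> T \<Longrightarrow> T \<subseteq> S \<Longrightarrow> nrm T n y \<le> c"
    and T0: "finite T0" "T0 \<subseteq> S"
  shows "(skew_partition_sum G S A \<psi> a \<phi> n) \<le> ennreal (exp D * c)"
  unfolding periodic_sum_eq[OF assms(1)] infsum_ennreal_le_iff
proof (intro allI impI)
  fix Y assume Y: "finite Y" "Y \<subseteq> {w \<in> loops S A a. length w = n \<and> cocycle G \<psi> n (w\<^sup>\<omega>) = \<one>}"
  define T where "T = T0 \<union> (\<Union>w\<in>Y. set w)"
  have wS: "set w \<subseteq> S" "w \<noteq> []" "length w = n" "w \<frown> y \<in> X" "w \<frown> w\<^sup>\<omega> \<in> X" "gp w = \<one>" if "w \<in> Y" for w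
  proof -
    have w: "w \<noteq> []" "length w = n" "w\<^sup>\<omega> \<in> X" "hd w = a" "cocycle G \<psi> n (w\<^sup>\<omega>) = \<one>"
      using that Y by (auto simp: loops_def)
    then show 1: "w \<noteq> []" "length w = n" "w \<frown> w\<^sup>\<omega> \<in> X" using assms(1) by (simp_all flip: iter_unroll)
    from 1(3) show "set w \<subseteq> S" unfolding conc_in_markov_shift by blast
    from w show "w \<frown> y \<in> X"
      unfolding iter_in_markov_shift[OF w(1)] conc_in_markov_shift using assms by simp
    have "prefix n (w\<^sup>\<omega>) = w" using w by (auto simp: iter_def intro!: nth_equalityI)
    then show "gp w = \<one>" using w cocycle_eq_word_prod[OF \<psi> w(3), of n] by simp
  qed
  have T: "finite T" "T0 \<subseteq> T" "T \<subseteq> S" using Y T0 wS by (auto simp: T_def)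
  have "(\<Sum>w\<in>Y. exp (birkhoff_sum \<phi> n (w\<^sup>\<omega>))) = (\<Sum>w\<in>Y. weight w (w\<^sup>\<omega>))"
    using wS by (intro sum.cong) (auto simp: weight_iter)
  also have "\<dots> \<le> (\<Sum>w\<in>Y. exp D * weight w y)"
    using wS by (intro sum_mono weight_le_D) auto
  also have "\<dots> = exp D * (\<Sum>w\<in>Y. if gp w \<otimes> \<one> = \<one> then weight w y else 0)"
    using wS by (simp add: sum_distrib_left)
  also have "\<dots> \<le> exp D * vec T n y \<one>"
    unfolding vec_def using wS by (intro mult_left_mono sum_mono2 finite_W T(1)) (auto simp: W_def T_def)
  also have "vec T n y \<one> \<le> nrm T n y"
    using abs_le_l2[OF fin_supp_vec[OF T(1)] one_closed, of n y] by (simp add: nrm_def)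
  also have "nrm T n y \<le> c" by (rule le[OF T])
  finally show "(\<Sum>w\<in>Y. ennreal (exp (birkhoff_sum \<phi> n (w\<^sup>\<omega>)))) \<le> ennreal (exp D * c)"
    by (simp add: ennreal_leI mult_left_mono)
qed

text \<open>A word that may precede \<open>y\<close> ends in a letter that \<open>a\<close> can
  follow; a connector from \<open>a\<close> to a state of \<open>B\<close>, put in front of it,
  closes it to a loop that is longer by \<open>N\<close>.\<close>

lemma partition_ge:
  assumes "a \<in> S"
  obtains N c where "c > 0" "\<And>T n y. finite T \<Longrightarrow> T \<subseteq> S \<Longrightarrow> n > 0 \<Longrightarrow> y \<in> X \<Longrightarrow> y 0 = a \<Longrightarrow>
    ennreal (c * tot T n y) \<le>
    (partition_sum S A a \<phi> (N + n))"
proof -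
  have S0: "finite (insert a B)" "insert a B \<subseteq> S" using assms finite_B B_subset by auto
  obtain N \<kappa> c where N: "N > 0" and c: "c > 0"
    and \<kappa>: "\<And>s t. s \<in> insert a B \<Longrightarrow> t \<in> insert a B \<Longrightarrow> connects S A N s t (\<kappa> s t)"
    and \<kappa>w: "\<And>s t x. s \<in> insert a B \<Longrightarrow> t \<in> insert a B \<Longrightarrow> \<kappa> s t \<frown> x \<in> X \<Longrightarrow> c \<le> weight (\<kappa> s t) x"
    by (rule connectors[OF S0]) blast
  show thesis
  proof (rule that[of "exp (-D) * c" N])
    show "exp (-D) * c > 0" using c by simp
    fix T :: "'s set" and n :: nat and y :: "nat \<Rightarrow> 's"
    assume T: "finite T" "T \<subseteq> S" and n: "n > 0" and y: "y \<in> X" "y 0 = a"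
    have "\<forall>w\<in>W T n y. \<exists>b. b \<in> B \<and> A b (hd w)"
    proof
      fix w assume w: "w \<in> W T n y"
      then have "w \<noteq> []" "set w \<subseteq> S" using WD[OF w] n by auto
      then have "hd w \<in> S" by auto
      then show "\<exists>b. b \<in> B \<and> A b (hd w)" using bip by blast
    qed
    from bchoice[OF this] obtain \<beta> where \<beta>: "\<And>w. w \<in> W T n y \<Longrightarrow> \<beta> w \<in> B \<and> A (\<beta> w) (hd w)" by blast
    let ?e = "\<lambda>w. exp (birkhoff_sum \<phi> (N + n) (w\<^sup>\<omega>))"
    define F where "F w = \<kappa> a (\<beta> w) @ w" for w
    have F: "F w \<in> loops S A a" "length (F w) = N + n" "exp (-D) * c * weight w y \<le> ?e (F w)"
      if w: "w \<in> W T n y" for w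
    proof -
      have k: "length (\<kappa> a (\<beta> w)) = N" "set (\<kappa> a (\<beta> w)) \<subseteq> S" "successively A (\<kappa> a (\<beta> w))"
          "hd (\<kappa> a (\<beta> w)) = a" "last (\<kappa> a (\<beta> w)) = \<beta> w" "\<kappa> a (\<beta> w) \<noteq> []"
        using \<kappa>[of a "\<beta> w"] \<beta>[OF w] N by auto
      have w': "w \<noteq> []" "length w = n" "w \<frown> y \<in> X" using WD[OF w] n by auto
      then have w'': "set w \<subseteq> S" "successively A w" "A (last w) a"
        using y by (auto simp: conc_in_markov_shift)
      have Fy: "F w \<frown> y \<in> X"
        using k w' w'' y \<beta>[OF w] by (auto simp: F_def conc_in_markov_shift successively_append_iff)
      then show 1: "F w \<in> loops S A a"
        using k w' w'' unfolding loops_def F_def conc_in_markov_shift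
        by (simp add: iter_in_markov_shift)
      show 2: "length (F w) = N + n" using k w' by (simp add: F_def)
      have ky: "\<kappa> a (\<beta> w) \<frown> (w \<frown> y) \<in> X" using Fy by (simp add: F_def)
      have "c * weight w y \<le> weight (F w) y"
        unfolding F_def weight_append using \<kappa>w[OF _ _ ky] \<beta>[OF w] by (intro mult_right_mono) auto
      also have "\<dots> \<le> exp D * weight (F w) ((F w)\<^sup>\<omega>)"
        using 1 Fy by (intro weight_le_D) (auto simp: loops_def simp flip: iter_unroll)
      also have "weight (F w) ((F w)\<^sup>\<omega>) = ?e (F w)"
        using 2 N by (subst weight_iter) auto
      finally show "exp (-D) * c * weight w y \<le> ?e (F w)"
        by (simp add: exp_minus field_simps)
    qed
    have inj: "inj_on F (W T n y)"
    proof (rule inj_on_inverseI)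
      fix w assume "w \<in> W T n y"
      then show "drop N (F w) = w"
        using \<kappa>[of a "\<beta> w"] \<beta>[of w] by (simp add: F_def)
    qed
    have "exp (-D) * c * tot T n y = (\<Sum>w\<in>W T n y. exp (-D) * c * weight w y)"
      by (simp add: tot_def sum_distrib_left)
    also have "\<dots> \<le> (\<Sum>w\<in>W T n y. ?e (F w))"
      by (intro sum_mono F)
    finally have "ennreal (exp (-D) * c * tot T n y) \<le> (\<Sum>w\<in>W T n y. ennreal (?e (F w)))"
      by (simp add: ennreal_leI)
    also have "\<dots> = (\<Sum>w\<in>F ` W T n y. ennreal (?e w))"
      by (simp add: sum.reindex[OF inj])
    also have "\<dots> \<le> (\<Sum>\<^sub>\<infinity>w\<in>{w \<in> loops S A a. length w = N + n}. ennreal (?e w))"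
      by (rule infsum_ennreal_le_iff[THEN iffD1, OF order_refl, rule_format]) (use F T(1) in auto)
    also have "\<dots> = (partition_sum S A a \<phi> (N + n))"
      using periodic_sum_eq[where P = "\<lambda>_. True" and n = "N + n" and S = S and A = A and a = a] n by simp
    finally show "ennreal (exp (- D) * c * tot T n y) \<le> \<dots>" .
  qed
qed

text \<open>Over \<open>q\<close> letters the norm is multiplied by at most \<rho>, while the mass
  over a suitable alphabet is multiplied by at least \<open>2 * \<rho>\<close>. The two pressures
  therefore differ by at least \<open>ln 2 / q\<close>.\<close>

theorem skew_pressure_less:
  assumes "\<not> amenable G" "a \<in> S"
  shows "skew_pressure G S A \<psi> a \<phi> < pressure S A a \<phi>"
proof -
  have "S \<noteq> {}" using assms by auto
  obtain N m K K' L where m: "m > N" and K: "K > 0" and K': "K' > 0" and L: "finite L" "B \<subseteq> L" "L \<subseteq> S"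
    and cmp: "\<And>T k x y. finite T \<Longrightarrow> L \<subseteq> T \<Longrightarrow> T \<subseteq> S \<Longrightarrow> k = 0 \<or> k > N \<Longrightarrow> x \<in> X \<Longrightarrow> y \<in> X \<Longrightarrow> tot T k x \<le> K * tot T k y"
    and decay: "\<And>T n J y. finite T \<Longrightarrow> L \<subseteq> T \<Longrightarrow> T \<subseteq> S \<Longrightarrow> n > N \<Longrightarrow> y \<in> X \<Longrightarrow>
       real J * snrm T (n + J * m) \<le> K' * tot T (J * m) y * snrm T n"
    by (rule uniform_decay[OF assms(1) \<open>S \<noteq> {}\<close>]) (rule that)
  obtain y where y: "y \<in> X" "y 0 = a" using exists_point[OF assms(2)] by blast
  \<comment> \<open>Of the factor 4, one 2 is lost in choosing the alphabet \<open>T1\<close> and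
    the other is the gap; \<open>K\<close> pays for changing the base point.\<close>
  define J where "J = Suc (nat \<lceil>4 * K * K'\<rceil>)"
  have J: "4 * K * K' \<le> real J" unfolding J_def by linarith
  define q where "q = J * m"
  have q: "q > N" using m by (simp add: q_def J_def)
  define \<T> where "\<T> = {T. finite T \<and> L \<subseteq> T \<and> T \<subseteq> S}"
  \<comment> \<open>The supremum over alphabets makes the decay rate the same for all of them; it is
    finite by \<open>tot_le_power\<close>.\<close>
  define P where "P = (SUP T\<in>\<T>. tot T q y)"
  have bdd: "bdd_above ((\<lambda>T. tot T q y) ` \<T>)"
    by (rule bdd_aboveI2[of _ _ "M ^ q"]) (auto simp: \<T>_def intro: tot_le_power y)
  have LT: "L \<in> \<T>" using L by (simp add: \<T>_def)
  have tot_le_P: "tot T q y \<le> P" if "T \<in> \<T>" for T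
    unfolding P_def by (rule cSUP_upper[OF that bdd])
  have P: "P > 0" using tot_pos[of L y q] L y tot_le_P[OF LT] by linarith
  obtain T1 where T1: "T1 \<in> \<T>" "P / 2 < tot T1 q y"
    using less_cSUP_iff[of \<T> "\<lambda>T. tot T q y" "P / 2"] bdd LT P by (auto simp flip: P_def)
  define \<rho> where "\<rho> = P / (4 * K)"
  have \<rho>: "\<rho> > 0" using P K by (simp add: \<rho>_def)
  have sn: "0 \<le> snrm T n" if "T \<in> \<T>" for T n
    using that y by (intro order_trans[OF nrm_nonneg nrm_le_snrm[of T y n]]) (auto simp: \<T>_def)
  have step: "snrm T (n + q) \<le> \<rho> * snrm T n" if "T \<in> \<T>" "n > N" for T n
  proof -
    have "4 * K * K' * snrm T (n + q) \<le> real J * snrm T (n + q)"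
      using J sn[OF that(1)] by (intro mult_right_mono) auto
    also have "\<dots> \<le> K' * tot T q y * snrm T n"
      using decay[of T n y J] that y by (simp add: \<T>_def q_def)
    also have "\<dots> \<le> K' * P * snrm T n"
      using tot_le_P[OF that(1)] K' sn[OF that(1)] by (intro mult_right_mono mult_left_mono) auto
    finally show ?thesis using K K' by (simp add: \<rho>_def field_simps)
  qed
  have steps: "snrm T (n + k * q) \<le> \<rho> ^ k * snrm T n" if "T \<in> \<T>" "n > N" for T n k
  proof (induction k)
    case (Suc k)
    have "snrm T (n + Suc k * q) = snrm T ((n + k * q) + q)" by (simp add: algebra_simps)
    also have "\<dots> \<le> \<rho> * snrm T (n + k * q)" using that by (intro step) auto
    also have "\<dots> \<le> \<rho> * (\<rho> ^ k * snrm T n)" using \<rho> Suc by (intro mult_left_mono) auto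
    finally show ?case by simp
  qed simp
  have grow: "(2 * \<rho>) ^ k \<le> tot T1 (k * q) x" if "x \<in> X" for x k
    using that
  proof (induction k arbitrary: x)
    case (Suc k)
    have T1': "finite T1" "L \<subseteq> T1" "T1 \<subseteq> S" using T1 by (auto simp: \<T>_def)
    have "tot T1 q y \<le> K * tot T1 q x" by (intro cmp T1' disjI2 q y Suc.prems)
    then have "2 * \<rho> \<le> tot T1 q x" using T1 K by (simp add: \<rho>_def field_simps)
    then have "(2 * \<rho>) ^ Suc k \<le> tot T1 q x * (2 * \<rho>) ^ k"
      using \<rho> by (simp add: mult_right_mono)
    also have "\<dots> = (\<Sum>w\<in>W T1 q x. weight w x * (2 * \<rho>) ^ k)" by (simp add: tot_def sum_distrib_right)
    also have "\<dots> \<le> (\<Sum>w\<in>W T1 q x. weight w x * tot T1 (k * q) (w \<frown> x))"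
      using WD by (intro sum_mono mult_left_mono Suc.IH) auto
    also have "\<dots> = tot T1 (Suc k * q) x"
      using tot_add[OF T1'(1), of "k * q" q x] by (simp add: add.commute)
    finally show ?case .
  qed simp
  have "skew_pressure G S A \<psi> a \<phi> \<le> ereal (ln \<rho> / real q)"
    unfolding skew_pressure_def
  proof (rule exp_growth_le_geometric[where l = "Suc N"])
    let ?M = "max 1 M ^ (Suc N + q)"
    show "0 < exp D * ?M" by (simp add: less_le_trans[of 0 1])
    fix r k assume r: "r < q"
    have "nrm T (Suc N + r + k * q) y \<le> \<rho> ^ k * ?M" if T: "finite T" "L \<subseteq> T" "T \<subseteq> S" for T
    proof -
      have "nrm T (Suc N + r + k * q) y \<le> snrm T (Suc N + r + k * q)" by (intro nrm_le_snrm T y)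
      also have "\<dots> \<le> \<rho> ^ k * snrm T (Suc N + r)" using T by (intro steps) (auto simp: \<T>_def)
      also have "snrm T (Suc N + r) \<le> ?M"
      proof (rule snrm_leI)
        show "X \<noteq> {}" using y by auto
        fix x assume "x \<in> X"
        then have "nrm T (Suc N + r) x \<le> M ^ (Suc N + r)" using T by (intro nrm_le_power)
        also have "\<dots> \<le> max 1 M ^ (Suc N + r)" using M_pos by (intro power_mono) auto
        also have "\<dots> \<le> ?M" using r by (intro power_increasing) auto
        finally show "nrm T (Suc N + r) x \<le> ?M" .
      qed
      finally show ?thesis using \<rho> by (simp add: mult_left_mono)
    qed
    from skew_partition_le[OF _ y this L(1,3)]
    show "(skew_partition_sum G S A \<psi> a \<phi> (Suc N + r + k * q)) \<le> ennreal (exp D * ?M * \<rho> ^ k)"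
      by (simp add: mult_ac)
  qed (use \<rho> q in auto)
  also have "ereal (ln \<rho> / real q) < ereal (ln (2 * \<rho>) / real q)"
    using \<rho> q by (simp add: divide_strict_right_mono)
  also have "\<dots> \<le> pressure S A a \<phi>"
    unfolding pressure_def
  proof -
    obtain N' c where c: "c > 0" and ge: "\<And>T n y. finite T \<Longrightarrow> T \<subseteq> S \<Longrightarrow> n > 0 \<Longrightarrow> y \<in> X \<Longrightarrow> y 0 = a \<Longrightarrow>
      ennreal (c * tot T n y) \<le>
      (partition_sum S A a \<phi> (N' + n))"
      by (rule partition_ge[OF assms(2)]) blast
    show "ereal (ln (2 * \<rho>) / real q) \<le> exp_growth (partition_sum S A a \<phi>)"
    proof (rule exp_growth_ge_geometric[OF _ _ c])
      fix k :: nat assume "1 \<le> k"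
      then have "ennreal (c * tot T1 (k * q) y) \<le>
        (partition_sum S A a \<phi> (N' + k * q))"
        using T1 y q by (intro ge) (auto simp: \<T>_def)
      moreover have "ennreal (c * (2 * \<rho>) ^ k) \<le> ennreal (c * tot T1 (k * q) y)"
        using c grow[OF y(1), of k] by (intro ennreal_leI mult_left_mono) auto
      ultimately show "ennreal (c * (2 * \<rho>) ^ k) \<le>
        (partition_sum S A a \<phi> (N' + k * q))"
        by (rule order_trans[rotated])
    qed (use \<rho> q in auto)
  qed
  finally show ?thesis .
qed

end

section \<open>Centred walks return with subexponential probability\<close>

text \<open>The trajectories of a walk with \<open>k\<close> steps from \<open>F\<close>.\<close>

definition lists_of :: "'w set \<Rightarrow> nat \<Rightarrow> 'w list set" where
  "lists_of F k = {ws. set ws \<subseteq> F \<and> length ws = k}"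

lemma finite_lists_of: "finite F \<Longrightarrow> finite (lists_of F k)"
  using finite_lists_length_eq[of F k] by (simp add: lists_of_def conj_commute)

lemma lists_of_0 [simp]: "lists_of F 0 = {[]}"
  by (auto simp: lists_of_def)

lemma sum_lists_of_Suc:
  "(\<Sum>ws\<in>lists_of F (Suc k). h ws) = (\<Sum>w\<in>F. \<Sum>ws\<in>lists_of F k. h (w # ws))"
proof -
  have "bij_betw (\<lambda>(w, ws). w # ws) (F \<times> lists_of F k) (lists_of F (Suc k))"
    by (rule bij_betwI[where g = "\<lambda>ws. (hd ws, tl ws)"]) (auto simp: lists_of_def length_Suc_conv)
  from sum.reindex_bij_betw[OF this, of h] show ?thesis
    by (simp add: sum.cartesian_product case_prod_beta)
qed

text \<open>The steps are independent under the product weights, so variances add: the cross terms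
  vanish because the steps are centred. Mass and mean are proved along with the second moment since
  its induction uses both.\<close>

lemma walk_second_moment:
  fixes p g :: "'w \<Rightarrow> real"
  assumes "(\<Sum>w\<in>F. p w) = 1" "(\<Sum>w\<in>F. p w * g w) = 0"
  shows "(\<Sum>ws\<in>lists_of F k. prod_list (map p ws)) = 1 \<and>
    (\<Sum>ws\<in>lists_of F k. prod_list (map p ws) * sum_list (map g ws)) = 0 \<and>
    (\<Sum>ws\<in>lists_of F k. prod_list (map p ws) * (sum_list (map g ws))\<^sup>2) = real k * (\<Sum>w\<in>F. p w * (g w)\<^sup>2)"
proof (induction k)
  case 0
  then show ?case by simp
next
  case (Suc k)
  let ?P = "\<lambda>ws. prod_list (map p ws)" and ?S = "\<lambda>ws. sum_list (map g ws)"
  note IH = Suc[THEN conjunct1] Suc[THEN conjunct2, THEN conjunct1] Suc[THEN conjunct2, THEN conjunct2]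
  have 0: "(\<Sum>ws\<in>lists_of F k. p w * ?P ws) = p w" for w
    using IH(1) by (simp flip: sum_distrib_left)
  have 1: "(\<Sum>ws\<in>lists_of F k. p w * ?P ws * (g w + ?S ws)) = p w * g w" for w
  proof -
    have "(\<Sum>ws\<in>lists_of F k. p w * ?P ws * (g w + ?S ws)) =
        p w * g w * (\<Sum>ws\<in>lists_of F k. ?P ws) + p w * (\<Sum>ws\<in>lists_of F k. ?P ws * ?S ws)"
      unfolding sum_distrib_left sum.distrib[symmetric] by (intro sum.cong) (simp_all add: algebra_simps)
    then show ?thesis using IH by simp
  qed
  have 2: "(\<Sum>ws\<in>lists_of F k. p w * ?P ws * (g w + ?S ws)\<^sup>2) =
      p w * (g w)\<^sup>2 + p w * (real k * (\<Sum>w\<in>F. p w * (g w)\<^sup>2))" for w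
  proof -
    have "(\<Sum>ws\<in>lists_of F k. p w * ?P ws * (g w + ?S ws)\<^sup>2) =
        p w * (g w)\<^sup>2 * (\<Sum>ws\<in>lists_of F k. ?P ws) + 2 * p w * g w * (\<Sum>ws\<in>lists_of F k. ?P ws * ?S ws) +
        p w * (\<Sum>ws\<in>lists_of F k. ?P ws * (?S ws)\<^sup>2)"
      unfolding sum_distrib_left sum.distrib[symmetric]
      by (intro sum.cong) (simp_all add: power2_eq_square algebra_simps)
    then show ?thesis using IH by simp
  qed
  have "(\<Sum>w\<in>F. p w * (real k * (\<Sum>w\<in>F. p w * (g w)\<^sup>2))) = real k * (\<Sum>w\<in>F. p w * (g w)\<^sup>2)"
    using assms(1) by (simp flip: sum_distrib_right)
  then show ?case
    using assms by (simp add: sum_lists_of_Suc 0 1 2 sum.distrib distrib_right)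
qed

lemma pigeonhole_sum:
  fixes h :: "'b \<Rightarrow> real"
  assumes "finite I" "finite T" "T \<noteq> {}" "g ` I \<subseteq> T" "\<alpha> \<le> sum h I"
  obtains v where "v \<in> T" "\<alpha> / real (card T) \<le> (\<Sum>x | x \<in> I \<and> g x = v. h x)"
proof (rule ccontr)
  assume "\<not> thesis"
  then have "(\<Sum>x | x \<in> I \<and> g x = v. h x) < \<alpha> / real (card T)" if "v \<in> T" for v
    using that \<open>\<And>v. v \<in> T \<Longrightarrow> _ \<Longrightarrow> thesis\<close> by force
  then have "(\<Sum>v\<in>T. \<Sum>x | x \<in> I \<and> g x = v. h x) < (\<Sum>v\<in>T. \<alpha> / real (card T))"
    using assms by (intro sum_strict_mono) auto
  also have "\<dots> = \<alpha>" using assms by simp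
  finally show False using sum.group[OF assms(1,2,4), of h] assms(5) by simp
qed

text \<open>What the random walk argument needs of loops: concatenation, a supermultiplicative
  weight \<mu>, an additive displacement \<open>f\<close>, and loops of one common length
  \<open>l\<close> moving by each unit vector in both directions. Distortion and the target growth
  rate are absorbed into \<mu> when the locale is interpreted.\<close>

locale graded_loops =
  fixes Lp :: "'w list set" and \<mu> :: "'w list \<Rightarrow> real" and f :: "'w list \<Rightarrow> nat \<Rightarrow> int"
    and d l :: nat
  assumes Lp_append: "\<And>u v. u \<in> Lp \<Longrightarrow> v \<in> Lp \<Longrightarrow> u @ v \<in> Lp"
    and \<mu>_pos: "\<And>w. w \<in> Lp \<Longrightarrow> \<mu> w > 0"
    and \<mu>_append: "\<And>u v. u \<in> Lp \<Longrightarrow> v \<in> Lp \<Longrightarrow> \<mu> u * \<mu> v \<le> \<mu> (u @ v)"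
    and f_append: "\<And>u v i. u \<in> Lp \<Longrightarrow> v \<in> Lp \<Longrightarrow> i < d \<Longrightarrow> f (u @ v) i = f u i + f v i"
    and l_pos: "l > 0"
    and unit_loop: "\<And>i \<sigma>. i < d \<Longrightarrow> \<sigma> \<in> {1, -1} \<Longrightarrow>
      \<exists>w\<in>Lp. length w = l \<and> (\<forall>j<d. f w j = (if j = i then \<sigma> else 0))"
begin

abbreviation dot :: "(nat \<Rightarrow> real) \<Rightarrow> (nat \<Rightarrow> int) \<Rightarrow> real" where
  "dot t v \<equiv> \<Sum>i<d. t i * real_of_int (v i)"

abbreviation pair :: "(nat \<Rightarrow> real) \<Rightarrow> 'w list \<Rightarrow> real" where
  "pair t w \<equiv> \<Sum>i<d. t i * real_of_int (f w i)"

abbreviation unit_step :: "nat \<Rightarrow> int \<Rightarrow> 'w list \<Rightarrow> bool" where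
  "unit_step i \<sigma> w \<equiv> \<forall>j<d. f w j = (if j = i then \<sigma> else 0)"

text \<open>The Laplace transform of the displacement under the weights \<mu>; in the application it
  is a finite part of a tilted partition sum, normalised by the growth rate and the
  distortion.\<close>

definition q :: "'w list set \<Rightarrow> (nat \<Rightarrow> real) \<Rightarrow> real" where
  "q F t = (\<Sum>w\<in>F. \<mu> w * exp (pair t w))"

text \<open>One length for all words makes a concatenation uniquely decodable, so distinct factors
  give distinct loops.\<close>

definition level :: "nat \<Rightarrow> 'w list set \<Rightarrow> bool" where
  "level n F \<longleftrightarrow> finite F \<and> F \<subseteq> Lp \<and> (\<forall>w\<in>F. length w = n)"

lemma q_cong: "(\<And>i. i < d \<Longrightarrow> t i = t' i) \<Longrightarrow> q F t = q F t'"
  unfolding q_def by (intro sum.cong arg_cong2[where f = "(*)"] arg_cong[where f = exp]) auto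

lemma q_nonneg: "level n F \<Longrightarrow> 0 \<le> q F t"
  unfolding q_def level_def using \<mu>_pos by (intro sum_nonneg mult_nonneg_nonneg) (auto intro: less_imp_le)

lemma q_mono: "level n F \<Longrightarrow> level n F' \<Longrightarrow> F \<subseteq> F' \<Longrightarrow> q F t \<le> q F' t"
  unfolding q_def level_def using \<mu>_pos
  by (intro sum_mono2 mult_nonneg_nonneg) (auto simp: subset_iff intro!: less_imp_le)

lemma continuous_q: "continuous_on UNIV (q F)"
  unfolding q_def by (intro continuous_intros continuous_on_product_coordinates)

lemma level_append:
  assumes "level n F" "level n' F'"
  obtains F'' where "level (n + n') F''" "\<And>t. q F t * q F' t \<le> q F'' t"
proof (rule that[of "(\<lambda>(u, v). u @ v) ` (F \<times> F')"])
  let ?F = "(\<lambda>(u, v). u @ v) ` (F \<times> F')"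
  show "level (n + n') ?F" using assms by (auto simp: level_def subset_iff intro!: Lp_append)
  have inj: "inj_on (\<lambda>(u, v). u @ v) (F \<times> F')"
    using assms by (auto simp: inj_on_def level_def)
  show "q F t * q F' t \<le> q ?F t" for t
  proof -
    have "q F t * q F' t = (\<Sum>(u, v)\<in>F \<times> F'. (\<mu> u * exp (pair t u)) *
        (\<mu> v * exp (pair t v)))"
      unfolding q_def by (simp add: sum_product sum.cartesian_product)
    also have "\<dots> \<le> (\<Sum>(u, v)\<in>F \<times> F'. \<mu> (u @ v) * exp (pair t (u @ v)))"
    proof (intro sum_mono, clarify)
      fix u v assume uv: "u \<in> F" "v \<in> F'"
      then have Lp: "u \<in> Lp" "v \<in> Lp" using assms by (auto simp: level_def)
      have "(pair t (u @ v)) =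
          (pair t u) + (pair t v)"
        unfolding sum.distrib[symmetric] by (intro sum.cong) (auto simp: f_append[OF Lp] algebra_simps)
      then show "(\<mu> u * exp (pair t u)) * (\<mu> v * exp (pair t v))
          \<le> \<mu> (u @ v) * exp (pair t (u @ v))"
        using mult_right_mono[OF \<mu>_append[OF Lp], of "exp (pair t (u @ v))"]
        by (simp add: exp_add mult_ac)
    qed
    also have "\<dots> = q ?F t"
      unfolding q_def by (subst sum.reindex[OF inj]) (simp add: case_prod_beta)
    finally show ?thesis .
  qed
qed

lemma level_power:
  assumes "level n F"
  shows "\<exists>F'. level (Suc k * n) F' \<and> (\<forall>t. q F t ^ Suc k \<le> q F' t)"
proof (induction k)
  case 0
  then show ?case using assms by (intro exI[of _ F]) auto
next
  case (Suc k)
  then obtain F' where F': "level (Suc k * n) F'" "\<And>t. q F t ^ Suc k \<le> q F' t" by blast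
  obtain F'' where F'': "level (n + Suc k * n) F''" "\<And>t. q F t * q F' t \<le> q F'' t"
    by (rule level_append[OF assms F'(1)]) blast
  have "q F t ^ Suc (Suc k) \<le> q F'' t" for t
    using mult_left_mono[OF F'(2) q_nonneg[OF assms], of t t] F''(2)[of t] by simp
  then show ?case using F''(1) by (intro exI[of _ F'']) simp
qed

text \<open>The exponent is positive, so a value above 1 of the generating function stays above 1 at
  every multiple of the length.\<close>

lemma level_dvd:
  assumes "level n F" "n dvd n'" "n' > 0"
  shows "\<exists>F'. level n' F' \<and> (\<exists>k. \<forall>t. q F t ^ Suc k \<le> q F' t)"
proof -
  obtain j where "n' = j * n" using assms(2) by (metis dvd_def mult.commute)
  moreover have "j > 0" using calculation assms(3) by (cases j) auto
  ultimately obtain k where "n' = Suc k * n" by (metis gr0_implies_Suc)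
  then show ?thesis using level_power[OF assms(1), of k] by auto
qed

text \<open>A cube in the first \<open>d\<close> coordinates; the others, which \<open>q\<close>
  does not see, are pinned to 0 so that the set is compact in the product topology.\<close>

definition box :: "real \<Rightarrow> (nat \<Rightarrow> real) set" where
  "box R = (\<Pi>\<^sub>E i\<in>UNIV. if i < d then {-R..R} else {0})"

lemma compact_box: "compact (box R)"
  using compactin_PiE[of "\<lambda>_. euclidean" UNIV "\<lambda>i. if i < d then {-R..R} else {0}"]
  by (simp add: box_def euclidean_product_topology)

lemma box_or_large:
  obtains t' where "t' \<in> box R" "\<And>i. i < d \<Longrightarrow> t i = t' i" | i where "i < d" "R < \<bar>t i\<bar>"
proof (cases "\<forall>i<d. \<bar>t i\<bar> \<le> R")
  case True
  then show thesis
    by (intro that(1)[of "\<lambda>i. if i < d then t i else 0"]) (auto simp: box_def abs_le_iff minus_le_iff)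
next
  case False
  then show thesis using that(2) by (meson not_le)
qed

text \<open>The unit loop in direction \<open>i\<close> whose sign is that of \<open>t i\<close>
  alone contributes \<open>exp \<bar>t i\<bar>\<close> times its weight, which makes
  \<open>q\<close> coercive.\<close>

lemma unit_level:
  obtains F c where "level l F" "0 < c" "c \<le> 1"
    "\<And>i \<sigma>. i < d \<Longrightarrow> \<sigma> \<in> {1, -1} \<Longrightarrow> \<exists>w\<in>F. c \<le> \<mu> w \<and> unit_step i \<sigma> w"
    "\<And>t i. i < d \<Longrightarrow> c * exp \<bar>t i\<bar> \<le> q F t"
proof -
  have "\<forall>x\<in>{..<d} \<times> {1, -1}. \<exists>w. w \<in> Lp \<and> length w = l \<and> (\<forall>j<d. f w j = (if j = fst x then snd x else 0))"
  proof
    fix x :: "nat \<times> int" assume "x \<in> {..<d} \<times> {1, -1}"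
    then have "fst x < d" "snd x \<in> {1, -1}" by auto
    from unit_loop[OF this] show "\<exists>w. w \<in> Lp \<and> length w = l \<and> (\<forall>j<d. f w j = (if j = fst x then snd x else 0))"
      by (simp only: Bex_def)
  qed
  from bchoice[OF this] obtain e where e': "\<forall>x\<in>{..<d} \<times> {1, -1}. e x \<in> Lp \<and> length (e x) = l \<and>
      (\<forall>j<d. f (e x) j = (if j = fst x then snd x else 0))" ..
  have e: "e (i, \<sigma>) \<in> Lp \<and> length (e (i, \<sigma>)) = l \<and> (\<forall>j<d. f (e (i, \<sigma>)) j = (if j = i then \<sigma> else 0))"
    if "i < d" "\<sigma> \<in> {1, -1}" for i \<sigma>
    using e'[rule_format, of "(i, \<sigma>)"] that by simp
  define F where "F = e ` ({..<d} \<times> {1, -1})"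
  \<comment> \<open>Inserting 1 gives \<open>c \<le> 1\<close> and covers \<open>d = 0\<close>,
    where \<open>F\<close> is empty.\<close>
  define c where "c = Min (insert 1 (\<mu> ` F))"
  have F: "level l F" using e' by (auto simp: F_def level_def)
  then have fin: "finite F" "F \<subseteq> Lp" by (auto simp: level_def)
  have c: "0 < c" "c \<le> 1" "\<And>w. w \<in> F \<Longrightarrow> c \<le> \<mu> w"
    unfolding c_def using fin \<mu>_pos by auto
  have unit: "\<exists>w\<in>F. c \<le> \<mu> w \<and> unit_step i \<sigma> w" if "i < d" "\<sigma> \<in> {1, -1}" for i \<sigma>
  proof (intro bexI[of _ "e (i, \<sigma>)"] conjI c)
    show "e (i, \<sigma>) \<in> F" "e (i, \<sigma>) \<in> F" using that unfolding F_def by blast+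
  qed (use e[OF that] in blast)
  have "c * exp \<bar>t i\<bar> \<le> q F t" if i: "i < d" for t i
  proof -
    define \<sigma> :: int where "\<sigma> = (if t i \<ge> 0 then 1 else -1)"
    obtain w where w: "w \<in> F" "c \<le> \<mu> w" "\<forall>j<d. f w j = (if j = i then \<sigma> else 0)"
      using unit[OF i, of \<sigma>] by (metis \<sigma>_def insertCI)
    have "(pair t w) = (\<Sum>j<d. if j = i then \<bar>t i\<bar> else 0)"
      using w(3) by (intro sum.cong) (auto simp: \<sigma>_def)
    also have "\<dots> = \<bar>t i\<bar>" using i by simp
    finally have "c * exp \<bar>t i\<bar> \<le> \<mu> w * exp (pair t w)"
      using w(2) by simp
    also have "\<dots> \<le> q F t"
      unfolding q_def using w(1) fin \<mu>_pos
      by (intro member_le_sum) (auto intro!: mult_nonneg_nonneg intro: less_imp_le)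
    finally show ?thesis .
  qed
  with F c(1,2) unit show thesis by (rule that)
qed

text \<open>Compactness handles a box of parameters, the unit loops handle its complement, and products
  make the lengths agree.\<close>

lemma uniform_level:
  assumes big: "\<And>t. \<exists>n F. n > 0 \<and> level n F \<and> 1 < q F t"
  obtains n F c where "n > 0" "level n F" "c > 0" "\<And>t. 1 \<le> q F t" "\<And>t i. i < d \<Longrightarrow> c * exp \<bar>t i\<bar> \<le> q F t"
proof -
  obtain F0 c where F0: "level l F0" and c: "0 < c" "c \<le> 1"
    and "\<And>i \<sigma>. i < d \<Longrightarrow> \<sigma> \<in> {1, -1} \<Longrightarrow> \<exists>w\<in>F0. c \<le> \<mu> w \<and> unit_step i \<sigma> w"
    and coer: "\<And>t i. i < d \<Longrightarrow> c * exp \<bar>t i\<bar> \<le> q F0 t"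
    by (rule unit_level) (rule that)
  \<comment> \<open>Beyond this radius \<open>c * exp \<bar>t i\<bar>\<close> exceeds 1, so the unit
    loops suffice there.\<close>
  define R where "R = - ln c"
  have "\<forall>t. \<exists>x. fst x > 0 \<and> level (fst x) (snd x) \<and> 1 < q (snd x) t" using big by simp
  from choice[OF this] obtain x where x: "\<And>t. fst (x t) > 0 \<and> level (fst (x t)) (snd (x t)) \<and> 1 < q (snd (x t)) t"
    by blast
  have open_U: "open {t'. 1 < q (snd (x t)) t'}" for t
    by (intro open_Collect_less continuous_q continuous_on_const)
  have "box R \<subseteq> (\<Union>t\<in>box R. {t'. 1 < q (snd (x t)) t'})" using x by auto
  from compactE_image[OF compact_box open_U this]
  obtain T where T: "T \<subseteq> box R" "finite T" "box R \<subseteq> (\<Union>t\<in>T. {t'. 1 < q (snd (x t)) t'})" by blast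
  \<comment> \<open>A common multiple of all lengths involved: every set is raised to this length by
    taking powers.\<close>
  define n where "n = l * (\<Prod>t\<in>T. fst (x t))"
  have n: "n > 0" using l_pos x by (auto simp: n_def intro!: prod_pos)
  obtain F1 k1 where F1: "level n F1" "\<And>t. q F0 t ^ Suc k1 \<le> q F1 t"
    using level_dvd[OF F0 _ n] by (auto simp: n_def)
  have "\<forall>t\<in>T. \<exists>F'. level n F' \<and> (\<exists>k. \<forall>t'. q (snd (x t)) t' ^ Suc k \<le> q F' t')"
  proof
    fix t assume "t \<in> T"
    then have "fst (x t) dvd n" using T(2) by (auto simp: n_def intro!: dvd_mult dvd_prodI)
    then show "\<exists>F'. level n F' \<and> (\<exists>k. \<forall>t'. q (snd (x t)) t' ^ Suc k \<le> q F' t')"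
      using x n by (intro level_dvd) auto
  qed
  from bchoice[OF this] obtain F2 where F2: "\<And>t. t \<in> T \<Longrightarrow> level n (F2 t)"
    "\<And>t. t \<in> T \<Longrightarrow> \<exists>k. \<forall>t'. q (snd (x t)) t' ^ Suc k \<le> q (F2 t) t'" by blast
  define F where "F = F1 \<union> (\<Union>t\<in>T. F2 t)"
  have F: "level n F" using F1(1) F2(1) T(2) unfolding level_def F_def by blast
  have F01: "q F0 t ^ Suc k1 \<le> q F t" for t
    using F1(2)[of t] q_mono[OF F1(1) F, of t] by (simp add: F_def)
  show thesis
  proof (rule that[of n F "c ^ Suc k1"])
    show coer': "c ^ Suc k1 * exp \<bar>t i\<bar> \<le> q F t" if "i < d" for t i
    proof -
      have "c ^ Suc k1 * exp \<bar>t i\<bar> \<le> c ^ Suc k1 * exp \<bar>t i\<bar> ^ Suc k1"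
        using c by (intro mult_left_mono self_le_power) auto
      also have "\<dots> = (c * exp \<bar>t i\<bar>) ^ Suc k1" by (simp only: power_mult_distrib)
      also have "\<dots> \<le> q F0 t ^ Suc k1" using coer[OF that, of t] c by (intro power_mono) auto
      also have "\<dots> \<le> q F t" by (rule F01)
      finally show ?thesis .
    qed
    show "1 \<le> q F t" for t
    proof (rule box_or_large[of R t])
      fix i assume i: "i < d" "R < \<bar>t i\<bar>"
      have "1 = c * exp R" using c by (simp add: R_def exp_minus)
      also have "\<dots> \<le> c * exp \<bar>t i\<bar>" using i c by simp
      also have "\<dots> \<le> q F0 t" by (rule coer[OF i(1)])
      finally have "1 ^ Suc k1 \<le> q F0 t ^ Suc k1" by (intro power_mono) auto
      also have "\<dots> \<le> q F t" by (rule F01)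
      finally show ?thesis by simp
    next
      fix t' assume t': "t' \<in> box R" "\<And>i. i < d \<Longrightarrow> t i = t' i"
      then obtain s where s: "s \<in> T" "1 < q (snd (x s)) t'" using T(3) by auto
      obtain k where k: "q (snd (x s)) t' ^ Suc k \<le> q (F2 s) t'" using F2(2)[OF s(1)] by blast
      have "1 \<le> q (snd (x s)) t' ^ Suc k" using s(2) by (intro one_le_power) simp
      also note k
      also have "q (F2 s) t' \<le> q F t'" using F F2(1)[OF s(1)] s(1) by (intro q_mono) (auto simp: F_def)
      also have "q F t' = q F t" using t'(2) by (intro q_cong) auto
      finally show ?thesis .
    qed
  qed (use n F c in auto)
qed

text \<open>Coercivity turns the minimum over a large cube into a global one, and there every
  partial derivative of \<open>q\<close> vanishes; the derivative in direction \<open>i\<close> is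
  the tilted sum of the displacements in that direction.\<close>

lemma centred_level:
  assumes "level n F" "c > 0" "\<And>t i. i < d \<Longrightarrow> c * exp \<bar>t i\<bar> \<le> q F t"
  obtains t where "\<And>i. i < d \<Longrightarrow>
    (\<Sum>w\<in>F. \<mu> w * exp (pair t w) * real_of_int (f w i)) = 0"
proof -
  \<comment> \<open>Outside this cube coercivity already gives values at least that of
    \<open>q\<close> at 0; the maximum with 0 keeps the origin inside.\<close>
  define R where "R = max 0 (ln (q F (\<lambda>_. 0) / c))"
  have "(\<lambda>_. 0) \<in> box R" by (auto simp: box_def R_def)
  then have "box R \<noteq> {}" by blast
  then obtain t where t: "t \<in> box R" "\<And>t'. t' \<in> box R \<Longrightarrow> q F t \<le> q F t'"
    using continuous_attains_inf[OF compact_box _ continuous_on_subset[OF continuous_q subset_UNIV]] by blast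
  have min: "q F t \<le> q F s" for s
  proof (rule box_or_large[of R s])
    fix t' assume "t' \<in> box R" "\<And>i. i < d \<Longrightarrow> s i = t' i"
    then show ?thesis using t(2)[of t'] q_cong[of s t' F] by simp
  next
    fix i assume i: "i < d" "R < \<bar>s i\<bar>"
    have "0 < c * exp 0" using assms by simp
    also have "\<dots> \<le> q F (\<lambda>_. 0)" using assms(3)[OF i(1), of "\<lambda>_. 0"] by simp
    finally have pos: "q F (\<lambda>_. 0) / c > 0" using assms by simp
    have "q F t \<le> q F (\<lambda>_. 0)" by (rule t(2)) fact
    also have "\<dots> = c * exp (ln (q F (\<lambda>_. 0) / c))" using pos assms by simp
    also have "\<dots> \<le> c * exp \<bar>s i\<bar>" using i assms by (simp add: R_def)
    also have "\<dots> \<le> q F s" by (rule assms(3)[OF i(1)])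
    finally show ?thesis .
  qed
  show thesis
  proof (rule that[of t])
    fix i assume i: "i < d"
    let ?a = "\<lambda>w. \<mu> w * exp (pair t w)"
    define g where "g s = (\<Sum>w\<in>F. ?a w * exp (s * real_of_int (f w i)))" for s
    have g: "g s = q F (t(i := t i + s))" for s
    proof -
      have "(\<Sum>j<d. (t(i := t i + s)) j * real_of_int (f w j)) =
          (pair t w) + (\<Sum>j<d. if j = i then s * real_of_int (f w i) else 0)" for w
        unfolding sum.distrib[symmetric] by (intro sum.cong) (auto simp: algebra_simps)
      then show ?thesis using i by (simp add: g_def q_def exp_add mult.assoc)
    qed
    have "(g has_real_derivative (\<Sum>w\<in>F. ?a w * (exp (0 * real_of_int (f w i)) * real_of_int (f w i)))) (at 0)"
      unfolding g_def by (auto intro!: derivative_eq_intros sum.cong)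
    moreover have "\<forall>s. \<bar>0 - s\<bar> < 1 \<longrightarrow> g 0 \<le> g s" using min by (simp add: g)
    ultimately have "(\<Sum>w\<in>F. ?a w * (exp (0 * real_of_int (f w i)) * real_of_int (f w i))) = 0"
      by (intro DERIV_local_min[where d = 1]) auto
    then show "(\<Sum>w\<in>F. ?a w * real_of_int (f w i)) = 0" by simp
  qed
qed

end

section \<open>Concentration and return to the origin\<close>

context graded_loops
begin

text \<open>Loops of \<open>k\<close> times the length \<open>n\<close> with one common displacement
  \<open>v\<close>. The factor \<open>exp (- dot t v)\<close> undoes the tilt by \<open>t\<close>,
  \<open>(2 * r + 1) ^ d\<close> counts the lattice points of the cube of radius \<open>r\<close>,
  and the 2 stands for the half of the mass kept by Chebyshev's inequality.\<close>

abbreviation concentrated :: "nat \<Rightarrow> (nat \<Rightarrow> real) \<Rightarrow> real \<Rightarrow> nat \<Rightarrow> bool" where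
  "concentrated n t U k \<equiv> \<exists>r v F. real r \<le> sqrt (real k * U) + 1 \<and> (\<forall>i<d. \<bar>v i\<bar> \<le> int r) \<and>
     level (k * n) F \<and> (\<forall>w\<in>F. \<forall>i<d. f w i = v i) \<and>
     exp (- dot t v) / (2 * (2 * real r + 1) ^ d) \<le> (\<Sum>w\<in>F. \<mu> w)"

lemma concat_loops:
  assumes "set ws \<subseteq> Lp" "ws \<noteq> []"
  shows "concat ws \<in> Lp \<and> prod_list (map \<mu> ws) \<le> \<mu> (concat ws) \<and>
    (\<forall>i<d. f (concat ws) i = sum_list (map (\<lambda>w. f w i) ws))"
  using assms(2,1)
proof (induction ws rule: list_nonempty_induct)
  case (single w)
  then show ?case by simp
next
  case (cons w ws)
  then have IH: "concat ws \<in> Lp" "prod_list (map \<mu> ws) \<le> \<mu> (concat ws)"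
    "\<And>i. i < d \<Longrightarrow> f (concat ws) i = sum_list (map (\<lambda>w. f w i) ws)" and w: "w \<in> Lp" by auto
  have "\<mu> w * prod_list (map \<mu> ws) \<le> \<mu> w * \<mu> (concat ws)"
    using IH \<mu>_pos[OF w] by (intro mult_left_mono) auto
  also have "\<dots> \<le> \<mu> (w @ concat ws)" by (rule \<mu>_append[OF w IH(1)])
  finally show ?case using IH w Lp_append f_append by simp
qed

text \<open>Tilting by the minimiser of the generating function makes the walk centred, so Chebyshev's
  inequality keeps half of its mass within distance of order \<open>sqrt k\<close>, and some displacement \<open>v\<close>
  there receives a polynomial share.\<close>

lemma concentrated_level:
  assumes F: "level n F" and ge1: "1 \<le> q F t"
    and centred: "\<And>i. i < d \<Longrightarrow> (\<Sum>w\<in>F. \<mu> w * exp (pair t w) * real_of_int (f w i)) = 0"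
  shows "\<exists>U>0. \<forall>k\<ge>1. concentrated n t U k"
proof -
  define m where "m = q F t"
  define a where "a w = exp (pair t w)" for w
  \<comment> \<open>The step distribution of the walk.\<close>
  define p where "p w = \<mu> w * a w / m" for w
  have m: "m \<ge> 1" using ge1 by (simp add: m_def)
  have FLp: "finite F" "F \<subseteq> Lp" "\<And>w. w \<in> F \<Longrightarrow> length w = n" using F by (auto simp: level_def)
  have p_pos: "p w \<ge> 0" if "w \<in> F" for w
    using \<mu>_pos[of w] that FLp m by (auto simp: p_def a_def intro!: divide_nonneg_nonneg mult_nonneg_nonneg)
  have p_sum: "(\<Sum>w\<in>F. p w) = 1"
    using m unfolding p_def m_def a_def by (simp add: q_def flip: sum_divide_distrib)
  have p_mean: "(\<Sum>w\<in>F. p w * real_of_int (f w i)) = 0" if "i < d" for i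
    using centred[OF that] by (simp add: p_def a_def flip: sum_divide_distrib)
  define V where "V = (\<Sum>i<d. \<Sum>w\<in>F. p w * (real_of_int (f w i))\<^sup>2)"
  have V: "V \<ge> 0" unfolding V_def using p_pos by (intro sum_nonneg mult_nonneg_nonneg) auto
  \<comment> \<open>Chebyshev leaves at most \<open>V / U \<le> 1 / 2\<close> of the mass outside;
    the summand 1 keeps \<open>U\<close> positive when the walk does not move.\<close>
  define U where "U = 2 * (V + 1)"
  show ?thesis
  proof (intro exI[of _ U] conjI allI impI)
    show "U > 0" using V by (simp add: U_def)
    fix k :: nat assume k: "k \<ge> 1"
    let ?P = "\<lambda>ws. prod_list (map p ws)"
    define Sv where "Sv i ws = sum_list (map (\<lambda>w. f w i) ws)" for i ws
    have Sv_real: "real_of_int (Sv i ws) = sum_list (map (\<lambda>w. real_of_int (f w i)) ws)" for i ws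
      by (induction ws) (simp_all add: Sv_def)
    let ?L = "lists_of F k"
    have finL: "finite ?L" using FLp by (simp add: finite_lists_of)
    have P_pos: "?P ws \<ge> 0" if "ws \<in> ?L" for ws
      using that p_pos by (intro prod_list_nonneg) (auto simp: lists_of_def)
    have P_sum: "(\<Sum>ws\<in>?L. ?P ws) = 1"
      using walk_second_moment[of p F "\<lambda>_. 0" k] p_sum by simp
    let ?Q = "\<lambda>ws. \<Sum>i<d. (real_of_int (Sv i ws))\<^sup>2"
    have var: "(\<Sum>ws\<in>?L. ?P ws * ?Q ws) = real k * V"
    proof -
      have "(\<Sum>ws\<in>?L. ?P ws * ?Q ws) =
          (\<Sum>i<d. \<Sum>ws\<in>?L. ?P ws * (real_of_int (Sv i ws))\<^sup>2)"
        unfolding sum_distrib_left by (rule sum.swap)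
      also have "\<dots> = (\<Sum>i<d. real k * (\<Sum>w\<in>F. p w * (real_of_int (f w i))\<^sup>2))"
        using walk_second_moment[OF p_sum p_mean] by (intro sum.cong) (simp_all add: Sv_real)
      finally show ?thesis by (simp add: V_def sum_distrib_left)
    qed
    define Good where "Good = {ws \<in> ?L. ?Q ws \<le> real k * U}"
    have "(\<Sum>ws\<in>?L - Good. ?P ws) * (real k * U) \<le> (\<Sum>ws\<in>?L - Good. ?P ws * ?Q ws)"
      unfolding sum_distrib_right using P_pos by (intro sum_mono mult_left_mono) (auto simp: Good_def)
    also have "\<dots> \<le> (\<Sum>ws\<in>?L. ?P ws * ?Q ws)"
      using finL P_pos by (intro sum_mono2 mult_nonneg_nonneg sum_nonneg) auto
    also have "\<dots> = real k * V" by (rule var)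
    also have "\<dots> \<le> 1 / 2 * (real k * U)" using k by (simp add: U_def)
    finally have "(\<Sum>ws\<in>?L - Good. ?P ws) \<le> 1 / 2"
      using k V by (subst (asm) mult_le_cancel_right_pos) (auto simp: U_def)
    moreover have "(\<Sum>ws\<in>?L. ?P ws) = (\<Sum>ws\<in>?L - Good. ?P ws) + (\<Sum>ws\<in>Good. ?P ws)"
      using finL by (intro sum.subset_diff) (auto simp: Good_def)
    ultimately have half: "1 / 2 \<le> (\<Sum>ws\<in>Good. ?P ws)" using P_sum by simp
    define r where "r = nat \<lceil>sqrt (real k * U)\<rceil>"
    have r: "sqrt (real k * U) \<le> real r" "real r \<le> sqrt (real k * U) + 1"
      using V by (auto simp: r_def U_def)
    define T where "T = (\<Pi>\<^sub>E i\<in>{..<d}. {- int r..int r})"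
    have T: "finite T" "card T = (2 * r + 1) ^ d"
    proof -
      show "finite T" by (auto simp: T_def intro!: finite_PiE)
      have "card {- int r..int r} = 2 * r + 1" unfolding card_atLeastAtMost_int by linarith
      then show "card T = (2 * r + 1) ^ d"
        unfolding T_def by (subst card_PiE) (simp_all only: finite_lessThan prod_constant card_lessThan)
    qed
    then have Tne: "T \<noteq> {}" by auto
    let ?S = "\<lambda>ws. \<lambda>i\<in>{..<d}. Sv i ws"
    have GT: "?S ` Good \<subseteq> T"
    proof (intro image_subsetI)
      fix ws assume ws: "ws \<in> Good"
      have "\<bar>Sv i ws\<bar> \<le> int r" if "i < d" for i
      proof -
        have "(real_of_int (Sv i ws))\<^sup>2 \<le> ?Q ws"
          using that by (intro member_le_sum) auto
        also have "\<dots> \<le> real k * U" using ws by (simp add: Good_def)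
        finally have "sqrt ((real_of_int (Sv i ws))\<^sup>2) \<le> sqrt (real k * U)" by (rule real_sqrt_le_mono)
        then have "\<bar>real_of_int (Sv i ws)\<bar> \<le> real r" using r by simp
        then show ?thesis by linarith
      qed
      then show "?S ws \<in> T" by (auto simp: T_def abs_le_iff minus_le_iff)
    qed
    have finG: "finite Good" using finL by (simp add: Good_def)
    obtain v where v: "v \<in> T" "1 / 2 / real (card T) \<le> (\<Sum>ws | ws \<in> Good \<and> ?S ws = v. ?P ws)"
      by (rule pigeonhole_sum[OF finG T(1) Tne GT half]) blast
    define H where "H = {ws \<in> Good. ?S ws = v}"
    have H: "length ws = k" "set ws \<subseteq> F" "ws \<noteq> []" "\<And>i. i < d \<Longrightarrow> Sv i ws = v i" if "ws \<in> H" for ws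
      using that k by (auto simp: H_def Good_def lists_of_def)
    have Hc: "concat ws \<in> Lp" "prod_list (map \<mu> ws) \<le> \<mu> (concat ws)" "\<And>i. i < d \<Longrightarrow> f (concat ws) i = v i"
      "length (concat ws) = k * n" if "ws \<in> H" for ws
    proof -
      have "set ws \<subseteq> Lp" using H[OF that] FLp by blast
      from concat_loops[OF this H(3)[OF that]] show "concat ws \<in> Lp" "prod_list (map \<mu> ws) \<le> \<mu> (concat ws)"
        "\<And>i. i < d \<Longrightarrow> f (concat ws) i = v i" using H(4)[OF that] by (auto simp: Sv_def)
      have "\<forall>w\<in>set ws. length w = n" using H[OF that] FLp by blast
      then have "map length ws = replicate (length ws) n" by (simp add: map_replicate_const[symmetric])
      then show "length (concat ws) = k * n" using H(1)[OF that] by (simp add: length_concat sum_list_replicate)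
    qed
    \<comment> \<open>All lists have \<open>k\<close> blocks of the same length \<open>n\<close>, so
      the concatenation determines the blocks.\<close>
    have inj: "inj_on concat H"
    proof (rule inj_onI)
      fix ws ws' assume *: "ws \<in> H" "ws' \<in> H" "concat ws = concat ws'"
      have "\<forall>(x, y)\<in>set (zip ws ws'). length x = length y"
      proof clarify
        fix x y assume "(x, y) \<in> set (zip ws ws')"
        then have "x \<in> set ws" "y \<in> set ws'" by (rule set_zip_leftD, rule set_zip_rightD)
        then show "length x = length y" using H(2)[OF *(1)] H(2)[OF *(2)] FLp(3) by (metis subsetD)
      qed
      then show "ws = ws'" using concat_injective[OF *(3)] H(1) * by simp
    qed
    have Pws: "?P ws \<le> exp (dot t v) * \<mu> (concat ws)" if "ws \<in> H" for ws
    proof -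
      have P_eq: "?P ws = prod_list (map \<mu> ws) * exp (\<Sum>i<d. t i * real_of_int (Sv i ws)) / m ^ length ws" for ws
      proof (induction ws)
        case (Cons w ws)
        have "(\<Sum>i<d. t i * real_of_int (Sv i (w # ws))) =
            (pair t w) + (\<Sum>i<d. t i * real_of_int (Sv i ws))"
          by (simp add: Sv_def distrib_left sum.distrib)
        then show ?case using Cons by (simp add: p_def a_def exp_add)
      qed (simp add: Sv_def)
      have nn: "0 \<le> prod_list (map \<mu> ws)"
        using H(2)[OF that] FLp \<mu>_pos by (intro prod_list_nonneg) (auto simp: subset_iff intro!: less_imp_le)
      have "?P ws \<le> prod_list (map \<mu> ws) * exp (\<Sum>i<d. t i * real_of_int (Sv i ws)) / 1"
        unfolding P_eq using m nn by (intro divide_left_mono) auto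
      also have "\<dots> = exp (dot t v) * prod_list (map \<mu> ws)"
        using H(4)[OF that] by simp
      also have "\<dots> \<le> exp (dot t v) * \<mu> (concat ws)"
        by (intro mult_left_mono Hc that) auto
      finally show ?thesis .
    qed
    have "1 / (2 * (2 * real r + 1) ^ d) = 1 / 2 / real (card T)" by (simp add: T(2) add.commute)
    also have "\<dots> \<le> (\<Sum>ws\<in>H. ?P ws)" using v(2) by (simp add: H_def)
    also have "\<dots> \<le> (\<Sum>ws\<in>H. exp (dot t v) * \<mu> (concat ws))"
      by (intro sum_mono Pws)
    also have "\<dots> = exp (dot t v) * (\<Sum>w\<in>concat ` H. \<mu> w)"
      by (simp add: sum.reindex[OF inj] sum_distrib_left)
    finally have final: "exp (- dot t v) / (2 * (2 * real r + 1) ^ d) \<le> (\<Sum>w\<in>concat ` H. \<mu> w)"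
      by (simp add: exp_minus field_simps)
    have "level (k * n) (concat ` H)" using Hc finG by (auto simp: level_def H_def)
    moreover have "\<forall>i<d. \<bar>v i\<bar> \<le> int r" using v(1) by (auto simp: T_def abs_le_iff PiE_iff minus_le_iff)
    ultimately show "concentrated n t U k"
      using r(2) final Hc(3) by blast
  qed
qed

text \<open>Each appended unit loop moves the displacement one step towards the origin at the price
  of a factor \<open>c\<close> and \<open>l\<close> letters; \<open>k\<close> is the distance to the
  origin in the sum norm.\<close>

lemma return_level:
  assumes unit: "\<And>i \<sigma>. i < d \<Longrightarrow> \<sigma> \<in> {1, -1} \<Longrightarrow>
      \<exists>w\<in>Lp. length w = l \<and> c \<le> \<mu> w \<and> unit_step i \<sigma> w"
    and c: "c > 0"
    and "level n F" "\<And>w i. w \<in> F \<Longrightarrow> i < d \<Longrightarrow> f w i = v i" "(\<Sum>i<d. nat \<bar>v i\<bar>) = k"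
  shows "\<exists>F'. level (n + k * l) F' \<and> (\<forall>w\<in>F'. \<forall>i<d. f w i = 0) \<and> c ^ k * (\<Sum>w\<in>F. \<mu> w) \<le> (\<Sum>w\<in>F'. \<mu> w)"
  using assms(3-)
proof (induction k arbitrary: n F v)
  case 0
  then have "v i = 0" if "i < d" for i using that by simp
  then show ?case using 0 by (intro exI[of _ F]) auto
next
  case (Suc k)
  have "\<exists>i<d. v i \<noteq> 0"
  proof (rule ccontr)
    assume "\<not> ?thesis"
    then have "(\<Sum>i<d. nat \<bar>v i\<bar>) = 0" by simp
    then show False using Suc.prems(3) by simp
  qed
  then obtain i where i: "i < d" "v i \<noteq> 0" by blast
  define \<sigma> where "\<sigma> = - sgn (v i)"
  have \<sigma>: "\<sigma> \<in> {1, -1}" using i by (auto simp: \<sigma>_def sgn_if)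
  obtain e where e: "e \<in> Lp" "length e = l" "c \<le> \<mu> e" "\<forall>j<d. f e j = (if j = i then \<sigma> else 0)"
    using unit[OF i(1) \<sigma>] by blast
  define v' where "v' = v(i := v i + \<sigma>)"
  have FLp: "finite F" "F \<subseteq> Lp" "\<And>w. w \<in> F \<Longrightarrow> length w = n" using Suc.prems by (auto simp: level_def)
  have "(\<Sum>j<d. nat \<bar>v j\<bar>) = nat \<bar>v i\<bar> + (\<Sum>j\<in>{..<d} - {i}. nat \<bar>v j\<bar>)"
    "(\<Sum>j<d. nat \<bar>v' j\<bar>) = nat \<bar>v' i\<bar> + (\<Sum>j\<in>{..<d} - {i}. nat \<bar>v' j\<bar>)"
    using i by (auto intro: sum.remove)
  moreover have "(\<Sum>j\<in>{..<d} - {i}. nat \<bar>v' j\<bar>) = (\<Sum>j\<in>{..<d} - {i}. nat \<bar>v j\<bar>)"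
    by (intro sum.cong) (auto simp: v'_def)
  moreover have "nat \<bar>v i\<bar> = Suc (nat \<bar>v' i\<bar>)"
    using i by (auto simp: v'_def \<sigma>_def sgn_if)
  ultimately have v': "(\<Sum>j<d. nat \<bar>v' j\<bar>) = k" using Suc.prems(3) by simp
  have "level (n + l) ((\<lambda>w. w @ e) ` F)"
    using FLp e Lp_append by (auto simp: level_def)
  moreover have "f w j = v' j" if "w \<in> (\<lambda>w. w @ e) ` F" "j < d" for w j
    using that FLp e f_append Suc.prems(2) by (auto simp: v'_def)
  ultimately obtain F' where F': "level (n + l + k * l) F'" "\<forall>w\<in>F'. \<forall>i<d. f w i = 0"
      "c ^ k * (\<Sum>w\<in>(\<lambda>w. w @ e) ` F. \<mu> w) \<le> (\<Sum>w\<in>F'. \<mu> w)"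
    using Suc.IH[of "n + l" "(\<lambda>w. w @ e) ` F" v'] v' by blast
  have "c * (\<Sum>w\<in>F. \<mu> w) \<le> (\<Sum>w\<in>F. \<mu> (w @ e))"
    unfolding sum_distrib_left
  proof (rule sum_mono)
    fix w assume w: "w \<in> F"
    then have "w \<in> Lp" using FLp by blast
    have "c * \<mu> w \<le> \<mu> e * \<mu> w" using e \<mu>_pos[OF \<open>w \<in> Lp\<close>] by (intro mult_right_mono) auto
    also have "\<dots> \<le> \<mu> (w @ e)" using \<mu>_append[OF \<open>w \<in> Lp\<close> e(1)] by (simp add: mult.commute)
    finally show "c * \<mu> w \<le> \<mu> (w @ e)" .
  qed
  also have "\<dots> = (\<Sum>w\<in>(\<lambda>w. w @ e) ` F. \<mu> w)" by (subst sum.reindex) (auto simp: inj_on_def)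
  finally have "c ^ k * (c * (\<Sum>w\<in>F. \<mu> w)) \<le> c ^ k * (\<Sum>w\<in>(\<lambda>w. w @ e) ` F. \<mu> w)"
    using c by (intro mult_left_mono) auto
  then have "c ^ Suc k * (\<Sum>w\<in>F. \<mu> w) \<le> (\<Sum>w\<in>F'. \<mu> w)" using F'(3) by (simp add: mult_ac)
  then show ?case using F' by (intro exI[of _ F']) (simp add: add.assoc)
qed

text \<open>After \<open>k\<close> steps the centred walk is within a radius \<open>r\<close> of
  order \<open>sqrt k\<close>, and leading it back costs a factor exponential only in
  \<open>r\<close>. The total cost \<open>exp (- (H * r + 1))\<close> is therefore subexponential in
  the length.\<close>

theorem subexponential_return:
  assumes big: "\<And>t. \<exists>n F. n > 0 \<and> level n F \<and> 1 < q F t" and \<epsilon>: "\<epsilon> > 0"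
  shows "\<exists>n\<ge>n0. \<exists>F. level n F \<and> (\<forall>w\<in>F. \<forall>i<d. f w i = 0) \<and> exp (- \<epsilon> * real n) \<le> (\<Sum>w\<in>F. \<mu> w)"
proof -
  obtain F0 c where F0: "level l F0" and c: "0 < c" "c \<le> 1"
    and unit: "\<And>i \<sigma>. i < d \<Longrightarrow> \<sigma> \<in> {1, -1} \<Longrightarrow> \<exists>w\<in>F0. c \<le> \<mu> w \<and> unit_step i \<sigma> w"
    and "\<And>t i. i < d \<Longrightarrow> c * exp \<bar>t i\<bar> \<le> q F0 t"
    by (rule unit_level) (rule that)
  obtain n F c' where n: "n > 0" and F: "level n F" and c': "c' > 0" and ge1: "\<And>t. 1 \<le> q F t"
    and coer: "\<And>t i. i < d \<Longrightarrow> c' * exp \<bar>t i\<bar> \<le> q F t"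
    by (rule uniform_level[OF big]) (rule that)
  obtain t where centred: "\<And>i. i < d \<Longrightarrow>
    (\<Sum>w\<in>F. \<mu> w * exp (pair t w) * real_of_int (f w i)) = 0"
    by (rule centred_level[OF F c' coer]) (assumption, rule that)
  obtain U where U: "U > 0" and conc: "\<And>k. k \<ge> 1 \<Longrightarrow> concentrated n t U k"
    using concentrated_level[OF F ge1 centred] by blast
  \<comment> \<open>The cost per unit of the radius \<open>r\<close>: at most \<open>d * r\<close>
    unit loops of weight at least \<open>c\<close>, the undone tilt, and the lattice point count
    through \<open>2 * r + 1 \<le> exp (2 * r)\<close>. The remaining factor 2 is paid by the 1 in
    \<open>H * r + 1\<close>.\<close>
  define H where "H = real d * (- ln c) + (\<Sum>i<d. \<bar>t i\<bar>) + 2 * real d"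
  have "real d * (- ln c) \<ge> 0" using c by (intro mult_nonneg_nonneg) auto
  then have H: "H \<ge> 0" unfolding H_def by (intro add_nonneg_nonneg sum_nonneg) auto
  \<comment> \<open>Large enough for \<open>H * r + 1 \<le> \<epsilon> * k\<close>, once the
    arithmetic-geometric mean inequality has split \<open>H * sqrt (k * U)\<close> into
    \<open>\<epsilon> / 2 * k\<close> and a constant.\<close>
  define k where "k = max (max 1 n0) (nat \<lceil>2 / \<epsilon> * (H\<^sup>2 * U / (2 * \<epsilon>) + H + 1)\<rceil>)"
  have k: "k \<ge> 1" "k \<ge> n0" by (auto simp: k_def)
  have "2 / \<epsilon> * (H\<^sup>2 * U / (2 * \<epsilon>) + H + 1) \<le> real k" unfolding k_def by linarith
  then have k_large: "H\<^sup>2 * U / (2 * \<epsilon>) + H + 1 \<le> \<epsilon> / 2 * real k" using \<epsilon> by (simp add: field_simps)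
  obtain r v F1 where r: "real r \<le> sqrt (real k * U) + 1" and v: "\<And>i. i < d \<Longrightarrow> \<bar>v i\<bar> \<le> int r"
    and F1: "level (k * n) F1" "\<And>w i. w \<in> F1 \<Longrightarrow> i < d \<Longrightarrow> f w i = v i"
    and F1_sum: "exp (- dot t v) / (2 * (2 * real r + 1) ^ d) \<le> (\<Sum>w\<in>F1. \<mu> w)"
    using conc[OF k(1)] by blast
  define j where "j = (\<Sum>i<d. nat \<bar>v i\<bar>)"
  have unit': "\<exists>w\<in>Lp. length w = l \<and> c \<le> \<mu> w \<and> unit_step i \<sigma> w"
    if "i < d" "\<sigma> \<in> {1, -1}" for i \<sigma>
    using unit[OF that] F0 by (auto simp: level_def)
  obtain F2 where F2: "level (k * n + j * l) F2" "\<forall>w\<in>F2. \<forall>i<d. f w i = 0"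
    "c ^ j * (\<Sum>w\<in>F1. \<mu> w) \<le> (\<Sum>w\<in>F2. \<mu> w)"
    using return_level[OF unit' c(1) F1(1,2) j_def[symmetric]] by blast
  have j: "j \<le> d * r"
  proof -
    have "j \<le> (\<Sum>i<d. r)" unfolding j_def using v by (intro sum_mono) force
    then show ?thesis by simp
  qed
  have "exp (- (H * real r + 1)) \<le> exp (real (d * r) * ln c) * (exp (- (\<Sum>i<d. \<bar>t i\<bar>) * real r) / (exp 1 * exp (2 * real r) ^ d))"
    by (simp add: H_def exp_add exp_minus exp_diff field_simps flip: exp_of_nat_mult)
  also have "\<dots> \<le> c ^ j * (exp (- dot t v) / (2 * (2 * real r + 1) ^ d))"
  proof (rule mult_mono[OF _ frac_le])
    have "exp (real (d * r) * ln c) = c ^ (d * r)" using c by (simp only: exp_of_nat_mult exp_ln)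
    also have "\<dots> \<le> c ^ j" using j c by (intro power_decreasing) auto
    finally show "exp (real (d * r) * ln c) \<le> c ^ j" .
    have "dot t v \<le> (\<Sum>i<d. \<bar>t i\<bar> * real r)"
    proof (rule sum_mono)
      fix i assume "i \<in> {..<d}"
      then have "\<bar>real_of_int (v i)\<bar> \<le> real r" using v[of i] by simp
      then have "\<bar>t i\<bar> * \<bar>real_of_int (v i)\<bar> \<le> \<bar>t i\<bar> * real r" by (intro mult_left_mono) auto
      then show "t i * real_of_int (v i) \<le> \<bar>t i\<bar> * real r" by (metis abs_ge_self abs_mult order_trans)
    qed
    then show "exp (- (\<Sum>i<d. \<bar>t i\<bar>) * real r) \<le> exp (- dot t v)"
      by (simp add: sum_distrib_right)
    have "2 * real r + 1 \<le> exp (2 * real r)" using exp_ge_add_one_self[of "2 * real r"] by linarith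
    moreover have "(2::real) \<le> exp 1" using exp_ge_add_one_self[of 1] by simp
    ultimately show "2 * (2 * real r + 1) ^ d \<le> exp 1 * exp (2 * real r) ^ d"
      by (intro mult_mono power_mono) auto
  qed (use c in \<open>auto intro!: mult_pos_pos zero_less_power add_nonneg_pos\<close>)
  also have "\<dots> \<le> c ^ j * (\<Sum>w\<in>F1. \<mu> w)" using F1_sum c by (intro mult_left_mono) auto
  also note F2(3)
  finally have main: "exp (- (H * real r + 1)) \<le> (\<Sum>w\<in>F2. \<mu> w)" .
  have "k * 1 \<le> k * n" using n by (intro mult_le_mono) auto
  then have k_le: "k \<le> k * n + j * l" by linarith
  have "H * real r + 1 \<le> \<epsilon> * real k"
  proof -
    have "2 * (sqrt (\<epsilon> * real k)) * (H * sqrt (U / \<epsilon>)) \<le> (sqrt (\<epsilon> * real k))\<^sup>2 + (H * sqrt (U / \<epsilon>))\<^sup>2"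
      by (rule sum_squares_bound)
    also have "\<dots> = \<epsilon> * real k + H\<^sup>2 * U / \<epsilon>" using U \<epsilon> by (simp add: power_mult_distrib)
    also have "2 * (sqrt (\<epsilon> * real k)) * (H * sqrt (U / \<epsilon>)) = 2 * (H * sqrt (real k * U))"
      using \<epsilon> by (simp add: real_sqrt_mult real_sqrt_divide)
    finally have "2 * (H * sqrt (real k * U)) \<le> \<epsilon> * real k + H\<^sup>2 * U / \<epsilon>" .
    then have "H * sqrt (real k * U) \<le> (\<epsilon> * real k + H\<^sup>2 * U / \<epsilon>) / 2"
      by (subst pos_le_divide_eq) (simp_all only: mult.commute zero_less_numeral)
    also have "\<dots> = \<epsilon> / 2 * real k + H\<^sup>2 * U / (2 * \<epsilon>)" using \<epsilon> by (simp add: field_simps)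
    finally have "H * sqrt (real k * U) \<le> \<epsilon> / 2 * real k + H\<^sup>2 * U / (2 * \<epsilon>)" .
    moreover have "H * real r \<le> H * (sqrt (real k * U) + 1)" using r H by (rule mult_left_mono)
    ultimately show ?thesis using k_large by (simp add: algebra_simps)
  qed
  also have "\<epsilon> * real k \<le> \<epsilon> * real (k * n + j * l)"
    using \<epsilon> k_le by (intro mult_left_mono) linarith+
  finally have "exp (- \<epsilon> * real (k * n + j * l)) \<le> exp (- (H * real r + 1))" by simp
  then have "exp (- \<epsilon> * real (k * n + j * l)) \<le> (\<Sum>w\<in>F2. \<mu> w)" using main by (rule order_trans)
  moreover have "n0 \<le> k * n + j * l" using k k_le by linarith
  ultimately show ?thesis using F2 by blast
qed

end

section \<open>The free abelianization\<close>

lemma (in comm_group) torsion_subgroup: "subgroup (torsion G) G"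
proof (rule subgroupI)
  show "torsion G \<subseteq> carrier G" by (auto simp: torsion_def)
  have "\<one> \<in> torsion G" by (auto simp: torsion_def intro!: exI[of _ 1])
  then show "torsion G \<noteq> {}" by blast
next
  fix x assume "x \<in> torsion G"
  then show "inv x \<in> torsion G" by (auto simp: torsion_def nat_pow_inv)
next
  fix x y assume "x \<in> torsion G" "y \<in> torsion G"
  then obtain m n :: nat where *: "x \<in> carrier G" "y \<in> carrier G" "m > 0" "n > 0" "x [^] m = \<one>" "y [^] n = \<one>"
    by (auto simp: torsion_def)
  have "x [^] (m * n) = \<one>" using * by (simp flip: nat_pow_pow)
  moreover have "y [^] (m * n) = \<one>" using * by (subst mult.commute) (simp flip: nat_pow_pow)
  ultimately have "(x \<otimes> y) [^] (m * n) = \<one>" using * by (simp add: nat_pow_distrib)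
  then show "x \<otimes> y \<in> torsion G" using * by (auto simp: torsion_def intro!: exI[of _ "m * n"])
qed

lemma (in group) free_abelianization_proj_hom:
  "free_abelianization_proj G \<in> hom G (free_abelianization G)"
  "free_abelianization_proj G ` carrier G = carrier (free_abelianization G)"
proof -
  let ?A = "abelianization G"
  interpret N: normal "derived G (carrier G)" G by (rule derived_self_is_normal)
  interpret A: comm_group ?A unfolding abelianization_def by (rule derived_quot_is_comm_group)
  interpret T: normal "torsion ?A" ?A
    using A.torsion_subgroup A.normal_iff_subgroup by blast
  have 1: "(\<lambda>g. derived G (carrier G) #> g) \<in> hom G ?A"
    unfolding abelianization_def by (rule N.r_coset_hom_Mod)
  have 2: "(\<lambda>g. torsion ?A #>\<^bsub>?A\<^esub> g) \<in> hom ?A (free_abelianization G)"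
    unfolding free_abelianization_def by (rule T.r_coset_hom_Mod)
  have comp: "free_abelianization_proj G = (\<lambda>g. torsion ?A #>\<^bsub>?A\<^esub> g) \<circ> (\<lambda>g. derived G (carrier G) #> g)"
    by (auto simp: free_abelianization_proj_def)
  show "free_abelianization_proj G \<in> hom G (free_abelianization G)"
    unfolding comp by (rule Group.hom_compose[OF 1 2])
  have "(\<lambda>g. derived G (carrier G) #> g) ` carrier G = carrier ?A"
    by (auto simp: abelianization_def FactGroup_def RCOSETS_def)
  moreover have "(\<lambda>g. torsion ?A #>\<^bsub>?A\<^esub> g) ` carrier ?A = carrier (free_abelianization G)"
    by (auto simp: free_abelianization_def FactGroup_def RCOSETS_def)
  ultimately show "free_abelianization_proj G ` carrier G = carrier (free_abelianization G)"
    unfolding comp by (simp only: image_comp[symmetric])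
qed

lemma lattice_cocycle_component:
  "i < d \<Longrightarrow> cocycle (int_lattice d) f n x i = (\<Sum>j<n. f ((shift ^^ j) x 0) i)"
  by (induction n) (simp_all add: integer_group_def)

text \<open>Elements of \<open>int_lattice d\<close> are undefined from index \<open>d\<close> on,
  so equality with the identity is a condition on the indices below \<open>d\<close> only.\<close>

lemma lattice_cocycle_eq_one_iff:
  "cocycle (int_lattice d) f n x = \<one>\<^bsub>int_lattice d\<^esub> \<longleftrightarrow> (\<forall>i<d. (\<Sum>j<n. f ((shift ^^ j) x 0) i) = 0)"
proof -
  have "cocycle (int_lattice d) f n x \<in> extensional {..<d}"
    by (cases n) simp_all
  then have "cocycle (int_lattice d) f n x = \<one>\<^bsub>int_lattice d\<^esub> \<longleftrightarrow>
      (\<forall>i<d. cocycle (int_lattice d) f n x i = 0)"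
    by (auto simp: fun_eq_iff extensional_def integer_group_def)
  then show ?thesis by (simp add: lattice_cocycle_component)
qed

lemma cocycle_hom:
  assumes "group G" "group H" "h \<in> hom G H" "\<psi> \<in> S \<rightarrow> carrier G" "x \<in> markov_shift S A"
  shows "cocycle H (\<lambda>s. h (\<psi> s)) n x = h (cocycle G \<psi> n x) \<and> cocycle G \<psi> n x \<in> carrier G"
proof -
  interpret group_hom G H h using assms by (simp add: group_hom_def group_hom_axioms_def)
  have "\<psi> ((shift ^^ n) x 0) \<in> carrier G" for n
    using assms(4,5) by (auto simp: funpow_shift suffix_def markov_shift_def)
  then show ?thesis by (induction n) auto
qed

section \<open>Tilted potentials\<close>

definition tilt :: "nat \<Rightarrow> ('s \<Rightarrow> nat \<Rightarrow> int) \<Rightarrow> ((nat \<Rightarrow> 's) \<Rightarrow> real) \<Rightarrow> (nat \<Rightarrow> real) \<Rightarrow> (nat \<Rightarrow> 's) \<Rightarrow> real" where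
  "tilt d f \<phi> t x = \<phi> x + (\<Sum>i<d. t i * real_of_int (f (x 0) i))"

lemma birkhoff_sum_tilt:
  "birkhoff_sum (tilt d f \<phi> t) n x =
     birkhoff_sum \<phi> n x + (\<Sum>i<d. t i * real_of_int (\<Sum>j<n. f ((shift ^^ j) x 0) i))"
  unfolding birkhoff_sum_def tilt_def sum.distrib of_int_sum sum_distrib_left
  by (subst sum.swap) simp

lemma eventually_le_of_exp_growth_less:
  assumes "exp_growth Z < ereal s"
  shows "\<forall>\<^sub>F n in sequentially. Z n \<le> ennreal (exp (s * real n))"
proof -
  have "\<forall>\<^sub>F n in sequentially. ereal (1 / real n) * ln_ennreal (Z n) < ereal s"
    using assms unfolding exp_growth_def by (rule Limsup_lessD)
  then show ?thesis using eventually_gt_at_top[of 0]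
  proof eventually_elim
    case (elim n)
    show ?case
    proof (rule ccontr)
      assume "\<not> ?case"
      then have "ln_ennreal (ennreal (exp (s * real n))) \<le> ln_ennreal (Z n)" by (intro ln_ennreal_mono) simp
      then have "ereal (1 / real n) * ereal (s * real n) \<le> ereal (1 / real n) * ln_ennreal (Z n)"
        by (intro ereal_mult_left_mono) auto
      then show False using elim by simp
    qed
  qed
qed

lemma exp_growth_add_le:
  assumes "\<forall>\<^sub>F n in sequentially. Z n \<le> Z1 n + Z2 n"
  shows "exp_growth Z \<le> max (exp_growth Z1) (exp_growth Z2)"
proof (rule ereal_le_real)
  fix s assume s: "max (exp_growth Z1) (exp_growth Z2) \<le> ereal s"
  show "exp_growth Z \<le> ereal s"
  proof (rule ereal_le_epsilon2)
    fix e :: real assume e: "0 < e"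
    have "exp_growth Z1 < ereal (s + e)" "exp_growth Z2 < ereal (s + e)"
      using s e by (auto intro: le_less_trans)
    from this[THEN eventually_le_of_exp_growth_less]
    have "\<forall>\<^sub>F n in sequentially. Z n \<le> ennreal (2 * exp ((s + e) * real n))"
      using assms
    proof eventually_elim
      case (elim n)
      have "Z n \<le> ennreal (exp ((s + e) * real n)) + ennreal (exp ((s + e) * real n))"
        using elim by (meson add_mono order_trans)
      then show ?case by (simp flip: ennreal_plus)
    qed
    then have "exp_growth Z \<le> ereal (s + e)" by (intro exp_growth_le[of 2]) auto
    then show "exp_growth Z \<le> ereal s + ereal e" by simp
  qed
qed

lemma exp_convex_le:
  fixes x y e :: real
  assumes "0 \<le> e" "e \<le> 1"
  shows "exp ((1 - e) * x + e * y) \<le> exp x + exp y"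
proof -
  have "(1 - e) * x + e * y \<le> (1 - e) * max x y + e * max x y"
    using assms by (intro add_mono mult_left_mono) auto
  also have "\<dots> = max x y" by (simp add: algebra_simps)
  finally have "exp ((1 - e) * x + e * y) \<le> exp (max x y)" by simp
  also have "\<dots> \<le> exp x + exp y" by (simp add: max_def)
  finally show ?thesis .
qed

text \<open>Termwise, the exponential of a convex combination is at most the sum of the two
  exponentials, and the growth rate of a sum is the larger of the two. This covers infinite
  pressures as well, which may occur outside the ball.\<close>

lemma pressure_tilt_quasiconvex:
  assumes "0 \<le> e" "e \<le> 1"
  shows "pressure S A a (tilt d f \<phi> (\<lambda>i. (1 - e) * t i + e * u i)) \<le>
    max (pressure S A a (tilt d f \<phi> t)) (pressure S A a (tilt d f \<phi> u))"
  unfolding pressure_def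
proof (rule exp_growth_add_le, rule always_eventually, rule allI)
  fix n
  let ?w = "tilt d f \<phi> (\<lambda>i. (1 - e) * t i + e * u i)" and ?t = "tilt d f \<phi> t" and ?u = "tilt d f \<phi> u"
  let ?X = "{x \<in> markov_shift S A. (shift ^^ n) x = x \<and> x 0 = a}"
  have le: "ennreal (exp (birkhoff_sum ?w n x)) \<le>
      ennreal (exp (birkhoff_sum ?t n x)) + ennreal (exp (birkhoff_sum ?u n x))" for x
  proof -
    have "birkhoff_sum ?w n x =
        (1 - e) * birkhoff_sum ?t n x + e * birkhoff_sum ?u n x"
      unfolding birkhoff_sum_tilt distrib_left sum_distrib_left
      by (simp add: sum.distrib[symmetric] algebra_simps)
    then have "exp (birkhoff_sum ?w n x) \<le>
        exp (birkhoff_sum ?t n x) + exp (birkhoff_sum ?u n x)"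
      using exp_convex_le[OF assms] by simp
    then show ?thesis by (simp flip: ennreal_plus add: ennreal_leI)
  qed
  have "partition_sum S A a ?w n \<le>
      (\<Sum>\<^sub>\<infinity>x\<in>?X. ennreal (exp (birkhoff_sum ?t n x)) + ennreal (exp (birkhoff_sum ?u n x)))"
    using le by (intro infsum_mono nonneg_summable_on_complete) auto
  also have "\<dots> = partition_sum S A a ?t n +
      partition_sum S A a ?u n"
    by (intro infsum_add nonneg_summable_on_complete) auto
  finally show "partition_sum S A a ?w n \<le> \<dots>" .
qed

lemma L2_set_convex_comb_le:
  "L2_set (\<lambda>i. (1 - e) * t i + e * u i) I \<le> \<bar>1 - e\<bar> * L2_set t I + \<bar>e\<bar> * L2_set u I"
proof -
  have scale: "L2_set (\<lambda>i. c * t i) I = \<bar>c\<bar> * L2_set t I" for c t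
    by (simp add: L2_set_def power_mult_distrib real_sqrt_mult flip: sum_distrib_left)
  show ?thesis
    using L2_set_triangle_ineq[of "\<lambda>i. (1 - e) * t i" "\<lambda>i. e * u i" I] by (simp add: scale)
qed

text \<open>A strict local minimum of a quasi-convex function is a global minimum.\<close>

lemma pressure_tilt_ge:
  assumes \<xi>: "\<xi> \<in> delta_ball d \<delta>"
    and min: "\<forall>w \<in> delta_ball d \<delta> - {\<xi>}. tilted_pressure S A d a \<phi> f \<xi> < tilted_pressure S A d a \<phi> f w"
  shows "pressure S A a (tilt d f \<phi> \<xi>) \<le> pressure S A a (tilt d f \<phi> t)"
proof -
  \<comment> \<open>Points of the ball vanish from index \<open>d\<close> on, so \<open>t\<close> is
    cut off there; the tilted potential does not change.\<close>
  define u where "u i = (if i < d then t i else 0)" for i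
  have u: "tilt d f \<phi> u = tilt d f \<phi> t" by (auto simp: tilt_def u_def fun_eq_iff)
  have tp: "tilted_pressure S A d a \<phi> f w = pressure S A a (tilt d f \<phi> w)" for w
    by (simp add: tilted_pressure_def tilt_def[abs_def])
  show ?thesis
  proof (cases "u = \<xi>")
    case True
    then show ?thesis using u by simp
  next
    case False
    have lt: "ereal (L2_set \<xi> {..<d}) < \<delta>" using \<xi> by (simp add: delta_ball_def)
    then obtain r where r: "L2_set \<xi> {..<d} < r" "ereal r < \<delta>"
      using ereal_dense2 by (metis less_ereal.simps(1))
    \<comment> \<open>Small enough that the point at fraction \<open>e\<close> of the segment from
      \<xi> to \<open>u\<close> stays within radius \<open>r\<close>; the 1 in the denominator
      avoids division by 0.\<close>
    define e where "e = min 1 ((r - L2_set \<xi> {..<d}) / (L2_set u {..<d} + 1))"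
    have pos: "L2_set u {..<d} + 1 > 0" by (simp add: add_nonneg_pos)
    have e: "0 < e" "e \<le> 1" using r pos by (auto simp: e_def)
    define w where "w i = (1 - e) * \<xi> i + e * u i" for i
    have "L2_set w {..<d} \<le> (1 - e) * L2_set \<xi> {..<d} + e * L2_set u {..<d}"
      using L2_set_convex_comb_le[of e \<xi> u "{..<d}"] e by (simp add: w_def[abs_def])
    also have "(1 - e) * L2_set \<xi> {..<d} \<le> 1 * L2_set \<xi> {..<d}" using e by (intro mult_right_mono) auto
    also have "e * L2_set u {..<d} \<le> e * (L2_set u {..<d} + 1)" using e by simp
    also have "\<dots> \<le> r - L2_set \<xi> {..<d}"
    proof -
      have "e \<le> (r - L2_set \<xi> {..<d}) / (L2_set u {..<d} + 1)" by (simp add: e_def)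
      then show ?thesis using pos by (simp add: pos_le_divide_eq)
    qed
    finally have "L2_set w {..<d} \<le> r" by simp
    then have "ereal (L2_set w {..<d}) < \<delta>" using r(2) by (simp add: le_less_trans[of _ "ereal r"])
    moreover have "w \<in> topspace (Euclidean_space d)"
      using \<xi> by (auto simp: delta_ball_def topspace_Euclidean_space w_def u_def)
    ultimately have "w \<in> delta_ball d \<delta>" by (simp add: delta_ball_def)
    moreover have "w \<noteq> \<xi>"
    proof
      assume "w = \<xi>"
      have "e * (u i - \<xi> i) = 0" for i
      proof -
        have "(1 - e) * \<xi> i + e * u i = \<xi> i" using fun_cong[OF \<open>w = \<xi>\<close>, of i] by (simp only: w_def)
        then show ?thesis by (simp add: left_diff_distrib right_diff_distrib)
      qed
      then show False using False e by (auto simp: fun_eq_iff)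
    qed
    ultimately have "pressure S A a (tilt d f \<phi> \<xi>) < pressure S A a (tilt d f \<phi> w)"
      using min by (auto simp: tp)
    \<comment> \<open>The strict inequality rules out \<xi> as the term attaining the maximum, so
      \<open>u\<close> attains it.\<close>
    also have "\<dots> \<le> max (pressure S A a (tilt d f \<phi> \<xi>)) (pressure S A a (tilt d f \<phi> u))"
      using pressure_tilt_quasiconvex[of e S A a d f \<phi> \<xi> u] e by (simp add: w_def[abs_def])
    finally show ?thesis unfolding u by (auto simp: less_max_iff_disj)
  qed
qed

section \<open>The pressure of the lattice extension\<close>

text \<open>For \<open>s\<close> below \<open>P\<close> every tilted partition sum exceeds any fixed
  multiple of \<open>exp (s * n)\<close> for arbitrarily large \<open>n\<close>. After normalising
  by the rate \<open>s\<close>, some finite set of loops thus has generating function above 1 at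
  each given \<open>t\<close>, and \<open>subexponential_return\<close> yields loops with
  displacement 0 whose growth rate is arbitrarily close to \<open>s\<close>.\<close>

lemma (in hoelder_shift) lattice_pressure_ge:
  assumes min: "\<And>t. P \<le> pressure S A a (tilt d f \<phi> t)"
    and l: "l > 0"
    and unit: "\<And>i \<sigma>. i < d \<Longrightarrow> \<sigma> \<in> {1, -1::int} \<Longrightarrow> \<exists>w\<in>loops S A a. length w = l \<and>
      (\<forall>j<d. sum_list (map (\<lambda>s. f s j) w) = (if j = i then \<sigma> else 0))"
  shows "P \<le> skew_pressure (int_lattice d) S A f a \<phi>"
proof (rule dense_le)
  fix P' assume "P' < P"
  then obtain s where s: "P' < ereal s" "ereal s < P" using ereal_dense2 by blast
  \<comment> \<open>The factor \<open>exp (- (2 * D))\<close> turns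
    \<open>weight_loops_append\<close> into supermultiplicativity, and the last factor removes
    exponential growth at rate \<open>s\<close>.\<close>
  define \<mu> where "\<mu> w = exp (- (2 * D)) * (weight w (w\<^sup>\<omega>) * exp (- s * real (length w)))" for w
  define F where "F w i = sum_list (map (\<lambda>s. f s i) w)" for w :: "'s list" and i
  interpret graded_loops "loops S A a" \<mu> F d l
  proof
    show "u @ v \<in> loops S A a" if "u \<in> loops S A a" "v \<in> loops S A a" for u v
      using that by (rule loops_append)
    show "\<mu> w > 0" for w by (simp add: \<mu>_def)
    show "\<mu> u * \<mu> v \<le> \<mu> (u @ v)" if "u \<in> loops S A a" "v \<in> loops S A a" for u v
    proof -
      let ?e = "exp (- (2 * D)) * exp (- (2 * D)) * exp (- s * real (length (u @ v)))"
      have "\<mu> u * \<mu> v = ?e * (weight u (u\<^sup>\<omega>) * weight v (v\<^sup>\<omega>))"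
      proof -
        have "exp (- s * real (length (u @ v))) = exp (- s * real (length u)) * exp (- s * real (length v))"
          by (simp add: algebra_simps flip: exp_add)
        then show ?thesis unfolding \<mu>_def by (simp only: mult_ac)
      qed
      also have "\<dots> \<le> ?e * (exp (2 * D) * weight (u @ v) ((u @ v)\<^sup>\<omega>))"
        by (intro mult_left_mono weight_loops_append[OF that]) auto
      also have "\<dots> = \<mu> (u @ v)" by (simp add: \<mu>_def exp_minus field_simps)
      finally show ?thesis .
    qed
  qed (use l unit in \<open>auto simp: F_def\<close>)
  have F_eq: "(\<Sum>j<length w. f ((shift ^^ j) (w\<^sup>\<omega>) 0) i) = F w i" if "w \<noteq> []" for w i
  proof -
    have "(\<Sum>j<length w. f ((shift ^^ j) (w\<^sup>\<omega>) 0) i) = (\<Sum>j<length w. f (w ! j) i)"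
      using that by (intro sum.cong) (auto simp: funpow_shift suffix_def iter_def)
    then show ?thesis by (simp add: F_def sum_list_sum_nth atLeast0LessThan)
  qed
  have loopD: "w \<noteq> []" if "w \<in> loops S A a" for w using that by (simp add: loops_def)
  have big: "\<exists>n Y. n > 0 \<and> level n Y \<and> 1 < q Y t" for t
  proof -
    have "ereal s < pressure S A a (tilt d f \<phi> t)" using s(2) min[of t] by (rule less_le_trans)
    \<comment> \<open>The prefactor \<open>exp (2 * D)\<close> makes up for the factor
      \<open>exp (- (2 * D))\<close> in \<mu>.\<close>
    from frequently_eventually_conj[OF less_exp_growthD[OF this[unfolded pressure_def], of "exp (2 * D)"] eventually_gt_at_top[of 0]]
    obtain n where n: "n > 0" "ennreal (exp (2 * D) * exp (s * real n)) <
      (partition_sum S A a (tilt d f \<phi> t) n)"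
      by (auto dest!: frequently_ex)
    let ?e = "\<lambda>w. exp (birkhoff_sum (tilt d f \<phi> t) n (w\<^sup>\<omega>))"
    have "(partition_sum S A a (tilt d f \<phi> t) n) =
      (\<Sum>\<^sub>\<infinity>w\<in>{w \<in> loops S A a. length w = n}. ennreal (?e w))"
      using periodic_sum_eq[where P = "\<lambda>_. True" and n = n and S = S and A = A and a = a] n by simp
    then obtain Y where Y: "finite Y" "Y \<subseteq> {w \<in> loops S A a. length w = n}"
      "ennreal (exp (2 * D) * exp (s * real n)) < (\<Sum>w\<in>Y. ennreal (?e w))"
      using n(2) by (auto simp: less_infsum_ennreal_iff)
    then have sum_gt: "exp (2 * D) * exp (s * real n) < (\<Sum>w\<in>Y. ?e w)"
      by (simp add: ennreal_less_iff)
    have "q Y t = exp (- (2 * D)) * exp (- s * real n) * (\<Sum>w\<in>Y. ?e w)"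
      unfolding q_def sum_distrib_left
    proof (rule sum.cong[OF refl])
      fix w assume "w \<in> Y"
      then have w: "w \<in> loops S A a" "length w = n" using Y by auto
      have "?e w = weight w (w\<^sup>\<omega>) * exp (\<Sum>i<d. t i * real_of_int (F w i))"
        using w(2) F_eq[OF loopD[OF w(1)]] by (simp add: birkhoff_sum_tilt weight_iter[OF loopD[OF w(1)]] exp_add)
      then show "\<mu> w * exp (\<Sum>i<d. t i * real_of_int (F w i)) =
          exp (- (2 * D)) * exp (- s * real n) * ?e w"
        using w(2) by (simp add: \<mu>_def)
    qed
    also have "\<dots> > exp (- (2 * D)) * exp (- s * real n) * (exp (2 * D) * exp (s * real n))"
      using sum_gt by (intro mult_strict_left_mono) auto
    also have "exp (- (2 * D)) * exp (- s * real n) * (exp (2 * D) * exp (s * real n)) = 1"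
      by (simp flip: exp_add)
    finally show ?thesis using n(1) Y by (intro exI[of _ n] exI[of _ Y]) (auto simp: level_def)
  qed
  have "ereal s \<le> skew_pressure (int_lattice d) S A f a \<phi>"
    unfolding skew_pressure_def
  proof (rule exp_growth_ge)
    fix s' assume s': "s' < s"
    show "\<exists>\<^sub>F n in sequentially. ennreal (exp (s' * real n)) \<le>
      (skew_partition_sum (int_lattice d) S A f a \<phi> n)"
      unfolding frequently_sequentially
    proof
      fix N
      \<comment> \<open>Asking for \<open>Suc N\<close> keeps the length positive, as
        \<open>periodic_sum_eq\<close> demands.\<close>
      obtain n Y where n: "n \<ge> Suc N" and Y: "level n Y" "\<forall>w\<in>Y. \<forall>i<d. F w i = 0"
        and sum_ge: "exp (- (s - s') * real n) \<le> (\<Sum>w\<in>Y. \<mu> w)"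
        using subexponential_return[OF big, of "s - s'" "Suc N"] s' by auto
      let ?L = "{w \<in> loops S A a. length w = n \<and> cocycle (int_lattice d) f n (w\<^sup>\<omega>) = \<one>\<^bsub>int_lattice d\<^esub>}"
      have YL: "finite Y" "Y \<subseteq> ?L"
      proof -
        show "finite Y" using Y by (simp add: level_def)
        show "Y \<subseteq> ?L"
        proof
          fix w assume w: "w \<in> Y"
          then have wL: "w \<in> loops S A a" "length w = n" using Y by (auto simp: level_def)
          have "(\<Sum>j<n. f ((shift ^^ j) (w\<^sup>\<omega>) 0) i) = 0" if "i < d" for i
            using F_eq[OF loopD[OF wL(1)], of i] wL(2) Y(2) w that by simp
          then show "w \<in> ?L" using wL by (simp add: lattice_cocycle_eq_one_iff del: one_product_group)
        qed
      qed
      have "exp (s' * real n) = exp (s * real n) * exp (- (s - s') * real n)"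
        by (simp add: algebra_simps flip: exp_add)
      also have "\<dots> \<le> exp (s * real n) * (\<Sum>w\<in>Y. \<mu> w)" using sum_ge by (intro mult_left_mono) auto
      also have "\<dots> = (\<Sum>w\<in>Y. exp (- (2 * D)) * exp (birkhoff_sum \<phi> n (w\<^sup>\<omega>)))"
        unfolding sum_distrib_left
      proof (rule sum.cong[OF refl])
        fix w assume "w \<in> Y"
        then have w: "length w = n" "w \<noteq> []" using YL loopD by auto
        show "exp (s * real n) * \<mu> w = exp (- (2 * D)) * exp (birkhoff_sum \<phi> n (w\<^sup>\<omega>))"
          using w by (simp add: \<mu>_def weight_iter exp_minus)
      qed
      also have "\<dots> \<le> (\<Sum>w\<in>Y. exp (birkhoff_sum \<phi> n (w\<^sup>\<omega>)))"
        using D_pos by (intro sum_mono mult_left_le_one_le) auto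
      finally have "ennreal (exp (s' * real n)) \<le> (\<Sum>w\<in>Y. ennreal (exp (birkhoff_sum \<phi> n (w\<^sup>\<omega>))))"
        by (simp add: ennreal_leI)
      also have "\<dots> \<le> (\<Sum>\<^sub>\<infinity>w\<in>?L. ennreal (exp (birkhoff_sum \<phi> n (w\<^sup>\<omega>))))"
        by (rule infsum_ennreal_le_iff[THEN iffD1, OF order_refl, rule_format]) (use YL in auto)
      also have "\<dots> = (skew_partition_sum (int_lattice d) S A f a \<phi> n)"
        using n by (subst periodic_sum_eq) auto
      finally show "\<exists>n\<ge>N. ennreal (exp (s' * real n)) \<le>
        (skew_partition_sum (int_lattice d) S A f a \<phi> n)"
        using n by (intro exI[of _ n] conjI) auto
    qed
  qed
  then show "P' \<le> skew_pressure (int_lattice d) S A f a \<phi>" using s(1) by (simp add: less_imp_le order_trans)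
qed

text \<open>The added term is constant on every cylinder of length at least 1, so it cancels in the
  Hoelder estimate.\<close>

lemma hoelder_shift_tilt:
  assumes "hoelder_shift S A \<phi> C \<theta>"
  shows "hoelder_shift S A (tilt d f \<phi> t) C \<theta>"
proof -
  interpret hoelder_shift S A \<phi> C \<theta> by fact
  show ?thesis
  proof
    fix n w x y assume *: "1 \<le> n" "w \<in> words S A n" "x \<in> cylinder S A w" "y \<in> cylinder S A w"
    then have "x 0 = y 0" by (simp add: cylinder_def words_def)
    then have "tilt d f \<phi> t x - tilt d f \<phi> t y = \<phi> x - \<phi> y" by (simp add: tilt_def)
    then show "\<bar>tilt d f \<phi> t x - tilt d f \<phi> t y\<bar> \<le> C * \<theta> ^ n" using hoelder[OF *] by simp
  qed (fact C_pos \<theta>_pos \<theta>_less)+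
qed

text \<open>As \<open>delta\<close> is a supremum, some \<open>r\<close> above the norm of \<xi>
  makes the potential \<open>\<phi> + r * |f|\<close> summable, and by Cauchy-Schwarz it dominates
  the tilted one. The bound is stated for finite sets of states, as the alphabets require.\<close>

lemma summable_tilt:
  fixes S :: "'s set"
  assumes "ereal (L2_set \<xi> {..<d}) < delta S A d \<phi> f"
  obtains M where "M > 0" "\<And>x T. x \<in> markov_shift S A \<Longrightarrow> finite T \<Longrightarrow>
    (\<Sum>s | s \<in> T \<and> [s] \<frown> x \<in> markov_shift S A. exp (tilt d f \<phi> \<xi> ([s] \<frown> x))) \<le> M"
proof -
  obtain r where r: "L2_set \<xi> {..<d} < r"
    "summable_potential S A (\<lambda>x. \<phi> x + r * L2_set (\<lambda>i. real_of_int (f (x 0) i)) {..<d})"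
    using assms unfolding delta_def by (auto simp: less_SUP_iff)
  define \<eta> where "\<eta> x = \<phi> x + r * L2_set (\<lambda>i. real_of_int (f (x 0) i)) {..<d}" for x
  have le: "tilt d f \<phi> \<xi> x \<le> \<eta> x" for x
  proof -
    have "(\<Sum>i<d. \<xi> i * real_of_int (f (x 0) i)) \<le> (\<Sum>i<d. \<bar>\<xi> i\<bar> * \<bar>real_of_int (f (x 0) i)\<bar>)"
      by (intro sum_mono) (simp flip: abs_mult)
    also have "\<dots> \<le> L2_set \<xi> {..<d} * L2_set (\<lambda>i. real_of_int (f (x 0) i)) {..<d}"
      by (rule L2_set_mult_ineq)
    also have "\<dots> \<le> r * L2_set (\<lambda>i. real_of_int (f (x 0) i)) {..<d}"
      using r(1) by (intro mult_right_mono) auto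
    finally show ?thesis by (simp add: tilt_def \<eta>_def)
  qed
  define P where "P x = (\<Sum>\<^sub>\<infinity>y\<in>{y \<in> markov_shift S A. shift y = x}. ennreal (exp (\<eta> y)))" for x
  define Q where "Q = (SUP x\<in>markov_shift S A. P x)"
  have Q: "Q < \<infinity>" using r(2) by (simp add: summable_potential_def Q_def P_def \<eta>_def)
  show thesis
  proof (rule that[of "enn2real Q + 1"])
    show "enn2real Q + 1 > 0" by (simp add: add_nonneg_pos)
    fix x and T :: "'s set" assume x: "x \<in> markov_shift S A" and T: "finite T"
    define T' where "T' = {s \<in> T. [s] \<frown> x \<in> markov_shift S A}"
    have T': "finite T'" using T by (simp add: T'_def)
    have inj: "inj_on (\<lambda>s. [s] \<frown> x) T'"
      by (rule inj_on_inverseI[where g = "\<lambda>y. y 0"]) (simp add: conc_def)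
    have sh: "shift ([s] \<frown> x) = x" for s by (simp add: shift_def conc_def)
    have "(\<Sum>s\<in>T'. ennreal (exp (\<eta> ([s] \<frown> x)))) = (\<Sum>y\<in>(\<lambda>s. [s] \<frown> x) ` T'. ennreal (exp (\<eta> y)))"
      by (subst sum.reindex[OF inj]) (simp only: o_def)
    also have "\<dots> \<le> P x"
      unfolding P_def
      by (rule infsum_ennreal_le_iff[THEN iffD1, OF order_refl, rule_format]) (use T' sh in \<open>auto simp: T'_def\<close>)
    also have "P x \<le> Q" unfolding Q_def using x by (rule SUP_upper)
    also have "Q = ennreal (enn2real Q)" using Q by simp
    finally have "(\<Sum>s\<in>T'. exp (\<eta> ([s] \<frown> x))) \<le> enn2real Q" by (simp add: sum_nonneg)
    moreover have "(\<Sum>s\<in>T'. exp (tilt d f \<phi> \<xi> ([s] \<frown> x))) \<le> (\<Sum>s\<in>T'. exp (\<eta> ([s] \<frown> x)))"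
      using le by (intro sum_mono) simp
    ultimately show "(\<Sum>s | s \<in> T \<and> [s] \<frown> x \<in> markov_shift S A. exp (tilt d f \<phi> \<xi> ([s] \<frown> x))) \<le> enn2real Q + 1"
      by (simp add: T'_def)
  qed
qed

lemma lattice_hom_word_prod:
  assumes "group G" "h \<in> hom G (int_lattice d)" "\<psi> \<in> S \<rightarrow> carrier G" "set w \<subseteq> S" "j < d"
  shows "h (word_prod G \<psi> w) j = sum_list (map (\<lambda>s. h (\<psi> s) j) w)"
proof -
  have "group (int_lattice d)" by simp
  then interpret group_hom G "int_lattice d" h using assms by (simp add: group_hom_def group_hom_axioms_def)
  show ?thesis
    using assms(4)
  proof (induction w)
    case Nil
    then show ?case using assms(5) by (simp add: hom_one integer_group_def)
  next
    case (Cons s w)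
    then have "\<psi> s \<in> carrier G" "word_prod G \<psi> w \<in> carrier G"
      using assms(3) G.word_prod_closed[OF assms(3), of w] by auto
    then have "h (word_prod G \<psi> (s # w)) = h (\<psi> s) \<otimes>\<^bsub>int_lattice d\<^esub> h (word_prod G \<psi> w)" by (simp only: word_prod_simps hom_mult)
    then show ?case using Cons assms(5) by (simp add: integer_group_def)
  qed
qed

section \<open>From equal pressures to amenability\<close>

theorem proposition7p2:
  fixes S :: "'s set" and A :: "'s \<Rightarrow> 's \<Rightarrow> bool"
    and G :: "('g, 'm) monoid_scheme"
    and \<phi> :: "(nat \<Rightarrow> 's) \<Rightarrow> real" and \<psi> :: "'s \<Rightarrow> 'g"
    and d :: nat and \<iota> :: "'g set set \<Rightarrow> nat \<Rightarrow> int"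
    and f :: "'s \<Rightarrow> nat \<Rightarrow> int" and \<delta> :: ereal
    and a :: 's and \<xi> :: "nat \<Rightarrow> real"
  assumes "countable S"
    and "a \<in> S"
    and "topologically_mixing S A"
    and "BIP S A"
    and "group G"
    and "finitely_generated G"
    and "locally_Hoelder S A \<phi>"
    and "summable_potential S A \<phi>"
    and "\<psi> \<in> S \<rightarrow> carrier G"
    and "\<iota> \<in> iso (free_abelianization G) (int_lattice d)"
    and "f = (\<lambda>s. \<iota> (free_abelianization_proj G (\<psi> s)))"
    and "\<delta> = delta S A d \<phi> f"
    and assumption_I: "skew_mixing G S A \<psi>"
    and assumption_II: "\<delta> > 0"
    and assumption_III:
      "\<xi> \<in> Euclidean_space d interior_of delta_ball d \<delta>"
      "\<forall>w \<in> delta_ball d \<delta> - {\<xi>}. tilted_pressure S A d a \<phi> f \<xi> < tilted_pressure S A d a \<phi> f w"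
    and "skew_pressure G S A \<psi> a \<phi> = skew_pressure (int_lattice d) S A f a \<phi>"
  shows "amenable G"
proof (rule ccontr)
  assume not_amenable: "\<not> amenable G"
  interpret G: group G by fact
  have lattice: "group (int_lattice d)" by simp
  define h where "h g = \<iota> (free_abelianization_proj G g)" for g
  have f_eq: "f = (\<lambda>s. h (\<psi> s))" using assms(11) by (simp add: h_def)
  have \<iota>: "\<iota> \<in> hom (free_abelianization G) (int_lattice d)"
    "\<iota> ` carrier (free_abelianization G) = carrier (int_lattice d)"
    using assms(10) by (auto simp: iso_def bij_betw_def)
  have h: "h \<in> hom G (int_lattice d)"
    using Group.hom_compose[OF G.free_abelianization_proj_hom(1) \<iota>(1)] by (simp add: h_def[abs_def] o_def)
  have h_surj: "h ` carrier G = carrier (int_lattice d)"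
    using \<iota>(2) unfolding G.free_abelianization_proj_hom(2)[symmetric] by (simp add: h_def image_image)
  obtain C \<theta> where C: "0 < C" "0 < \<theta>" "\<theta> < 1"
    "\<forall>n\<ge>1. \<forall>w\<in>words S A n. \<forall>x\<in>cylinder S A w. \<forall>y\<in>cylinder S A w. \<bar>\<phi> x - \<phi> y\<bar> \<le> C * \<theta> ^ n"
    using assms(7) unfolding locally_Hoelder_def by (elim exE conjE) (rule that)
  have H\<phi>: "hoelder_shift S A \<phi> C \<theta>"
  proof
    show "\<bar>\<phi> x - \<phi> y\<bar> \<le> C * \<theta> ^ n"
      if "1 \<le> n" "w \<in> words S A n" "x \<in> cylinder S A w" "y \<in> cylinder S A w" for n w x y
      using C(4)[rule_format, OF that] .
  qed (fact C(1) C(2) C(3))+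
  interpret \<phi>: hoelder_shift S A \<phi> C \<theta> by (rule H\<phi>)
  let ?\<Phi> = "tilt d f \<phi> \<xi>"
  \<comment> \<open>Two potentials are in play: the lattice bound concerns \<phi>, whose tilts are
    minimised, while the contraction is applied to the potential tilted by \<xi>.\<close>
  interpret \<Phi>: hoelder_shift S A ?\<Phi> C \<theta> by (rule hoelder_shift_tilt[OF H\<phi>])
  have \<xi>: "\<xi> \<in> delta_ball d \<delta>" using interior_of_subset assumption_III(1) by (rule subsetD)
  then have "ereal (L2_set \<xi> {..<d}) < delta S A d \<phi> f" using assms(12) by (simp add: delta_ball_def)
  then obtain M where M: "M > 0" "\<And>x T. x \<in> markov_shift S A \<Longrightarrow> finite T \<Longrightarrow>
    (\<Sum>s | s \<in> T \<and> [s] \<frown> x \<in> markov_shift S A. exp (?\<Phi> ([s] \<frown> x))) \<le> M"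
    by (rule summable_tilt) (rule that)
  obtain B where B: "finite B" "B \<subseteq> S" "\<forall>s\<in>S. \<exists>b\<in>B. \<exists>b'\<in>B. A b s \<and> A s b'"
    using assms(4) unfolding BIP_def by (elim exE conjE) (rule that)
  interpret \<Phi>: group_extension S A ?\<Phi> C \<theta> G \<psi> B M
  proof
    show "\<exists>b\<in>B. \<exists>b'\<in>B. A b s \<and> A s b'" if "s \<in> S" for s using B(3) that by blast
    show "(\<Sum>s | s \<in> T \<and> [s] \<frown> x \<in> markov_shift S A. \<Phi>.weight [s] x) \<le> M"
      if "x \<in> markov_shift S A" "finite T" "T \<subseteq> S" for x T
      using M(2)[OF that(1,2)] by (simp add: \<Phi>.weight_def birkhoff_sum_def)
  qed (fact assms(9) assumption_I B(1) B(2) M(1))+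
  \<comment> \<open>The signed unit vectors, undefined from index \<open>d\<close> on as elements of
    \<open>int_lattice d\<close>. Surjectivity of \<open>h\<close> lifts them to \<open>G\<close>,
    and mixing realises the lifts by loops at \<open>a\<close> of one common length.\<close>
  define e where "e x = (\<lambda>j\<in>{..<d}. if j = fst x then snd x else (0::int))" for x :: "nat \<times> int"
  have "\<forall>x\<in>{..<d} \<times> {1, -1}. \<exists>g. g \<in> carrier G \<and> h g = e x"
  proof
    fix x :: "nat \<times> int"
    have "e x \<in> h ` carrier G" unfolding h_surj by (simp add: e_def integer_group_def)
    then obtain g where "e x = h g" "g \<in> carrier G" by (rule imageE)
    then show "\<exists>g. g \<in> carrier G \<and> h g = e x" by (intro exI[of _ g] conjI) simp_all
  qed
  from bchoice[OF this] obtain g where g: "\<forall>x\<in>{..<d} \<times> {1, -1}. g x \<in> carrier G \<and> h (g x) = e x" ..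
  have "\<exists>N. \<forall>n\<ge>N. \<exists>v. \<forall>x\<in>{..<d} \<times> {1, -1}. joins G S A \<psi> n a a (g x) (v x)"
    using g \<open>a \<in> S\<close> by (intro \<Phi>.mix_finite) auto
  then obtain N where N: "\<forall>n\<ge>N. \<exists>v. \<forall>x\<in>{..<d} \<times> {1, -1}. joins G S A \<psi> n a a (g x) (v x)" ..
  from N[rule_format, OF order_refl] obtain v where v: "\<forall>x\<in>{..<d} \<times> {1, -1}. joins G S A \<psi> N a a (g x) (v x)" ..
  have unit: "\<exists>w\<in>loops S A a. length w = Suc N \<and>
      (\<forall>j<d. sum_list (map (\<lambda>s. f s j) w) = (if j = i then \<sigma> else 0))"
    if "i < d" "\<sigma> \<in> {1, -1}" for i and \<sigma> :: int
  proof (intro bexI[of _ "a # v (i, \<sigma>)"] conjI allI impI)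
    have x: "(i, \<sigma>) \<in> {..<d} \<times> {1, -1}" using that by simp
    note v = v[rule_format, OF x]
    show "length (a # v (i, \<sigma>)) = Suc N" using v by simp
    have "successively A (a # v (i, \<sigma>)) \<and> A (last (a # v (i, \<sigma>))) a"
      using v successively_append_iff[of A "a # v (i, \<sigma>)" "[a]"] by simp
    moreover have S: "set (a # v (i, \<sigma>)) \<subseteq> S" using v \<open>a \<in> S\<close> by simp
    ultimately show "a # v (i, \<sigma>) \<in> loops S A a"
      by (simp add: loops_def iter_in_markov_shift)
    fix j assume j: "j < d"
    have "sum_list (map (\<lambda>s. f s j) (a # v (i, \<sigma>))) = h (g (i, \<sigma>)) j"
      unfolding f_eq using lattice_hom_word_prod[OF \<open>group G\<close> h assms(9) S j] v by simp
    also have "\<dots> = (if j = i then \<sigma> else 0)"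
      using g[rule_format, OF x] j by (simp add: e_def)
    finally show "sum_list (map (\<lambda>s. f s j) (a # v (i, \<sigma>))) = (if j = i then \<sigma> else 0)" .
  qed
  have "skew_pressure G S A \<psi> a ?\<Phi> < pressure S A a ?\<Phi>"
    by (rule \<Phi>.skew_pressure_less[OF not_amenable \<open>a \<in> S\<close>])
  also have "\<dots> \<le> skew_pressure (int_lattice d) S A f a \<phi>"
    by (rule \<phi>.lattice_pressure_ge[OF pressure_tilt_ge[OF \<xi> assumption_III(2)] zero_less_Suc unit])
  also have "\<dots> = skew_pressure G S A \<psi> a \<phi>" using assms(17) by simp
  also have "\<dots> = skew_pressure G S A \<psi> a ?\<Phi>"
  proof -
    have "birkhoff_sum ?\<Phi> n x = birkhoff_sum \<phi> n x"
      if "x \<in> markov_shift S A" "cocycle G \<psi> n x = \<one>\<^bsub>G\<^esub>" for n x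
    proof -
      have "cocycle (int_lattice d) f n x = h \<one>\<^bsub>G\<^esub>"
        using cocycle_hom[OF \<open>group G\<close> lattice h assms(9) that(1), of n] that(2) by (simp add: f_eq)
      also have "\<dots> = \<one>\<^bsub>int_lattice d\<^esub>" by (rule hom_one[OF h \<open>group G\<close> lattice])
      finally have "\<forall>i<d. (\<Sum>j<n. f ((shift ^^ j) x 0) i) = 0"
        by (simp only: lattice_cocycle_eq_one_iff)
      then show ?thesis by (simp add: birkhoff_sum_tilt)
    qed
    then show ?thesis
      unfolding skew_pressure_def by (intro arg_cong[where f = exp_growth] ext infsum_cong) auto
  qed
  finally show False by simp
qed

end
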